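(* There exist a connected non-Abelian Lie group $G$ and a connected complete hyperKähler manifold $M$ with an effective tri-Hamiltonian action of $G$ such that the hyperKähler moment map $\mu\colon M\to\mathrm{Im}\,\mathbb H\otimes\mathfrak g^*$ is not surjective and has some non-empty fibre that is not connected.
   Context: A hyperKähler manifold is a Riemannian manifold $(M,g)$ with complex structures $I,J,K$ satisfying the quaternion relations such that $g$ is Kähler with respect to each; $\omega_I,\omega_J,\omega_K$ are the Kähler forms. An action of a Lie group $G$ on $M$ is tri-Hamiltonian if it preserves each $\omega_A$ ($A=I,J,K$) and there are equivariant moment maps $\mu_A\colon M\to\mathfrak g^*$ with $d\langle\mu_A,X\rangle=X\lrcorner\,\omega_A$ for all $X\in\mathfrak g$. With $\mathrm{Im}\,\mathbb H\cong\mathbb R^3$ the imaginary quaternions, $\mu=(\mu_I,\mu_J,\mu_K)\colon M\to\mathrm{Im}\,\mathbb H\otimes\mathfrak g^*$ is the hyperKähler moment map. *)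

theory Defs
  imports "HOL-Analysis.Analysis" "HOL-Algebra.Group_Action"
begin

section \<open>Smooth functions on open subsets of Euclidean n-space\<close>

text \<open>
  \<^term>\<open>Euclidean_space n\<close> is the set of sequences vanishing from index \<open>n\<close> on, so the
  dimension is an ordinary natural number and can be quantified. Indices run over \<open>0, ..., n - 1\<close>.
\<close>

definition pd :: "nat \<Rightarrow> ((nat \<Rightarrow> real) \<Rightarrow> real) \<Rightarrow> (nat \<Rightarrow> real) \<Rightarrow> real" where
  "pd i f x = deriv (\<lambda>t. f (x(i := t))) (x i)"

primrec Ck_on :: "nat \<Rightarrow> nat \<Rightarrow> (nat \<Rightarrow> real) set \<Rightarrow> ((nat \<Rightarrow> real) \<Rightarrow> real) \<Rightarrow> bool" where
  "Ck_on n 0 U f \<longleftrightarrow> continuous_map (subtopology (Euclidean_space n) U) euclideanreal f"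
| "Ck_on n (Suc k) U f \<longleftrightarrow>
     continuous_map (subtopology (Euclidean_space n) U) euclideanreal f \<and>
     (\<forall>i<n. (\<forall>x\<in>U. (\<lambda>t. f (x(i := t))) differentiable (at (x i))) \<and> Ck_on n k U (pd i f))"

definition smooth_on :: "nat \<Rightarrow> (nat \<Rightarrow> real) set \<Rightarrow> ((nat \<Rightarrow> real) \<Rightarrow> real) \<Rightarrow> bool" where
  "smooth_on n U f \<longleftrightarrow> (\<forall>k. Ck_on n k U f)"

section \<open>Smooth manifolds\<close>

type_synonym 'a chart = "'a set \<times> ('a \<Rightarrow> nat \<Rightarrow> real)"

record 'a manifold =
  mtop :: "'a topology"
  mdim :: nat
  atlas :: "'a chart set"

abbreviation points :: "'a manifold \<Rightarrow> 'a set" where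
  "points M \<equiv> topspace (mtop M)"

abbreviation chart_inv :: "'a chart \<Rightarrow> (nat \<Rightarrow> real) \<Rightarrow> 'a" where
  "chart_inv c \<equiv> inv_into (fst c) (snd c)"

definition is_chart :: "'a topology \<Rightarrow> nat \<Rightarrow> 'a chart \<Rightarrow> bool" where
  "is_chart X n c \<longleftrightarrow>
     openin X (fst c) \<and> openin (Euclidean_space n) (snd c ` fst c) \<and>
     homeomorphic_map (subtopology X (fst c))
       (subtopology (Euclidean_space n) (snd c ` fst c)) (snd c)"

definition smooth_transition :: "nat \<Rightarrow> 'a chart \<Rightarrow> 'a chart \<Rightarrow> bool" where
  "smooth_transition n c d \<longleftrightarrow>
     (\<forall>j<n. smooth_on n (snd c ` (fst c \<inter> fst d)) (\<lambda>x. snd d (chart_inv c x) j))"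

definition second_countable_space :: "'a topology \<Rightarrow> bool" where
  "second_countable_space X \<longleftrightarrow>
     (\<exists>B. countable B \<and> (\<forall>V\<in>B. openin X V) \<and>
        (\<forall>U x. openin X U \<and> x \<in> U \<longrightarrow> (\<exists>V\<in>B. x \<in> V \<and> V \<subseteq> U)))"

text \<open>The atlas is not required to be maximal; it determines the smooth structure.\<close>

definition smooth_manifold :: "'a manifold \<Rightarrow> bool" where
  "smooth_manifold M \<longleftrightarrow>
     Hausdorff_space (mtop M) \<and> second_countable_space (mtop M) \<and>
     (\<forall>c\<in>atlas M. is_chart (mtop M) (mdim M) c) \<and>
     (\<Union>c\<in>atlas M. fst c) = points M \<and>
     (\<forall>c\<in>atlas M. \<forall>d\<in>atlas M. smooth_transition (mdim M) c d)"

definition compatible_chart :: "'a manifold \<Rightarrow> 'a chart \<Rightarrow> bool" where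
  "compatible_chart M c \<longleftrightarrow>
     is_chart (mtop M) (mdim M) c \<and>
     (\<forall>d\<in>atlas M. smooth_transition (mdim M) c d \<and> smooth_transition (mdim M) d c)"

text \<open>Values of functions off the set of points are irrelevant.\<close>

definition smooth_funs :: "'a manifold \<Rightarrow> ('a \<Rightarrow> real) set" where
  "smooth_funs M =
     {f. \<forall>c\<in>atlas M. smooth_on (mdim M) (snd c ` fst c) (\<lambda>x. f (chart_inv c x))}"

definition smooth_map :: "'a manifold \<Rightarrow> 'b manifold \<Rightarrow> ('a \<Rightarrow> 'b) \<Rightarrow> bool" where
  "smooth_map M N F \<longleftrightarrow>
     continuous_map (mtop M) (mtop N) F \<and>
     (\<forall>c\<in>atlas M. \<forall>d\<in>atlas N. \<forall>j<mdim N.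
        smooth_on (mdim M) (snd c ` (fst c \<inter> F -` fst d))
          (\<lambda>x. snd d (F (chart_inv c x)) j))"

definition prod_chart :: "nat \<Rightarrow> 'a chart \<Rightarrow> 'b chart \<Rightarrow> ('a \<times> 'b) chart" where
  "prod_chart m c d =
     (fst c \<times> fst d, \<lambda>(x, y) i. if i < m then snd c x i else snd d y (i - m))"

definition prod_manifold :: "'a manifold \<Rightarrow> 'b manifold \<Rightarrow> ('a \<times> 'b) manifold" where
  "prod_manifold M N =
     \<lparr>mtop = prod_topology (mtop M) (mtop N), mdim = mdim M + mdim N,
      atlas = {prod_chart (mdim M) c d | c d. c \<in> atlas M \<and> d \<in> atlas N}\<rparr>"

section \<open>Tangent vectors\<close>

text \<open>
  A tangent vector at \<open>p\<close> is a directional derivative operator on the smooth functions, i.e. a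
  linear combination of the coordinate derivations of a chart around \<open>p\<close>. Operators are extended
  by 0 to functions that are not smooth, so that equal tangent vectors are equal as functions.
\<close>

type_synonym 'a tvec = "('a \<Rightarrow> real) \<Rightarrow> real"

definition coord_vec :: "'a manifold \<Rightarrow> 'a chart \<Rightarrow> 'a \<Rightarrow> nat \<Rightarrow> 'a tvec" where
  "coord_vec M c p i =
     (\<lambda>f. if f \<in> smooth_funs M then pd i (\<lambda>x. f (chart_inv c x)) (snd c p) else 0)"

definition tangent_space :: "'a manifold \<Rightarrow> 'a \<Rightarrow> 'a tvec set" where
  "tangent_space M p =
     {v. \<exists>c\<in>atlas M. p \<in> fst c \<and>
           (\<exists>a :: nat \<Rightarrow> real. v = (\<lambda>f. \<Sum>i<mdim M. a i * coord_vec M c p i f))}"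

definition pushforward :: "'b manifold \<Rightarrow> ('a \<Rightarrow> 'b) \<Rightarrow> 'a tvec \<Rightarrow> 'b tvec" where
  "pushforward N F v = (\<lambda>f. if f \<in> smooth_funs N then v (\<lambda>x. f (F x)) else 0)"

definition linear_functional_on :: "'a tvec set \<Rightarrow> ('a tvec \<Rightarrow> real) \<Rightarrow> bool" where
  "linear_functional_on T L \<longleftrightarrow>
     (\<forall>v\<in>T. \<forall>w\<in>T. \<forall>a b. L (\<lambda>f. a * v f + b * w f) = a * L v + b * L w)"

definition endomorphism_on :: "'a tvec set \<Rightarrow> ('a tvec \<Rightarrow> 'a tvec) \<Rightarrow> bool" where
  "endomorphism_on T L \<longleftrightarrow>
     (\<forall>v\<in>T. L v \<in> T) \<and>
     (\<forall>v\<in>T. \<forall>w\<in>T. \<forall>a b. L (\<lambda>f. a * v f + b * w f) = (\<lambda>f. a * L v f + b * L w f))"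

section \<open>Riemannian metrics and completeness\<close>

type_synonym 'a bilin = "'a \<Rightarrow> 'a tvec \<Rightarrow> 'a tvec \<Rightarrow> real"
type_synonym 'a endo = "'a \<Rightarrow> 'a tvec \<Rightarrow> 'a tvec"

definition riemannian_metric :: "'a manifold \<Rightarrow> 'a bilin \<Rightarrow> bool" where
  "riemannian_metric M g \<longleftrightarrow>
     (\<forall>p\<in>points M.
        (\<forall>v\<in>tangent_space M p. linear_functional_on (tangent_space M p) (g p v)) \<and>
        (\<forall>v\<in>tangent_space M p. \<forall>w\<in>tangent_space M p. g p v w = g p w v) \<and>
        (\<forall>v\<in>tangent_space M p. v \<noteq> (\<lambda>f. 0) \<longrightarrow> g p v v > 0)) \<and>
     (\<forall>c\<in>atlas M. \<forall>i<mdim M. \<forall>j<mdim M.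
        smooth_on (mdim M) (snd c ` fst c)
          (\<lambda>x. g (chart_inv c x) (coord_vec M c (chart_inv c x) i)
                  (coord_vec M c (chart_inv c x) j)))"

definition velocity :: "'a manifold \<Rightarrow> (real \<Rightarrow> 'a) \<Rightarrow> real \<Rightarrow> 'a tvec" where
  "velocity M \<gamma> t = (\<lambda>f. if f \<in> smooth_funs M then deriv (\<lambda>s. f (\<gamma> s)) t else 0)"

text \<open>
  A continuous curve is \<open>C\<^sup>1\<close> on an interval iff its composition with every smooth function is.
  The set \<open>S\<close> contains the break points; derivatives at the end points of the intervals between
  break points are one-sided.
\<close>

definition piecewise_C1_curve :: "'a manifold \<Rightarrow> (real \<Rightarrow> 'a) \<Rightarrow> bool" where
  "piecewise_C1_curve M \<gamma> \<longleftrightarrow>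
     continuous_map (top_of_set {0..1}) (mtop M) \<gamma> \<and>
     (\<exists>S. finite S \<and>
        (\<forall>a b. 0 \<le> a \<and> a < b \<and> b \<le> 1 \<and> {a<..<b} \<inter> S = {} \<longrightarrow>
           (\<forall>f\<in>smooth_funs M. \<exists>D. continuous_on {a..b} D \<and>
              (\<forall>t\<in>{a..b}. ((\<lambda>s. f (\<gamma> s)) has_real_derivative D t) (at t within {a..b})))))"

text \<open>The finitely many break points and end points do not affect the integral.\<close>

definition curve_length :: "'a manifold \<Rightarrow> 'a bilin \<Rightarrow> (real \<Rightarrow> 'a) \<Rightarrow> real" where
  "curve_length M g \<gamma> =
     integral {0..1} (\<lambda>t. sqrt (g (\<gamma> t) (velocity M \<gamma> t) (velocity M \<gamma> t)))"

text \<open>Meaningful for connected \<open>M\<close>; set to 0 off \<open>M\<close>, as \<^const>\<open>Metric_space\<close> requires of a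
  distance that it be symmetric and non-negative everywhere.\<close>

definition riemannian_dist :: "'a manifold \<Rightarrow> 'a bilin \<Rightarrow> 'a \<Rightarrow> 'a \<Rightarrow> real" where
  "riemannian_dist M g p q =
     (if p \<in> points M \<and> q \<in> points M
      then Inf {curve_length M g \<gamma> | \<gamma>. piecewise_C1_curve M \<gamma> \<and> \<gamma> 0 = p \<and> \<gamma> 1 = q}
      else 0)"

definition complete_riemannian :: "'a manifold \<Rightarrow> 'a bilin \<Rightarrow> bool" where
  "complete_riemannian M g \<longleftrightarrow>
     Metric_space (points M) (riemannian_dist M g) \<and>
     Metric_space.mcomplete (points M) (riemannian_dist M g)"

section \<open>Kaehler and hyperKaehler structures\<close>

definition almost_complex_structure :: "'a manifold \<Rightarrow> 'a endo \<Rightarrow> bool" where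
  "almost_complex_structure M A \<longleftrightarrow>
     (\<forall>p\<in>points M. endomorphism_on (tangent_space M p) (A p) \<and>
        (\<forall>v\<in>tangent_space M p. A p (A p v) = (\<lambda>f. - v f))) \<and>
     (\<forall>c\<in>atlas M. \<forall>i<mdim M. \<forall>f\<in>smooth_funs M.
        smooth_on (mdim M) (snd c ` fst c)
          (\<lambda>x. A (chart_inv c x) (coord_vec M c (chart_inv c x) i) f))"

text \<open>
  A complex structure is the almost complex structure of a holomorphic atlas: around every point
  there are coordinates \<open>z\<^sub>k = x\<^bsub>2k\<^esub> + i x\<^bsub>2k+1\<^esub>\<close> in which \<open>A\<close> is multiplication by \<open>i\<close>
  (transition functions between such charts are then holomorphic).
\<close>

definition complex_structure :: "'a manifold \<Rightarrow> 'a endo \<Rightarrow> bool" where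
  "complex_structure M A \<longleftrightarrow>
     almost_complex_structure M A \<and>
     (\<exists>m. mdim M = 2 * m \<and>
        (\<forall>p\<in>points M. \<exists>c. compatible_chart M c \<and> p \<in> fst c \<and>
           (\<forall>q\<in>fst c. \<forall>k<m.
              A q (coord_vec M c q (2 * k)) = coord_vec M c q (2 * k + 1) \<and>
              A q (coord_vec M c q (2 * k + 1)) = (\<lambda>f. - coord_vec M c q (2 * k) f))))"

definition kahler_form :: "'a bilin \<Rightarrow> 'a endo \<Rightarrow> 'a bilin" where
  "kahler_form g A p v w = g p (A p v) w"

definition form_component ::
  "'a manifold \<Rightarrow> 'a bilin \<Rightarrow> 'a chart \<Rightarrow> nat \<Rightarrow> nat \<Rightarrow> (nat \<Rightarrow> real) \<Rightarrow> real" where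
  "form_component M \<omega> c i j x =
     \<omega> (chart_inv c x) (coord_vec M c (chart_inv c x) i) (coord_vec M c (chart_inv c x) j)"

text \<open>Vanishing of the components of the exterior derivative.\<close>

definition closed_2form :: "'a manifold \<Rightarrow> 'a bilin \<Rightarrow> bool" where
  "closed_2form M \<omega> \<longleftrightarrow>
     (\<forall>c\<in>atlas M. \<forall>i<mdim M. \<forall>j<mdim M. \<forall>k<mdim M. \<forall>x\<in>snd c ` fst c.
        pd i (form_component M \<omega> c j k) x + pd j (form_component M \<omega> c k i) x
          + pd k (form_component M \<omega> c i j) x = 0)"

definition kahler :: "'a manifold \<Rightarrow> 'a bilin \<Rightarrow> 'a endo \<Rightarrow> bool" where
  "kahler M g A \<longleftrightarrow>
     complex_structure M A \<and>
     (\<forall>p\<in>points M. \<forall>v\<in>tangent_space M p. \<forall>w\<in>tangent_space M p.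
        g p (A p v) (A p w) = g p v w) \<and>
     closed_2form M (kahler_form g A)"

definition hyperkahler ::
  "'a manifold \<Rightarrow> 'a bilin \<Rightarrow> 'a endo \<Rightarrow> 'a endo \<Rightarrow> 'a endo \<Rightarrow> bool" where
  "hyperkahler M g I J K \<longleftrightarrow>
     smooth_manifold M \<and> riemannian_metric M g \<and>
     kahler M g I \<and> kahler M g J \<and> kahler M g K \<and>
     (\<forall>p\<in>points M. \<forall>v\<in>tangent_space M p.
        I p (J p v) = K p v \<and> J p (I p v) = (\<lambda>f. - K p v f))"

section \<open>Lie groups and tri-Hamiltonian actions\<close>

definition lie_group :: "('g, 'z) monoid_scheme \<Rightarrow> 'g manifold \<Rightarrow> bool" where
  "lie_group G MG \<longleftrightarrow>
     group G \<and> smooth_manifold MG \<and> points MG = carrier G \<and>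
     smooth_map (prod_manifold MG MG) MG (\<lambda>(x, y). x \<otimes>\<^bsub>G\<^esub> y) \<and>
     smooth_map MG MG (\<lambda>x. inv\<^bsub>G\<^esub> x)"

definition lie_algebra :: "('g, 'z) monoid_scheme \<Rightarrow> 'g manifold \<Rightarrow> 'g tvec set" where
  "lie_algebra G MG = tangent_space MG \<one>\<^bsub>G\<^esub>"

definition lie_algebra_dual ::
  "('g, 'z) monoid_scheme \<Rightarrow> 'g manifold \<Rightarrow> ('g tvec \<Rightarrow> real) set" where
  "lie_algebra_dual G MG =
     {\<alpha> \<in> extensional (lie_algebra G MG). linear_functional_on (lie_algebra G MG) \<alpha>}"

text \<open>\<open>Im H \<otimes> g\<^sup>*\<close>, a triple being the components along the basis \<open>i, j, k\<close> of \<open>Im H\<close>.\<close>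

definition imH_dual ::
  "('g, 'z) monoid_scheme \<Rightarrow> 'g manifold \<Rightarrow>
     (('g tvec \<Rightarrow> real) \<times> ('g tvec \<Rightarrow> real) \<times> ('g tvec \<Rightarrow> real)) set" where
  "imH_dual G MG =
     lie_algebra_dual G MG \<times> lie_algebra_dual G MG \<times> lie_algebra_dual G MG"

definition Ad :: "('g, 'z) monoid_scheme \<Rightarrow> 'g manifold \<Rightarrow> 'g \<Rightarrow> 'g tvec \<Rightarrow> 'g tvec" where
  "Ad G MG h = pushforward MG (\<lambda>x. h \<otimes>\<^bsub>G\<^esub> x \<otimes>\<^bsub>G\<^esub> inv\<^bsub>G\<^esub> h)"

definition smooth_action ::
  "('g, 'z) monoid_scheme \<Rightarrow> 'g manifold \<Rightarrow> 'a manifold \<Rightarrow> ('g \<Rightarrow> 'a \<Rightarrow> 'a) \<Rightarrow> bool" where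
  "smooth_action G MG M act \<longleftrightarrow>
     group_action G (points M) act \<and>
     smooth_map (prod_manifold MG M) M (\<lambda>(h, p). act h p)"

text \<open>The derivative at \<open>t = 0\<close> of \<open>exp(tX) p\<close> is the image of \<open>X\<close> under the derivative of the
  orbit map of \<open>p\<close>.\<close>

definition fundamental_field ::
  "'a manifold \<Rightarrow> ('g \<Rightarrow> 'a \<Rightarrow> 'a) \<Rightarrow> 'g tvec \<Rightarrow> 'a \<Rightarrow> 'a tvec" where
  "fundamental_field M act X p = pushforward M (\<lambda>h. act h p) X"

definition preserves_form ::
  "('g, 'z) monoid_scheme \<Rightarrow> 'a manifold \<Rightarrow> ('g \<Rightarrow> 'a \<Rightarrow> 'a) \<Rightarrow> 'a bilin \<Rightarrow> bool" where
  "preserves_form G M act \<omega> \<longleftrightarrow>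
     (\<forall>h\<in>carrier G. \<forall>p\<in>points M. \<forall>v\<in>tangent_space M p. \<forall>w\<in>tangent_space M p.
        \<omega> (act h p) (pushforward M (act h) v) (pushforward M (act h) w) = \<omega> p v w)"

text \<open>In the third conjunct, the differential of the function \<open>\<langle>\<mu>, X\<rangle>\<close> applied to the tangent
  vector \<open>v\<close> is \<open>v\<close> applied to the function. The last one is equivariance for the coadjoint
  action.\<close>

definition equivariant_moment_map ::
  "('g, 'z) monoid_scheme \<Rightarrow> 'g manifold \<Rightarrow> 'a manifold \<Rightarrow> ('g \<Rightarrow> 'a \<Rightarrow> 'a) \<Rightarrow>
     'a bilin \<Rightarrow> ('a \<Rightarrow> 'g tvec \<Rightarrow> real) \<Rightarrow> bool" where
  "equivariant_moment_map G MG M act \<omega> \<mu> \<longleftrightarrow>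
     (\<forall>p\<in>points M. \<mu> p \<in> lie_algebra_dual G MG) \<and>
     (\<forall>X\<in>lie_algebra G MG. (\<lambda>p. \<mu> p X) \<in> smooth_funs M) \<and>
     (\<forall>X\<in>lie_algebra G MG. \<forall>p\<in>points M. \<forall>v\<in>tangent_space M p.
        v (\<lambda>q. \<mu> q X) = \<omega> p (fundamental_field M act X p) v) \<and>
     (\<forall>h\<in>carrier G. \<forall>p\<in>points M. \<forall>X\<in>lie_algebra G MG.
        \<mu> (act h p) X = \<mu> p (Ad G MG (inv\<^bsub>G\<^esub> h) X))"

definition hyperkahler_moment_map ::
  "('g, 'z) monoid_scheme \<Rightarrow> 'g manifold \<Rightarrow> 'a manifold \<Rightarrow> 'a bilin \<Rightarrow>
     'a endo \<Rightarrow> 'a endo \<Rightarrow> 'a endo \<Rightarrow> ('g \<Rightarrow> 'a \<Rightarrow> 'a) \<Rightarrow>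
     ('a \<Rightarrow> ('g tvec \<Rightarrow> real) \<times> ('g tvec \<Rightarrow> real) \<times> ('g tvec \<Rightarrow> real)) \<Rightarrow> bool" where
  "hyperkahler_moment_map G MG M g I J K act \<mu> \<longleftrightarrow>
     equivariant_moment_map G MG M act (kahler_form g I) (\<lambda>p. fst (\<mu> p)) \<and>
     equivariant_moment_map G MG M act (kahler_form g J) (\<lambda>p. fst (snd (\<mu> p))) \<and>
     equivariant_moment_map G MG M act (kahler_form g K) (\<lambda>p. snd (snd (\<mu> p)))"

definition tri_hamiltonian ::
  "('g, 'z) monoid_scheme \<Rightarrow> 'g manifold \<Rightarrow> 'a manifold \<Rightarrow> 'a bilin \<Rightarrow>
     'a endo \<Rightarrow> 'a endo \<Rightarrow> 'a endo \<Rightarrow> ('g \<Rightarrow> 'a \<Rightarrow> 'a) \<Rightarrow> bool" where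
  "tri_hamiltonian G MG M g I J K act \<longleftrightarrow>
     smooth_action G MG M act \<and>
     preserves_form G M act (kahler_form g I) \<and>
     preserves_form G M act (kahler_form g J) \<and>
     preserves_form G M act (kahler_form g K) \<and>
     (\<exists>\<mu>. hyperkahler_moment_map G MG M g I J K act \<mu>)"

text \<open>
  For existence statements about manifolds, points may be labelled by elements of a type of the
  cardinality of the continuum, since a second countable manifold has at most that many points.
  The topology is part of the data and unrelated to that of the type.
\<close>

type_synonym label = "nat \<Rightarrow> real"

end

theory Submission
  imports Defs
begin

text \<open>
  The unit quaternions act on the flat hyperKaehler space of quaternions by left multiplication, the
  complex structures being right multiplications by imaginary units. With \<open>A\<close> right multiplication
  by the imaginary unit \<open>a\<close>, the moment map is \<open>\<mu>\<^sub>A(p)(X) = g(Xpa, p) / 2\<close>, so the three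
  components of \<open>\<mu>(p)\<close> are pairwise orthogonal vectors \<open>-p a p\<^sup>*\<close> (up to a factor) of common length
  \<open>|p|\<^sup>2\<close>: no value has exactly one non-zero component, and the fibre over \<open>\<mu>(1)\<close> is \<open>{1, -1}\<close>.
  Completeness holds because the Riemannian distance of the flat metric is the Euclidean one.
\<close>

section \<open>Calculus on open subsets of Euclidean n-space\<close>

text \<open>For p non-zero, a -> p a p^* is |p|^2 times a rotation. So the image of the moment map
  is a cone over the rotation group inside a 9-dimensional target, and the double cover of that
  group by the unit quaternions is what splits the fibres. Most of the work is to fit this into
  definitions by atlases, where smoothness means iterated partial derivatives on relatively open
  sets. Two choices keep that manageable. Every chart in use has the whole of R^n as its image:
  coordinate permutations, the two stereographic projections (each omits a single point), and their
  products. Conditions on charts thereby become smoothness of explicit rational formulas. Moreover,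
  a tangent vector is determined by its values on the ambient coordinate functions, so metric,
  complex structures and moment map are defined through these values, and the geometric identities
  turn into polynomial identities in four coordinates.\<close>

lemma Euclidean_space_eq_top_of_set:
  "Euclidean_space n = top_of_set (topspace (Euclidean_space n))"
  by (simp add: Euclidean_space_def euclidean_product_topology)

lemma continuous_map_subtopology_Euclidean_space:
  assumes "openin (Euclidean_space n) U"
  shows "continuous_map (subtopology (Euclidean_space n) U) euclideanreal f \<longleftrightarrow> continuous_on U f"
proof -
  have "subtopology (Euclidean_space n) U = top_of_set U"
    using openin_subset[OF assms]
    by (subst Euclidean_space_eq_top_of_set) (simp add: subtopology_subtopology Int_absorb1)
  then show ?thesis by simp
qed

lemma continuous_fun_upd: "continuous_on UNIV (\<lambda>t::real. x(i := t))"
  for x :: "nat \<Rightarrow> real"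
proof (rule continuous_on_coordinatewise_then_product)
  show "continuous_on UNIV (\<lambda>t. (x(i := t)) j)" for j
    by (cases "j = i") auto
qed

lemma fun_upd_topspace_Euclidean_space:
  "x \<in> topspace (Euclidean_space n) \<Longrightarrow> i < n \<Longrightarrow> x(i := t) \<in> topspace (Euclidean_space n)"
  by (auto simp: topspace_Euclidean_space)

text \<open>\<open>U\<close> is open only relative to \<open>Euclidean_space n\<close>, but changing
  a coordinate below \<open>n\<close> does not leave that space. So \<open>pd i\<close> with
  \<open>i < n\<close> depends on values in \<open>U\<close> alone, which is what the congruence
  lemmas rest on.\<close>

lemma eventually_fun_upd_in:
  assumes U: "openin (Euclidean_space n) U" and x: "x \<in> U" and i: "i < n"
  shows "\<forall>\<^sub>F t in nhds (x i). x(i := t) \<in> U"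
proof -
  obtain T where T: "open T" "U = topspace (Euclidean_space n) \<inter> T"
    using U by (subst (asm) Euclidean_space_eq_top_of_set) (auto simp: openin_open)
  have "open ((\<lambda>t. x(i := t)) -` T)"
    using T(1) continuous_fun_upd by (rule open_vimage)
  moreover have "x i \<in> (\<lambda>t. x(i := t)) -` T" using x T by simp
  ultimately have "\<forall>\<^sub>F t in nhds (x i). x(i := t) \<in> T"
    by (auto simp: eventually_nhds)
  then show ?thesis
    by eventually_elim (use x i T fun_upd_topspace_Euclidean_space[of x n i] in auto)
qed

lemma openin_Euclidean_space_box:
  assumes U: "openin (Euclidean_space n) U" and p: "p \<in> U"
  obtains \<delta> where "\<delta> > 0"
    "\<And>y. y \<in> topspace (Euclidean_space n) \<Longrightarrow> (\<And>i. i < n \<Longrightarrow> \<bar>y i - p i\<bar> < \<delta>) \<Longrightarrow> y \<in> U"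
proof -
  obtain T where T: "openin (powertop_real UNIV) T" "U = topspace (Euclidean_space n) \<inter> T"
    using U by (auto simp: Euclidean_space_def openin_subtopology)
  from product_topology_open_contains_basis[OF T(1), of p] p T(2)
  obtain X where X: "p \<in> Pi\<^sub>E UNIV X" "\<And>i. open (X i)" "Pi\<^sub>E UNIV X \<subseteq> T"
    by auto
  \<comment> \<open>Only the factors below \<open>n\<close> matter, since points of the space agree
    (being 0) in all later coordinates; a minimum of finitely many radii therefore suffices.\<close>
  have "\<exists>\<delta>>0. \<forall>i<m. \<forall>s. \<bar>s - p i\<bar> < \<delta> \<longrightarrow> s \<in> X i" for m
  proof (induction m)
    case 0 show ?case by (intro exI[of _ 1]) auto
  next
    case (Suc m)
    then obtain d where d: "d > 0" "\<forall>i<m. \<forall>s. \<bar>s - p i\<bar> < d \<longrightarrow> s \<in> X i" by blast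
    have "p m \<in> X m" using X(1) by auto
    then obtain e where e: "e > 0" "\<forall>s. dist s (p m) < e \<longrightarrow> s \<in> X m"
      using X(2)[of m] unfolding open_dist by blast
    show ?case
      by (intro exI[of _ "min d e"]) (use d e in \<open>auto simp: less_Suc_eq dist_real_def\<close>)
  qed
  from this[of n] obtain \<delta> where \<delta>: "\<delta> > 0" "\<And>i s. i < n \<Longrightarrow> \<bar>s - p i\<bar> < \<delta> \<Longrightarrow> s \<in> X i"
    by auto
  show thesis
  proof (rule that[OF \<delta>(1)])
    fix y assume y: "y \<in> topspace (Euclidean_space n)" "\<And>i. i < n \<Longrightarrow> \<bar>y i - p i\<bar> < \<delta>"
    have "y i \<in> X i" for i
    proof (cases "i < n")
      case False
      then have "y i = p i" using y(1) p T(2) by (simp add: topspace_Euclidean_space)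
      then show ?thesis using X(1) by auto
    qed (use y(2) \<delta>(2) in auto)
    then have "y \<in> T" using X(3) by auto
    then show "y \<in> U" using y(1) T(2) by blast
  qed
qed

lemma continuous_on_Euclidean_space_box:
  fixes f :: "(nat \<Rightarrow> real) \<Rightarrow> real"
  assumes U: "openin (Euclidean_space n) U" and p: "p \<in> U" and f: "continuous_on U f" and "e > 0"
  obtains \<delta> where "\<delta> > 0"
    "\<And>y. y \<in> topspace (Euclidean_space n) \<Longrightarrow> (\<And>i. i < n \<Longrightarrow> \<bar>y i - p i\<bar> < \<delta>)
       \<Longrightarrow> y \<in> U \<and> \<bar>f y - f p\<bar> < e"
proof -
  have "openin (top_of_set U) (U \<inter> f -` ball (f p) e)"
    by (rule continuous_openin_preimage_gen[OF f]) simp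
  then have "openin (Euclidean_space n) (U \<inter> f -` ball (f p) e)"
    by (metis U Euclidean_space_eq_top_of_set openin_trans)
  moreover have "p \<in> U \<inter> f -` ball (f p) e" using p \<open>e > 0\<close> by simp
  ultimately show thesis
    by (rule openin_Euclidean_space_box) (use that in \<open>auto simp: dist_real_def abs_minus_commute\<close>)
qed

section \<open>Partial derivatives and the chain rule along curves\<close>

lemma DERIV_pd:
  assumes "(\<lambda>t. f (x(i := t))) differentiable (at (x i))"
  shows "((\<lambda>t. f (x(i := t))) has_real_derivative pd i f x) (at (x i))"
  using assms unfolding pd_def
  by (simp add: DERIV_deriv_iff_real_differentiable)

lemma pd_eqI: "((\<lambda>t. f (x(i := t))) has_real_derivative D) (at (x i)) \<Longrightarrow> pd i f x = D"
  unfolding pd_def by (rule DERIV_imp_deriv)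

lemma DERIV_differentiable: "(f has_real_derivative D) (at x) \<Longrightarrow> f differentiable (at x)"
  using real_differentiable_def by blast

text \<open>A mean value estimate in one coordinate whose error is uniform in the base point
  \<open>y\<close> near \<open>p\<close>. The chain rule needs this uniformity because its base
  point moves with the curve parameter.\<close>

lemma pd_increment_bound:
  assumes U: "openin (Euclidean_space n) U" and p: "p \<in> U" and j: "j < n"
    and f: "\<And>y. y \<in> U \<Longrightarrow> (\<lambda>t. f (y(j := t))) differentiable (at (y j))"
    and c: "continuous_on U (pd j f)" and "e > 0"
  obtains \<delta> where "\<delta> > 0"
    "\<And>y b. y \<in> topspace (Euclidean_space n) \<Longrightarrow> (\<And>i. i < n \<Longrightarrow> \<bar>y i - p i\<bar> < \<delta>) \<Longrightarrow> \<bar>b - p j\<bar> < \<delta>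
       \<Longrightarrow> \<bar>f (y(j := b)) - f y - pd j f p * (b - y j)\<bar> \<le> e * \<bar>b - y j\<bar>"
proof -
  obtain \<delta> where \<delta>: "\<delta> > 0"
    "\<And>y. y \<in> topspace (Euclidean_space n) \<Longrightarrow> (\<And>i. i < n \<Longrightarrow> \<bar>y i - p i\<bar> < \<delta>)
       \<Longrightarrow> y \<in> U \<and> \<bar>pd j f y - pd j f p\<bar> < e"
    using continuous_on_Euclidean_space_box[OF U p c \<open>e > 0\<close>] by blast
  show thesis
  proof (rule that[OF \<delta>(1)])
    fix y b assume y: "y \<in> topspace (Euclidean_space n)" "\<And>i. i < n \<Longrightarrow> \<bar>y i - p i\<bar> < \<delta>"
      and b: "\<bar>b - p j\<bar> < \<delta>"
    \<comment> \<open>Subtracting the linear term turns the small oscillation of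
      \<open>pd j f\<close> near \<open>p\<close> into a small derivative of
      \<open>h\<close>.\<close>
    define h where "h = (\<lambda>t. f (y(j := t)) - pd j f p * t)"
    have "norm (h b - h (y j)) \<le> e * norm (b - y j)"
    proof (rule field_differentiable_bound[of "ball (p j) \<delta>" h "\<lambda>s. pd j f (y(j := s)) - pd j f p"])
      fix s assume "s \<in> ball (p j) \<delta>"
      then have *: "y(j := s) \<in> U \<and> \<bar>pd j f (y(j := s)) - pd j f p\<bar> < e"
        by (intro \<delta>(2) fun_upd_topspace_Euclidean_space y(1) j)
           (use y(2) in \<open>auto simp: dist_real_def abs_minus_commute\<close>)
      have "((\<lambda>t. f ((y(j := s))(j := t))) has_real_derivative pd j f (y(j := s))) (at ((y(j := s)) j))"
        by (rule DERIV_pd, rule f, rule conjunct1[OF *])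
      then have "((\<lambda>t. f (y(j := t))) has_real_derivative pd j f (y(j := s))) (at s)"
        unfolding fun_upd_upd fun_upd_same .
      then show "(h has_real_derivative pd j f (y(j := s)) - pd j f p) (at s within ball (p j) \<delta>)"
        unfolding h_def
        by (rule has_field_derivative_at_within[OF DERIV_diff[OF _ DERIV_cmult_Id]])
      show "norm (pd j f (y(j := s)) - pd j f p) \<le> e" using * by simp
    qed (use b y(2)[OF j] in \<open>auto simp: dist_real_def abs_minus_commute\<close>)
    then show "\<bar>f (y(j := b)) - f y - pd j f p * (b - y j)\<bar> \<le> e * \<bar>b - y j\<bar>"
      by (simp add: h_def algebra_simps)
  qed
qed

text \<open>Continuity of the partial derivatives suffices, without a total derivative: the
  increment of \<open>f\<close> is telescoped by switching one coordinate at a time from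
  \<open>\<gamma> t0\<close> to \<open>\<gamma> t\<close>.\<close>

lemma chain_rule_curve:
  assumes U: "openin (Euclidean_space n) U" and p: "\<gamma> t0 \<in> U"
    and f: "\<And>i y. i < n \<Longrightarrow> y \<in> U \<Longrightarrow> (\<lambda>t. f (y(i := t))) differentiable (at (y i))"
    and c: "\<And>i. i < n \<Longrightarrow> continuous_on U (pd i f)"
    and E: "\<forall>\<^sub>F t in nhds t0. \<gamma> t \<in> topspace (Euclidean_space n)"
    and d: "\<And>i. i < n \<Longrightarrow> ((\<lambda>t. \<gamma> t i) has_real_derivative d i) (at t0)"
  shows "((\<lambda>t. f (\<gamma> t)) has_real_derivative (\<Sum>i<n. pd i f (\<gamma> t0) * d i)) (at t0)"
proof -
  define p where "p = \<gamma> t0"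
  \<comment> \<open>The first \<open>k\<close> coordinates follow the curve and the others stay
    frozen at \<open>p\<close>, so \<open>h 0\<close> is constant and \<open>h n\<close> is the
    curve itself.\<close>
  define h where "h = (\<lambda>k t i. if i < k then \<gamma> t i else p i)"
  have pE: "p \<in> topspace (Euclidean_space n)"
    using openin_subset[OF U] assms(2) p_def by auto
  have close: "\<forall>\<^sub>F t in nhds t0. \<forall>i<n. \<bar>\<gamma> t i - p i\<bar> < \<delta>" if "\<delta> > 0" for \<delta>
  proof -
    have "\<forall>\<^sub>F t in nhds t0. \<bar>\<gamma> t i - p i\<bar> < \<delta>" if "i < n" for i
    proof -
      have "isCont (\<lambda>t. \<gamma> t i) t0" using d[OF that] by (rule DERIV_isCont)
      then have "((\<lambda>t. \<gamma> t i) \<longlongrightarrow> \<gamma> t0 i) (nhds t0)"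
        by (metis isCont_def tendsto_at_iff_tendsto_nhds)
      from tendstoD[OF this \<open>\<delta> > 0\<close>] show ?thesis by (simp add: dist_real_def p_def)
    qed
    then have "\<forall>\<^sub>F t in nhds t0. \<forall>i\<in>{..<n}. \<bar>\<gamma> t i - p i\<bar> < \<delta>"
      by (subst eventually_ball_finite_distrib) auto
    then show ?thesis by eventually_elim auto
  qed
  have hE: "h k t \<in> topspace (Euclidean_space n)" if "k \<le> n" for k t
    using pE that by (auto simp: topspace_Euclidean_space h_def)
  have "((\<lambda>t. f (h k t)) has_real_derivative (\<Sum>i<k. pd i f p * d i)) (at t0)" if "k \<le> n" for k
    using that
  proof (induction k)
    case 0 then show ?case by (simp add: h_def)
  next
    case (Suc k)
    then have k: "k < n" by simp
    \<comment> \<open>The error made when the switch of coordinate \<open>k\<close> is replaced by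
      its linear part; the induction step amounts to its derivative at \<open>t0\<close> being
      0.\<close>
    define Q where "Q = (\<lambda>t. f (h (Suc k) t) - f (h k t) - pd k f p * (\<gamma> t k - p k))"
    have hS: "h (Suc k) t = (h k t)(k := \<gamma> t k)" for t
      by (auto simp: h_def less_Suc_eq)
    have Q0: "Q t0 = 0"
    proof -
      have "h (Suc k) t0 = h k t0" by (auto simp: h_def p_def)
      then show ?thesis by (simp add: Q_def p_def)
    qed
    have "((\<lambda>t. Q t / (t - t0)) \<longlongrightarrow> 0) (at t0)"
    proof (rule tendstoI)
      fix e :: real assume "e > 0"
      \<comment> \<open>The difference quotient of coordinate \<open>k\<close> is eventually below
        |d k| + 1 in absolute value, so this choice keeps the quotient of \<open>Q\<close> below
        \<open>e\<close>.\<close>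
      define e' where "e' = e / (\<bar>d k\<bar> + 2)"
      have e': "e' > 0" using \<open>e > 0\<close> by (simp add: e'_def add_nonneg_pos)
      obtain \<delta> where \<delta>: "\<delta> > 0"
        "\<And>y b. y \<in> topspace (Euclidean_space n) \<Longrightarrow> (\<And>i. i < n \<Longrightarrow> \<bar>y i - p i\<bar> < \<delta>) \<Longrightarrow> \<bar>b - p k\<bar> < \<delta>
           \<Longrightarrow> \<bar>f (y(k := b)) - f y - pd k f p * (b - y k)\<bar> \<le> e' * \<bar>b - y k\<bar>"
        using pd_increment_bound[OF U assms(2) k f[OF k] c[OF k] e'] p_def by metis
      have *: "\<bar>q - b\<bar> < 1 \<Longrightarrow> \<bar>q\<bar> < \<bar>b\<bar> + 1" for q b :: real by arith
      have "((\<lambda>t. (\<gamma> t k - p k) / (t - t0)) \<longlongrightarrow> d k) (at t0)"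
        using d[OF k] by (simp add: has_field_derivative_iff p_def)
      from tendstoD[OF this, of 1]
      have "\<forall>\<^sub>F t in at t0. dist ((\<gamma> t k - p k) / (t - t0)) (d k) < 1" by simp
      then have "\<forall>\<^sub>F t in at t0. \<bar>(\<gamma> t k - p k) / (t - t0)\<bar> < \<bar>d k\<bar> + 1"
        by (rule eventually_mono) (rule *, simp only: dist_real_def)
      moreover have "\<forall>\<^sub>F t in at t0. \<forall>i<n. \<bar>\<gamma> t i - p i\<bar> < \<delta>"
        using close[OF \<delta>(1)] by (simp add: eventually_nhds_conv_at)
      moreover have "\<forall>\<^sub>F t in at t0. t \<noteq> t0" by (simp add: eventually_at_filter)
      ultimately show "\<forall>\<^sub>F t in at t0. dist (Q t / (t - t0)) 0 < e"
      proof eventually_elim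
        case (elim t)
        have "\<bar>Q t\<bar> \<le> e' * \<bar>\<gamma> t k - p k\<bar>"
          unfolding Q_def hS using \<delta>(2)[OF hE, of k t "\<gamma> t k"] k elim(2) \<delta>(1)
          by (auto simp: h_def)
        then have "\<bar>Q t / (t - t0)\<bar> \<le> e' * \<bar>(\<gamma> t k - p k) / (t - t0)\<bar>"
          using elim(3) by (simp add: abs_divide divide_right_mono)
        also have "\<dots> < e' * (\<bar>d k\<bar> + 2)"
          using e' elim(1) by (intro mult_strict_left_mono) auto
        also have "\<dots> = e" by (simp add: e'_def add_nonneg_pos)
        finally show ?case by (simp add: dist_real_def)
      qed
    qed
    then have "(Q has_real_derivative 0) (at t0)"
      by (simp add: has_field_derivative_iff Q0)
    from DERIV_add[OF DERIV_add[OF Suc.IH this] DERIV_cmult[OF DERIV_diff[OF d[OF k] DERIV_const], of "pd k f p" "p k"]]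
    show ?case using Suc.prems by (simp add: Q_def)
  qed
  from this[of n] have "((\<lambda>t. f (h n t)) has_real_derivative (\<Sum>i<n. pd i f p * d i)) (at t0)" by simp
  \<comment> \<open>Both sequences vanish from index \<open>n\<close> on as long as the curve stays
    in the space.\<close>
  moreover have "\<forall>\<^sub>F t in nhds t0. f (h n t) = f (\<gamma> t)"
    using E
  proof eventually_elim
    case (elim t)
    then have "h n t = \<gamma> t" using pE by (auto simp: h_def topspace_Euclidean_space fun_eq_iff)
    then show ?case by simp
  qed
  ultimately show ?thesis
    by (subst (asm) DERIV_cong_ev) (auto simp: p_def)
qed

lemma pd_cong:
  assumes U: "openin (Euclidean_space n) U" and x: "x \<in> U" and i: "i < n"
    and eq: "\<And>y. y \<in> U \<Longrightarrow> f y = g y"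
  shows "((\<lambda>t. f (x(i := t))) has_real_derivative D) (at (x i)) \<longleftrightarrow>
         ((\<lambda>t. g (x(i := t))) has_real_derivative D) (at (x i))"
    and "pd i f x = pd i g x"
proof -
  have ev: "\<forall>\<^sub>F t in nhds (x i). f (x(i := t)) = g (x(i := t))"
    using eventually_fun_upd_in[OF U x i] by eventually_elim (rule eq)
  then show "((\<lambda>t. f (x(i := t))) has_real_derivative D) (at (x i)) \<longleftrightarrow>
         ((\<lambda>t. g (x(i := t))) has_real_derivative D) (at (x i))"
    by (intro DERIV_cong_ev) auto
  show "pd i f x = pd i g x"
    unfolding pd_def using ev by (rule deriv_cong_ev) simp
qed

section \<open>Closure properties of C^k and smooth functions\<close>

lemma Ck_on_0_iff:
  assumes U: "openin (Euclidean_space n) U"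
  shows "Ck_on n 0 U f \<longleftrightarrow> continuous_on U f"
  by (simp add: continuous_map_subtopology_Euclidean_space[OF U])

lemma Ck_on_Suc_iff:
  assumes U: "openin (Euclidean_space n) U"
  shows "Ck_on n (Suc k) U f \<longleftrightarrow> continuous_on U f \<and>
     (\<forall>i<n. (\<forall>x\<in>U. (\<lambda>t. f (x(i := t))) differentiable (at (x i))) \<and> Ck_on n k U (pd i f))"
  by (simp add: continuous_map_subtopology_Euclidean_space[OF U])

declare Ck_on.simps [simp del]

lemma Ck_on_imp_continuous_on:
  "openin (Euclidean_space n) U \<Longrightarrow> Ck_on n k U f \<Longrightarrow> continuous_on U f"
  by (cases k) (auto simp: Ck_on_0_iff Ck_on_Suc_iff)

lemma Ck_on_cong:
  assumes U: "openin (Euclidean_space n) U"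
  shows "(\<And>y. y \<in> U \<Longrightarrow> f y = g y) \<Longrightarrow> Ck_on n k U f \<Longrightarrow> Ck_on n k U g"
proof (induction k arbitrary: f g)
  case 0
  then show ?case using continuous_on_cong[of U U f g] by (simp add: Ck_on_0_iff[OF U])
next
  case (Suc k)
  have 1: "continuous_on U g"
    using Suc.prems continuous_on_cong[of U U f g] by (simp add: Ck_on_Suc_iff[OF U])
  have 2: "(\<lambda>t. g (x(i := t))) differentiable (at (x i))" if "i < n" "x \<in> U" for i x
    using pd_cong(1)[of n U x i f g, OF U that(2,1) Suc.prems(1)] Suc.prems(2) that
    unfolding Ck_on_Suc_iff[OF U] real_differentiable_def by metis
  have 3: "Ck_on n k U (pd i g)" if "i < n" for i
    by (rule Suc.IH[of "pd i f"])
       (use Suc.prems that pd_cong(2)[OF U _ that Suc.prems(1)] in \<open>auto simp: Ck_on_Suc_iff[OF U]\<close>)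
  from 1 2 3 show ?case by (simp add: Ck_on_Suc_iff[OF U])
qed

lemma Ck_on_SucD:
  assumes U: "openin (Euclidean_space n) U"
  shows "Ck_on n (Suc k) U f \<Longrightarrow> Ck_on n k U f"
  by (induction k arbitrary: f) (auto simp: Ck_on_0_iff[OF U] Ck_on_Suc_iff[OF U])

text \<open>Allows an explicit formula \<open>f'\<close> for the derivative in place of
  \<open>pd\<close>. The two agree on \<open>U\<close> only, which is why \<open>Ck_on_cong\<close>
  comes first.\<close>

lemma Ck_on_SucI:
  assumes U: "openin (Euclidean_space n) U"
    and "continuous_on U f"
    and D: "\<And>i x. i < n \<Longrightarrow> x \<in> U \<Longrightarrow> ((\<lambda>t. f (x(i := t))) has_real_derivative f' i x) (at (x i))"
    and C: "\<And>i. i < n \<Longrightarrow> Ck_on n k U (f' i)"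
  shows "Ck_on n (Suc k) U f"
  unfolding Ck_on_Suc_iff[OF U]
proof (intro conjI allI impI ballI)
  fix i assume i: "i < n"
  show "Ck_on n k U (pd i f)"
    by (rule Ck_on_cong[OF U _ C[OF i]]) (metis pd_eqI D i)
qed (use assms in \<open>auto intro: DERIV_differentiable\<close>)

lemma Ck_on_DERIV:
  assumes U: "openin (Euclidean_space n) U" and "Ck_on n (Suc k) U f" "i < n" "x \<in> U"
  shows "((\<lambda>t. f (x(i := t))) has_real_derivative pd i f x) (at (x i))"
  using assms by (intro DERIV_pd) (simp add: Ck_on_Suc_iff[OF U])

lemma Ck_on_const: "openin (Euclidean_space n) U \<Longrightarrow> Ck_on n k U (\<lambda>x. c)"
proof (induction k arbitrary: c)
  case (Suc k)
  then show ?case by (intro Ck_on_SucI[where f' = "\<lambda>i x. 0"]) auto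
qed (simp add: Ck_on_0_iff)

lemma Ck_on_coordinate:
  assumes U: "openin (Euclidean_space n) U"
  shows "Ck_on n k U (\<lambda>x. x j)"
proof (cases k)
  case 0
  then show ?thesis
    by (simp add: Ck_on_0_iff[OF U] continuous_on_subset[OF continuous_on_product_coordinates])
next
  case (Suc k)
  show ?thesis unfolding Suc
    by (intro Ck_on_SucI[OF U, where f' = "\<lambda>i x. if i = j then 1 else 0"])
       (auto simp: Ck_on_const[OF U] continuous_on_subset[OF continuous_on_product_coordinates])
qed

lemma Ck_on_add:
  assumes U: "openin (Euclidean_space n) U"
  shows "Ck_on n k U f \<Longrightarrow> Ck_on n k U g \<Longrightarrow> Ck_on n k U (\<lambda>x. f x + g x)"
proof (induction k arbitrary: f g)
  case 0
  then show ?case by (auto simp: Ck_on_0_iff[OF U] intro: continuous_on_add)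
next
  case (Suc k)
  show ?case
  proof (rule Ck_on_SucI[OF U, where f' = "\<lambda>i x. pd i f x + pd i g x"])
    show "continuous_on U (\<lambda>x. f x + g x)"
      using Suc.prems by (intro continuous_on_add) (auto simp: Ck_on_Suc_iff[OF U])
  qed (use Suc in \<open>auto intro!: DERIV_add DERIV_pd simp: Ck_on_Suc_iff[OF U] simp del: fun_upd_apply\<close>)
qed

lemma Ck_on_mult:
  assumes U: "openin (Euclidean_space n) U"
  shows "Ck_on n k U f \<Longrightarrow> Ck_on n k U g \<Longrightarrow> Ck_on n k U (\<lambda>x. f x * g x)"
proof (induction k arbitrary: f g)
  case 0
  then show ?case by (auto simp: Ck_on_0_iff[OF U] intro: continuous_on_mult)
next
  case (Suc k)
  \<comment> \<open>The product rule pairs a derivative of order \<open>k\<close> with an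
    undifferentiated factor of order \<open>Suc k\<close>, which has to be lowered before the
    induction hypothesis applies.\<close>
  note k = Suc.prems[THEN Ck_on_SucD[OF U]]
  show ?case
  proof (rule Ck_on_SucI[OF U, where f' = "\<lambda>i x. pd i f x * g x + pd i g x * f x"])
    show "continuous_on U (\<lambda>x. f x * g x)"
      using Suc.prems by (intro continuous_on_mult) (auto simp: Ck_on_Suc_iff[OF U])
    show "((\<lambda>t. f (x(i := t)) * g (x(i := t))) has_real_derivative pd i f x * g x + pd i g x * f x) (at (x i))"
      if "i < n" "x \<in> U" for i x
      using DERIV_mult[OF Suc.prems[THEN Ck_on_DERIV[OF U _ that]]]
      by (simp del: fun_upd_apply)
    show "Ck_on n k U (\<lambda>x. pd i f x * g x + pd i g x * f x)" if "i < n" for i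
      using Suc.prems that by (intro Ck_on_add[OF U] Suc.IH k) (auto simp: Ck_on_Suc_iff[OF U])
  qed
qed

text \<open>The derivative of 1/f is -f' times the square of 1/f. Hence \<open>f\<close> stays fixed
  in the induction: order \<open>k\<close> of 1/f gives order \<open>k\<close> of its
  derivative.\<close>

lemma Ck_on_inverse:
  assumes U: "openin (Euclidean_space n) U" and nz: "\<And>x. x \<in> U \<Longrightarrow> f x \<noteq> 0"
  shows "Ck_on n k U f \<Longrightarrow> Ck_on n k U (\<lambda>x. inverse (f x))"
proof (induction k)
  case 0
  then show ?case using nz by (auto simp: Ck_on_0_iff[OF U] intro!: continuous_on_inverse)
next
  case (Suc k)
  note IH = Suc.IH[OF Ck_on_SucD[OF U Suc.prems]]
  show ?case
  proof (rule Ck_on_SucI[OF U, where f' = "\<lambda>i x. (- 1) * (pd i f x * (inverse (f x) * inverse (f x)))"])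
    show "continuous_on U (\<lambda>x. inverse (f x))"
      using Suc.prems nz by (intro continuous_on_inverse) (auto simp: Ck_on_Suc_iff[OF U])
    show "((\<lambda>t. inverse (f (x(i := t)))) has_real_derivative
        (- 1) * (pd i f x * (inverse (f x) * inverse (f x)))) (at (x i))"
      if "i < n" "x \<in> U" for i x
      using DERIV_inverse_fun[OF Ck_on_DERIV[OF U Suc.prems that]] nz[OF that(2)]
      by (simp add: power2_eq_square del: fun_upd_apply)
    show "Ck_on n k U (\<lambda>x. (- 1) * (pd i f x * (inverse (f x) * inverse (f x))))" if "i < n" for i
      using Suc.prems that by (intro Ck_on_mult[OF U] IH Ck_on_const[OF U]) (auto simp: Ck_on_Suc_iff[OF U])
  qed
qed

lemma Ck_on_sum:
  assumes U: "openin (Euclidean_space n) U"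
  shows "finite A \<Longrightarrow> (\<And>a. a \<in> A \<Longrightarrow> Ck_on n k U (f a)) \<Longrightarrow> Ck_on n k U (\<lambda>x. \<Sum>a\<in>A. f a x)"
  by (induction A rule: finite_induct) (auto intro!: Ck_on_const[OF U] Ck_on_add[OF U])

lemma pd_compose:
  assumes U: "openin (Euclidean_space n) U" and V: "openin (Euclidean_space m) V"
    and FV: "\<And>x. x \<in> U \<Longrightarrow> F x \<in> V"
    and F: "\<And>j. j < m \<Longrightarrow> Ck_on n (Suc k) U (\<lambda>x. F x j)" and f: "Ck_on m (Suc l) V f"
    and i: "i < n" and x: "x \<in> U"
  shows "((\<lambda>t. f (F (x(i := t)))) has_real_derivative (\<Sum>j<m. pd j f (F x) * pd i (\<lambda>x. F x j) x)) (at (x i))"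
proof -
  have "((\<lambda>t. f (F (x(i := t)))) has_real_derivative
      (\<Sum>j<m. pd j f (F (x(i := x i))) * pd i (\<lambda>x. F x j) x)) (at (x i))"
  proof (rule chain_rule_curve[OF V])
    show "\<forall>\<^sub>F t in nhds (x i). F (x(i := t)) \<in> topspace (Euclidean_space m)"
      using eventually_fun_upd_in[OF U x i]
      by eventually_elim (use FV openin_subset[OF V] in auto)
    show "continuous_on V (pd j f)" if "j < m" for j
      using f that by (intro Ck_on_imp_continuous_on[OF V]) (auto simp: Ck_on_Suc_iff[OF V])
    show "((\<lambda>t. F (x(i := t)) j) has_real_derivative pd i (\<lambda>x. F x j) x) (at (x i))" if "j < m" for j
      by (rule Ck_on_DERIV[OF U F[OF that] i x])
    show "(\<lambda>t. f (y(j := t))) differentiable (at (y j))" if "j < m" "y \<in> V" for j y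
      using f that unfolding Ck_on_Suc_iff[OF V] by blast
  qed (use FV x in simp)
  then show ?thesis by simp
qed

text \<open>The chain rule replaces \<open>f\<close> by its partial derivatives while
  \<open>F\<close> survives unchanged, so the induction generalises over the outer function
  only.\<close>

lemma Ck_on_compose:
  assumes U: "openin (Euclidean_space n) U" and V: "openin (Euclidean_space m) V"
    and FV: "\<And>x. x \<in> U \<Longrightarrow> F x \<in> V"
  shows "(\<And>j. j < m \<Longrightarrow> Ck_on n k U (\<lambda>x. F x j)) \<Longrightarrow> Ck_on m k V f \<Longrightarrow> Ck_on n k U (\<lambda>x. f (F x))"
proof (induction k arbitrary: f)
  have cont: "continuous_on U (\<lambda>x. f (F x))"
    if "\<And>j. j < m \<Longrightarrow> continuous_on U (\<lambda>x. F x j)" "continuous_on V f" for f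
  proof (rule continuous_on_compose2[OF that(2)])
    \<comment> \<open>Coordinates of \<open>F x\<close> from \<open>m\<close> on are 0 because
      \<open>F x\<close> lies in \<open>V\<close>, so the hypotheses on the first \<open>m\<close>
      coordinates give continuity into the whole function space.\<close>
    have *: "continuous_on U (\<lambda>x. F x j)" for j
    proof (cases "j < m")
      case False
      then have "F x j = 0" if "x \<in> U" for x
        using FV[OF that] openin_subset[OF V] by (auto simp: topspace_Euclidean_space)
      then show ?thesis by (subst continuous_on_cong[where g = "\<lambda>x. 0"]) auto
    qed (rule that)
    then show "continuous_on U F" by (rule continuous_on_coordinatewise_then_product)
  qed (use FV in auto)
  {
    case 0
    then show ?case by (auto simp: Ck_on_0_iff[OF U] Ck_on_0_iff[OF V] intro: cont)
  next
    case (Suc k)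
    show ?case
    proof (rule Ck_on_SucI[OF U])
      show "((\<lambda>t. f (F (x(i := t)))) has_real_derivative (\<Sum>j<m. pd j f (F x) * pd i (\<lambda>x. F x j) x)) (at (x i))"
        if "i < n" "x \<in> U" for i x
        by (rule pd_compose[OF U V FV Suc.prems that])
      show "continuous_on U (\<lambda>x. f (F x))"
        by (rule cont[OF Ck_on_imp_continuous_on[OF U Suc.prems(1)] Ck_on_imp_continuous_on[OF V Suc.prems(2)]])
      show "Ck_on n k U (\<lambda>x. \<Sum>j<m. pd j f (F x) * pd i (\<lambda>x. F x j) x)" if "i < n" for i
      proof (intro Ck_on_sum[OF U] Ck_on_mult[OF U])
        fix j assume "j \<in> {..<m}"
        then have j: "j < m" by simp
        show "Ck_on n k U (\<lambda>x. pd j f (F x))"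
          by (rule Suc.IH[OF Ck_on_SucD[OF U Suc.prems(1)]])
             (use Suc.prems(2) j in \<open>auto simp: Ck_on_Suc_iff[OF V]\<close>)
        show "Ck_on n k U (pd i (\<lambda>x. F x j))"
          using Suc.prems(1)[OF j] that by (simp add: Ck_on_Suc_iff[OF U])
      qed simp
    qed
  }
qed

lemma Ck_on_subset:
  assumes U: "openin (Euclidean_space n) U" and V: "openin (Euclidean_space n) V" and "V \<subseteq> U"
  shows "Ck_on n k U f \<Longrightarrow> Ck_on n k V f"
proof (induction k arbitrary: f)
  case 0
  then show ?case using \<open>V \<subseteq> U\<close> by (auto simp: Ck_on_0_iff[OF U] Ck_on_0_iff[OF V] intro: continuous_on_subset)
next
  case (Suc k)
  then show ?case using \<open>V \<subseteq> U\<close>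
    by (auto simp: Ck_on_Suc_iff[OF U] Ck_on_Suc_iff[OF V] intro: continuous_on_subset)
qed

lemma smooth_on_const: "openin (Euclidean_space n) U \<Longrightarrow> smooth_on n U (\<lambda>x. c)"
  unfolding smooth_on_def by (simp add: Ck_on_const)

lemma smooth_on_cong:
  "openin (Euclidean_space n) U \<Longrightarrow> (\<And>y. y \<in> U \<Longrightarrow> f y = g y) \<Longrightarrow> smooth_on n U f \<Longrightarrow> smooth_on n U g"
  unfolding smooth_on_def by (auto intro: Ck_on_cong[of n U f g])

lemma smooth_on_subset:
  "openin (Euclidean_space n) U \<Longrightarrow> openin (Euclidean_space n) V \<Longrightarrow> V \<subseteq> U \<Longrightarrow> smooth_on n U f \<Longrightarrow> smooth_on n V f"
  unfolding smooth_on_def by (auto intro: Ck_on_subset[of n U V])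

lemma smooth_on_coordinate: "openin (Euclidean_space n) U \<Longrightarrow> smooth_on n U (\<lambda>x. x j)"
  unfolding smooth_on_def by (simp add: Ck_on_coordinate)

lemma smooth_on_add:
  "openin (Euclidean_space n) U \<Longrightarrow> smooth_on n U f \<Longrightarrow> smooth_on n U g \<Longrightarrow> smooth_on n U (\<lambda>x. f x + g x)"
  unfolding smooth_on_def by (simp add: Ck_on_add)

lemma smooth_on_mult:
  "openin (Euclidean_space n) U \<Longrightarrow> smooth_on n U f \<Longrightarrow> smooth_on n U g \<Longrightarrow> smooth_on n U (\<lambda>x. f x * g x)"
  unfolding smooth_on_def by (simp add: Ck_on_mult)

lemma smooth_on_minus:
  "openin (Euclidean_space n) U \<Longrightarrow> smooth_on n U f \<Longrightarrow> smooth_on n U (\<lambda>x. - f x)"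
  using smooth_on_mult[of n U "\<lambda>x. -1" f] smooth_on_const[of n U "-1"] by simp

lemma smooth_on_diff:
  "openin (Euclidean_space n) U \<Longrightarrow> smooth_on n U f \<Longrightarrow> smooth_on n U g \<Longrightarrow> smooth_on n U (\<lambda>x. f x - g x)"
  using smooth_on_add[of n U f "\<lambda>x. - g x"] smooth_on_minus[of n U g] by simp

lemma smooth_on_inverse:
  "openin (Euclidean_space n) U \<Longrightarrow> (\<And>x. x \<in> U \<Longrightarrow> f x \<noteq> 0) \<Longrightarrow> smooth_on n U f \<Longrightarrow> smooth_on n U (\<lambda>x. inverse (f x))"
  unfolding smooth_on_def by (auto intro!: Ck_on_inverse)

lemma smooth_on_divide:
  "openin (Euclidean_space n) U \<Longrightarrow> (\<And>x. x \<in> U \<Longrightarrow> g x \<noteq> 0) \<Longrightarrow> smooth_on n U f \<Longrightarrow> smooth_on n U g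
    \<Longrightarrow> smooth_on n U (\<lambda>x. f x / g x)"
  by (simp add: divide_inverse smooth_on_mult smooth_on_inverse)

lemma smooth_on_sum:
  "openin (Euclidean_space n) U \<Longrightarrow> finite A \<Longrightarrow> (\<And>a. a \<in> A \<Longrightarrow> smooth_on n U (f a)) \<Longrightarrow>
    smooth_on n U (\<lambda>x. \<Sum>a\<in>A. f a x)"
  unfolding smooth_on_def by (auto intro!: Ck_on_sum)

lemma smooth_on_compose:
  assumes "openin (Euclidean_space n) U" "openin (Euclidean_space m) V"
    and "\<And>x. x \<in> U \<Longrightarrow> F x \<in> V"
    and "\<And>j. j < m \<Longrightarrow> smooth_on n U (\<lambda>x. F x j)" "smooth_on m V f"
  shows "smooth_on n U (\<lambda>x. f (F x))"
  using assms unfolding smooth_on_def by (auto intro!: Ck_on_compose[of n U m V F _ f])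

lemma smooth_on_DERIV:
  assumes "openin (Euclidean_space n) U" "smooth_on n U f" "i < n" "x \<in> U"
  shows "((\<lambda>t. f (x(i := t))) has_real_derivative pd i f x) (at (x i))"
  using assms(2) unfolding smooth_on_def by (intro Ck_on_DERIV[OF assms(1) _ assms(3,4)]) simp

lemma smooth_on_pd_compose:
  assumes "openin (Euclidean_space n) U" "openin (Euclidean_space m) V"
    and "\<And>x. x \<in> U \<Longrightarrow> F x \<in> V"
    and "\<And>j. j < m \<Longrightarrow> smooth_on n U (\<lambda>x. F x j)" "smooth_on m V f" "i < n" "x \<in> U"
  shows "pd i (\<lambda>x. f (F x)) x = (\<Sum>j<m. pd j f (F x) * pd i (\<lambda>x. F x j) x)"
proof (rule pd_eqI, rule pd_compose[OF assms(1-3)])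
  show "Ck_on n (Suc 0) U (\<lambda>x. F x j)" if "j < m" for j
    using assms(4)[OF that] unfolding smooth_on_def by blast
  show "Ck_on m (Suc 0) V f" using assms(5) unfolding smooth_on_def by blast
qed (assumption | rule assms)+

lemma smooth_on_imp_continuous_on:
  "openin (Euclidean_space n) U \<Longrightarrow> smooth_on n U f \<Longrightarrow> continuous_on U f"
  unfolding smooth_on_def using Ck_on_imp_continuous_on by metis

section \<open>Flat space\<close>

lemma openin_topspace_Euclidean_space [simp]:
  "openin (Euclidean_space n) (topspace (Euclidean_space n))"
  by simp

lemma smooth_on_pd:
  assumes "openin (Euclidean_space n) U" "smooth_on n U f" "i < n"
  shows "smooth_on n U (pd i f)"
  using assms Ck_on_Suc_iff[OF assms(1)] unfolding smooth_on_def by blast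

lemma second_countable_top_of_set:
  fixes S :: "'a::second_countable_topology set"
  shows "second_countable_space (top_of_set S)"
proof -
  obtain B :: "'a set set" where B: "countable B" "topological_basis B"
    using ex_countable_basis by blast
  show ?thesis unfolding second_countable_space_def
  proof (intro exI[of _ "(\<inter>) S ` B"] conjI allI impI ballI)
    show "openin (top_of_set S) V" if "V \<in> (\<inter>) S ` B" for V
      using that topological_basis_open[OF B(2)] by auto
    fix U x assume "openin (top_of_set S) U \<and> x \<in> U"
    then obtain T where T: "open T" "U = S \<inter> T" "x \<in> U" by (auto simp: openin_open)
    then have "x \<in> T" by simp
    from topological_basisE[OF B(2) T(1) this] obtain V where V: "V \<in> B" "x \<in> V" "V \<subseteq> T" .
    show "\<exists>V\<in>(\<inter>) S ` B. x \<in> V \<and> V \<subseteq> U"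
      by (rule bexI[of _ "S \<inter> V"]) (use T V in auto)
  qed (simp add: B)
qed

text \<open>The flat atlas consists of the identity chart, but \<open>complex_structure\<close> asks
  for coordinates in which partners are numbered 2k and 2k+1. Permuted charts provide these for
  complex structures that pair the coordinates differently.\<close>

definition perm_chart :: "nat \<Rightarrow> (nat \<Rightarrow> nat) \<Rightarrow> (nat \<Rightarrow> real) chart" where
  "perm_chart n \<pi> = (topspace (Euclidean_space n), \<lambda>x. x \<circ> \<pi>)"

definition flat_space :: "nat \<Rightarrow> (nat \<Rightarrow> real) manifold" where
  "flat_space n = \<lparr>mtop = Euclidean_space n, mdim = n, atlas = {perm_chart n id}\<rparr>"

text \<open>The directional derivative at \<open>p\<close> along \<open>a\<close>. The value 0 off
  the smooth functions follows the convention of \<open>coord_vec\<close>, so that equal tangent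
  vectors are equal as functions.\<close>

definition flat_vec :: "nat \<Rightarrow> (nat \<Rightarrow> real) \<Rightarrow> (nat \<Rightarrow> real) \<Rightarrow> (nat \<Rightarrow> real) tvec" where
  "flat_vec n p a =
     (\<lambda>f. if smooth_on n (topspace (Euclidean_space n)) f then \<Sum>i<n. a i * pd i f p else 0)"

text \<open>Applying a tangent vector to the coordinate functions recovers its components, so no
  representative \<open>a\<close> has to be chosen. \<open>flat_endo\<close> is encoded in the same
  way.\<close>

definition flat_metric :: "nat \<Rightarrow> (nat \<Rightarrow> real) bilin" where
  "flat_metric n p v w = (\<Sum>i<n. v (\<lambda>x. x i) * w (\<lambda>x. x i))"

definition flat_endo ::
  "nat \<Rightarrow> ((nat \<Rightarrow> real) \<Rightarrow> nat \<Rightarrow> real) \<Rightarrow> (nat \<Rightarrow> real) endo" where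
  "flat_endo n L p v = flat_vec n p (L (\<lambda>i. v (\<lambda>x. x i)))"

text \<open>An involution on all indices makes the permutation of coordinates its own inverse on the
  whole function space; preserving the indices below \<open>n\<close> makes it preserve the
  sequences that vanish from \<open>n\<close> on.\<close>

definition involution_below :: "nat \<Rightarrow> (nat \<Rightarrow> nat) \<Rightarrow> bool" where
  "involution_below n \<pi> \<longleftrightarrow> (\<forall>i. \<pi> (\<pi> i) = i) \<and> (\<forall>i<n. \<pi> i < n)"

lemma involution_below_less_iff: "involution_below n \<pi> \<Longrightarrow> \<pi> i < n \<longleftrightarrow> i < n"
  unfolding involution_below_def by metis

lemma involution_below_id [simp]: "involution_below n id"
  by (simp add: involution_below_def)

lemma involution_below_twice [simp]: "involution_below n \<pi> \<Longrightarrow> \<pi> (\<pi> i) = i"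
  by (simp add: involution_below_def)

lemma comp_involution_in_topspace:
  "involution_below n \<pi> \<Longrightarrow> x \<in> topspace (Euclidean_space n) \<Longrightarrow> x \<circ> \<pi> \<in> topspace (Euclidean_space n)"
  using involution_below_less_iff[of n \<pi>] by (auto simp: topspace_Euclidean_space not_less[symmetric])

lemma comp_involution_twice: "involution_below n \<pi> \<Longrightarrow> (x \<circ> \<pi>) \<circ> \<pi> = x"
  by (auto simp: involution_below_def)

lemma image_comp_involution:
  "involution_below n \<pi> \<Longrightarrow> (\<lambda>x. x \<circ> \<pi>) ` topspace (Euclidean_space n) = topspace (Euclidean_space n)"
  by (auto simp: image_iff intro!: comp_involution_in_topspace)
     (metis comp_involution_in_topspace comp_involution_twice)

lemma fst_perm_chart [simp]: "fst (perm_chart n \<pi>) = topspace (Euclidean_space n)"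
  and snd_perm_chart [simp]: "snd (perm_chart n \<pi>) = (\<lambda>x. x \<circ> \<pi>)"
  by (simp_all add: perm_chart_def)

lemma perm_chart_inv:
  assumes "involution_below n \<pi>" "x \<in> topspace (Euclidean_space n)"
  shows "inv_into (topspace (Euclidean_space n)) (\<lambda>x. x \<circ> \<pi>) x = x \<circ> \<pi>"
proof -
  have inj: "inj_on (\<lambda>x. x \<circ> \<pi>) (topspace (Euclidean_space n))"
    by (rule inj_onI) (metis assms(1) comp_involution_twice)
  have "inv_into (topspace (Euclidean_space n)) (\<lambda>x. x \<circ> \<pi>) ((x \<circ> \<pi>) \<circ> \<pi>) = x \<circ> \<pi>"
    using inv_into_f_f[OF inj comp_involution_in_topspace[OF assms]] by simp
  then show ?thesis by (simp add: comp_involution_twice[OF assms(1)])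
qed

lemma flat_space_simps [simp]:
  "mtop (flat_space n) = Euclidean_space n" "mdim (flat_space n) = n"
  "atlas (flat_space n) = {perm_chart n id}"
  by (simp_all add: flat_space_def)

lemma continuous_map_comp_involution:
  assumes "involution_below n \<pi>"
  shows "continuous_map (Euclidean_space n) (Euclidean_space n) (\<lambda>x. x \<circ> \<pi>)"
proof -
  have "continuous_on (topspace (Euclidean_space n)) (\<lambda>x. x \<circ> \<pi>)"
    by (rule continuous_on_coordinatewise_then_product)
       (simp add: continuous_on_subset[OF continuous_on_product_coordinates])
  then show ?thesis
    using cm_Euclidean_space_iff_continuous_on[of n "topspace (Euclidean_space n)" n "\<lambda>x. x \<circ> \<pi>"]
      comp_involution_in_topspace[OF assms] by (auto simp del: comp_apply)
qed

lemma is_chart_perm_chart: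
  assumes "involution_below n \<pi>"
  shows "is_chart (Euclidean_space n) n (perm_chart n \<pi>)"
proof -
  have "homeomorphic_map (Euclidean_space n) (Euclidean_space n) (\<lambda>x. x \<circ> \<pi>)"
    by (rule homeomorphic_map_involution[OF continuous_map_comp_involution[OF assms]])
       (rule comp_involution_twice[OF assms])
  then show ?thesis
    by (simp add: is_chart_def image_comp_involution[OF assms])
qed

lemma smooth_transition_perm_chart:
  assumes "involution_below n \<pi>" "involution_below n \<rho>"
  shows "smooth_transition n (perm_chart n \<pi>) (perm_chart n \<rho>)"
  unfolding smooth_transition_def
proof (intro allI impI)
  fix j assume "j < n"
  have "smooth_on n (topspace (Euclidean_space n)) (\<lambda>x. snd (perm_chart n \<rho>) (chart_inv (perm_chart n \<pi>) x) j)"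
    by (rule smooth_on_cong[OF _ _ smooth_on_coordinate[of n _ "\<pi> (\<rho> j)"]])
       (simp_all add: perm_chart_inv[OF assms(1)])
  then show "smooth_on n (snd (perm_chart n \<pi>) ` (fst (perm_chart n \<pi>) \<inter> fst (perm_chart n \<rho>)))
      (\<lambda>x. snd (perm_chart n \<rho>) (chart_inv (perm_chart n \<pi>) x) j)"
    by (simp add: image_comp_involution[OF assms(1)])
qed

lemma smooth_manifold_flat_space: "smooth_manifold (flat_space n)"
proof -
  have "Hausdorff_space (Euclidean_space n)" "second_countable_space (Euclidean_space n)"
    by (subst Euclidean_space_eq_top_of_set,
        simp add: Hausdorff_space_subtopology second_countable_top_of_set)+
  then show ?thesis
    by (simp add: smooth_manifold_def is_chart_perm_chart smooth_transition_perm_chart)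
qed

lemma compatible_perm_chart:
  "involution_below n \<pi> \<Longrightarrow> compatible_chart (flat_space n) (perm_chart n \<pi>)"
  by (simp add: compatible_chart_def is_chart_perm_chart smooth_transition_perm_chart)

lemma smooth_funs_flat_space:
  "f \<in> smooth_funs (flat_space n) \<longleftrightarrow> smooth_on n (topspace (Euclidean_space n)) f"
proof -
  let ?g = "\<lambda>x. f (inv_into (topspace (Euclidean_space n)) (\<lambda>x. x \<circ> id) x)"
  have eq: "?g x = f x" if "x \<in> topspace (Euclidean_space n)" for x
    using perm_chart_inv[OF involution_below_id that] by simp
  have "smooth_on n (topspace (Euclidean_space n)) ?g \<longleftrightarrow> smooth_on n (topspace (Euclidean_space n)) f"
    using smooth_on_cong[OF openin_topspace_Euclidean_space, of n ?g f]
      smooth_on_cong[OF openin_topspace_Euclidean_space, of n f ?g] eq by auto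
  then show ?thesis
    by (simp add: smooth_funs_def)
qed

text \<open>The chart is its own inverse, so moving its coordinate \<open>i\<close> moves the
  standard coordinate \<open>\<pi> i\<close>.\<close>

lemma coord_vec_perm_chart:
  assumes \<pi>: "involution_below n \<pi>" and p: "p \<in> topspace (Euclidean_space n)" and i: "i < n"
  shows "coord_vec (flat_space n) (perm_chart n \<pi>) p i = flat_vec n p (\<lambda>j. if j = \<pi> i then 1 else 0)"
proof
  fix f
  have "pd i (\<lambda>x. f (chart_inv (perm_chart n \<pi>) x)) (p \<circ> \<pi>) = pd i (\<lambda>x. f (x \<circ> \<pi>)) (p \<circ> \<pi>)"
    by (rule pd_cong(2)[OF openin_topspace_Euclidean_space comp_involution_in_topspace[OF \<pi> p] i])
       (simp add: perm_chart_inv[OF \<pi>])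
  also have "\<dots> = pd (\<pi> i) f p"
  proof -
    have "((p \<circ> \<pi>)(i := t)) \<circ> \<pi> = p(\<pi> i := t)" for t
      using \<pi> by (auto simp: fun_eq_iff)
    then show ?thesis by (simp add: pd_def)
  qed
  finally have *: "pd i (\<lambda>x. f (chart_inv (perm_chart n \<pi>) x)) (p \<circ> \<pi>) = pd (\<pi> i) f p" .
  have "(\<Sum>j<n. (if j = \<pi> i then 1 else 0) * pd j f p) = (\<Sum>j<n. if j = \<pi> i then pd j f p else 0)"
    by (rule sum.cong) auto
  also have "\<dots> = pd (\<pi> i) f p"
    using involution_below_less_iff[OF \<pi>] i by simp
  finally show "coord_vec (flat_space n) (perm_chart n \<pi>) p i f = flat_vec n p (\<lambda>j. if j = \<pi> i then 1 else 0) f"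
    using * by (simp add: coord_vec_def flat_vec_def smooth_funs_flat_space)
qed

lemma flat_vec_coordinate [simp]:
  assumes "j < n"
  shows "flat_vec n p a (\<lambda>x. x j) = a j"
proof -
  have "pd i (\<lambda>x. x j) p = (if i = j then 1 else 0)" for i
    by (rule pd_eqI) (auto intro!: derivative_eq_intros)
  then have "(\<Sum>i<n. a i * pd i (\<lambda>x. x j) p) = (\<Sum>i<n. if i = j then a i else 0)"
    by (intro sum.cong) auto
  also have "\<dots> = a j" using assms by simp
  finally show ?thesis by (simp add: flat_vec_def smooth_on_coordinate)
qed

lemma flat_vec_linear: "x * flat_vec n p a f + y * flat_vec n p b f = flat_vec n p (\<lambda>i. x * a i + y * b i) f"
  by (simp add: flat_vec_def sum.distrib sum_distrib_left algebra_simps)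

lemma flat_vec_cong: "(\<And>i. i < n \<Longrightarrow> a i = b i) \<Longrightarrow> flat_vec n p a = flat_vec n p b"
  by (auto simp: flat_vec_def fun_eq_iff)

lemma flat_vec_minus: "(\<lambda>f. - flat_vec n p a f) = flat_vec n p (\<lambda>i. - a i)"
  by (auto simp: flat_vec_def fun_eq_iff sum_negf)

lemma flat_vec_expand:
  "flat_vec n p a f = (\<Sum>i<n. a i * flat_vec n p (\<lambda>j. if j = i then 1 else 0) f)"
proof (cases "smooth_on n (topspace (Euclidean_space n)) f")
  case True
  have "(\<Sum>j<n. (if j = i then 1 else 0) * pd j f p) = pd i f p" if "i < n" for i
  proof -
    have "(\<Sum>j<n. (if j = i then 1 else 0) * pd j f p) = (\<Sum>j<n. if j = i then pd j f p else 0)"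
      by (rule sum.cong) auto
    then show ?thesis using that by simp
  qed
  then show ?thesis using True by (simp add: flat_vec_def)
qed (simp add: flat_vec_def)

lemma tangent_space_flat_space:
  assumes p: "p \<in> topspace (Euclidean_space n)"
  shows "tangent_space (flat_space n) p = range (flat_vec n p)"
proof -
  have "(\<Sum>i<n. a i * coord_vec (flat_space n) (perm_chart n id) p i f) = flat_vec n p a f" for a f
    by (subst flat_vec_expand[of n p a])
       (intro sum.cong refl, simp add: coord_vec_perm_chart[OF involution_below_id p])
  then show ?thesis
    using p by (auto simp: tangent_space_def)
qed

lemma flat_metric_flat_vec [simp]:
  "flat_metric n q (flat_vec n p a) (flat_vec n p' b) = (\<Sum>i<n. a i * b i)"
  by (simp add: flat_metric_def)

lemma smooth_on_eq_const:
  assumes "\<And>x. x \<in> topspace (Euclidean_space n) \<Longrightarrow> f x = c"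
  shows "smooth_on n (topspace (Euclidean_space n)) f"
  by (rule smooth_on_cong[OF _ _ smooth_on_const[of n _ c]]) (simp_all add: assms)

lemma sum_delta_mult_delta:
  "(\<Sum>l<n::nat. (if l = j then 1 else 0) * (if l = k then 1 else 0)) = (if j = k \<and> j < n then 1 else (0::real))"
  by (simp add: if_distrib[of "\<lambda>x. x * _"] cong: if_cong)

lemma riemannian_metric_flat_space: "riemannian_metric (flat_space n) (flat_metric n)"
  unfolding riemannian_metric_def
proof (intro conjI ballI allI impI)
  fix p assume "p \<in> points (flat_space n)"
  then have p: "p \<in> topspace (Euclidean_space n)" by simp
  note T = tangent_space_flat_space[OF p]
  {
    fix v assume "v \<in> tangent_space (flat_space n) p"
    show "linear_functional_on (tangent_space (flat_space n) p) (flat_metric n p v)"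
      by (auto simp: linear_functional_on_def flat_metric_def sum.distrib sum_distrib_left algebra_simps)
  next
    fix v w
    show "flat_metric n p v w = flat_metric n p w v" by (simp add: flat_metric_def mult.commute)
  next
    fix v assume "v \<in> tangent_space (flat_space n) p" and nz: "v \<noteq> (\<lambda>f. 0)"
    then obtain a where v: "v = flat_vec n p a" using T by auto
    have "\<exists>i<n. a i \<noteq> 0"
    proof (rule ccontr)
      assume "\<not> ?thesis"
      then have "v = flat_vec n p (\<lambda>i. 0)" unfolding v by (intro flat_vec_cong) auto
      then show False using nz by (auto simp: flat_vec_def)
    qed
    then obtain i where "i < n" "a i \<noteq> 0" by blast
    then have "(\<Sum>i<n. a i * a i) > 0"
      by (intro sum_pos2[of _ i]) (auto simp: zero_less_mult_iff neq_iff)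
    then show "flat_metric n p v v > 0" by (simp add: v)
  }
next
  fix c i j assume c: "c \<in> atlas (flat_space n)" and i: "i < mdim (flat_space n)" and j: "j < mdim (flat_space n)"
  have "smooth_on n (topspace (Euclidean_space n))
     (\<lambda>x. flat_metric n (chart_inv c x) (coord_vec (flat_space n) c (chart_inv c x) i)
                (coord_vec (flat_space n) c (chart_inv c x) j))"
    by (rule smooth_on_eq_const[where c = "if i = j then 1 else 0"])
       (use c i j in \<open>auto simp: perm_chart_inv coord_vec_perm_chart sum_delta_mult_delta\<close>)
  then show "smooth_on (mdim (flat_space n)) (snd c ` fst c)
     (\<lambda>x. flat_metric n (chart_inv c x) (coord_vec (flat_space n) c (chart_inv c x) i)
                (coord_vec (flat_space n) c (chart_inv c x) j))"
    using c by simp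
qed

subsection \<open>Constant complex structures\<close>

definition parity_swap :: "nat \<Rightarrow> nat" where
  "parity_swap i = (if even i then i + 1 else i - 1)"

text \<open>Multiplication by \<open>i\<close> in the complex coordinates \<open>x (\<pi> (2k)) + i x (\<pi> (2k+1))\<close>.\<close>

definition std_complex :: "(nat \<Rightarrow> nat) \<Rightarrow> (nat \<Rightarrow> real) \<Rightarrow> nat \<Rightarrow> real" where
  "std_complex \<pi> a i = (if even (\<pi> i) then - 1 else 1) * a (\<pi> (parity_swap (\<pi> i)))"

lemma parity_swap_twice [simp]: "parity_swap (parity_swap i) = i"
  by (auto simp: parity_swap_def)

lemma even_parity_swap [simp]: "even (parity_swap i) \<longleftrightarrow> odd i"
  by (auto simp: parity_swap_def)

lemma parity_swap_less: "i < 2 * m \<Longrightarrow> parity_swap i < 2 * m"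
  by (auto simp: parity_swap_def elim!: evenE)

lemma flat_endo_flat_vec:
  assumes "\<And>a b i. i < n \<Longrightarrow> (\<And>j. j < n \<Longrightarrow> a j = b j) \<Longrightarrow> L a i = L b i"
  shows "flat_endo n L q (flat_vec n p a) = flat_vec n q (L a)"
  unfolding flat_endo_def by (rule flat_vec_cong, rule assms) auto

lemma std_complex_cong:
  assumes "involution_below (2 * m) \<pi>" "i < 2 * m" "\<And>j. j < 2 * m \<Longrightarrow> a j = b j"
  shows "std_complex \<pi> a i = std_complex \<pi> b i"
  using assms parity_swap_less involution_below_less_iff[OF assms(1)]
  by (auto simp: std_complex_def)

lemma flat_endo_std_complex:
  assumes "involution_below (2 * m) \<pi>"
  shows "flat_endo (2 * m) (std_complex \<pi>) q (flat_vec (2 * m) p a) = flat_vec (2 * m) q (std_complex \<pi> a)"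
  by (rule flat_endo_flat_vec) (rule std_complex_cong[OF assms])

lemma std_complex_linear:
  "std_complex \<pi> (\<lambda>i. x * a i + y * b i) = (\<lambda>i. x * std_complex \<pi> a i + y * std_complex \<pi> b i)"
  by (auto simp: std_complex_def algebra_simps)

lemma std_complex_twice:
  "involution_below n \<pi> \<Longrightarrow> std_complex \<pi> (std_complex \<pi> a) = (\<lambda>i. - a i)"
  by (auto simp: std_complex_def)

text \<open>In the identity chart all components are constant, which gives closedness at once.
  Holomorphic coordinates come from the chart permuted by \<open>\<pi>\<close>, where the structure
  is the standard one.\<close>

lemma kahler_flat_space:
  assumes \<pi>: "involution_below (2 * m) \<pi>"
  shows "kahler (flat_space (2 * m)) (flat_metric (2 * m)) (flat_endo (2 * m) (std_complex \<pi>))"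
proof -
  define n where "n = 2 * m"
  note \<pi>' = \<pi>[folded n_def]
  let ?M = "flat_space n" and ?E = "topspace (Euclidean_space n)" and ?A = "flat_endo n (std_complex \<pi>)"
  note A = flat_endo_std_complex[OF \<pi>, folded n_def]
  have acs: "almost_complex_structure ?M ?A"
    unfolding almost_complex_structure_def endomorphism_on_def
  proof (intro conjI ballI allI impI)
    fix p assume "p \<in> points ?M"
    then have T: "tangent_space ?M p = range (flat_vec n p)" by (simp add: tangent_space_flat_space)
    fix v assume v: "v \<in> tangent_space ?M p"
    show "?A p v \<in> tangent_space ?M p" by (simp add: T flat_endo_def)
    show "?A p (?A p v) = (\<lambda>f. - v f)"
      using v T by (auto simp: A std_complex_twice[OF \<pi>] flat_vec_minus)
    fix w x y
    assume w: "w \<in> tangent_space ?M p"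
    obtain a b where ab: "v = flat_vec n p a" "w = flat_vec n p b" using v w T by auto
    show "?A p (\<lambda>f. x * v f + y * w f) = (\<lambda>f. x * ?A p v f + y * ?A p w f)"
      by (simp add: ab flat_vec_linear A std_complex_linear)
  next
    fix c i f assume c: "c \<in> atlas ?M" and i: "i < mdim ?M" and f: "f \<in> smooth_funs ?M"
    define a where "a = std_complex \<pi> (\<lambda>j. if j = i then 1 else 0)"
    have f': "smooth_on n ?E f" using f by (simp add: smooth_funs_flat_space)
    have "smooth_on n ?E (\<lambda>x. \<Sum>j<n. a j * pd j f x)"
      using f' by (auto intro!: smooth_on_sum smooth_on_mult smooth_on_const smooth_on_pd)
    then have "smooth_on n ?E (\<lambda>x. ?A (chart_inv c x) (coord_vec ?M c (chart_inv c x) i) f)"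
    proof (rule smooth_on_cong[rotated 2])
      fix x assume "x \<in> ?E"
      then show "(\<Sum>j<n. a j * pd j f x) = ?A (chart_inv c x) (coord_vec ?M c (chart_inv c x) i) f"
        using c i f' by (simp add: perm_chart_inv coord_vec_perm_chart A)
          (simp add: flat_vec_def a_def)
    qed simp
    then show "smooth_on (mdim ?M) (snd c ` fst c) (\<lambda>x. ?A (chart_inv c x) (coord_vec ?M c (chart_inv c x) i) f)"
      using c by simp
  qed
  have cs: "complex_structure ?M ?A"
    unfolding complex_structure_def
  proof (intro conjI acs exI[of _ m] ballI)
    show "mdim ?M = 2 * m" by (simp add: n_def)
    fix p assume p: "p \<in> points ?M"
    show "\<exists>c. compatible_chart ?M c \<and> p \<in> fst c \<and>
           (\<forall>q\<in>fst c. \<forall>k<m.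
              ?A q (coord_vec ?M c q (2 * k)) = coord_vec ?M c q (2 * k + 1) \<and>
              ?A q (coord_vec ?M c q (2 * k + 1)) = (\<lambda>f. - coord_vec ?M c q (2 * k) f))"
    proof (intro exI[of _ "perm_chart n \<pi>"] conjI ballI allI impI)
      fix q k assume q: "q \<in> fst (perm_chart n \<pi>)" and k: "k < m"
      have "2 * k < n" "2 * k + 1 < n" using k by (auto simp: n_def)
      note C = coord_vec_perm_chart[OF \<pi>' q[simplified] this(1)]
               coord_vec_perm_chart[OF \<pi>' q[simplified] this(2)]
      have inj: "\<pi> i = \<pi> j \<longleftrightarrow> i = j" for i j by (metis \<pi> involution_below_twice)
      have sw: "parity_swap i = 2 * k \<longleftrightarrow> i = 2 * k + 1" "parity_swap i = 2 * k + 1 \<longleftrightarrow> i = 2 * k" for i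
        unfolding parity_swap_def by presburger+
      have eq: "\<pi> i = j \<longleftrightarrow> i = \<pi> j" for i j by (metis \<pi> involution_below_twice)
      \<comment> \<open>The basis vectors numbered \<open>\<pi> (2 * k)\<close> and
        \<open>\<pi> (2 * k + 1)\<close> are the coordinate vectors 2k and 2k+1 of the permuted
        chart; this and the next claim say that the structure rotates one into the other.\<close>
      have 1: "std_complex \<pi> (\<lambda>j. if j = \<pi> (2 * k) then 1 else 0) = (\<lambda>j. if j = \<pi> (2 * k + 1) then 1 else 0)"
      proof
        fix i
        have "i = \<pi> (2 * k + 1) \<longleftrightarrow> \<pi> i = 2 * k + 1" using eq by blast
        then show "std_complex \<pi> (\<lambda>j. if j = \<pi> (2 * k) then 1 else 0) i = (if i = \<pi> (2 * k + 1) then 1 else 0)"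
          by (simp add: std_complex_def inj sw)
      qed
      have 2: "std_complex \<pi> (\<lambda>j. if j = \<pi> (2 * k + 1) then 1 else 0) = (\<lambda>j. - (if j = \<pi> (2 * k) then 1 else 0))"
      proof
        fix i
        have "i = \<pi> (2 * k) \<longleftrightarrow> \<pi> i = 2 * k" using eq by blast
        then show "std_complex \<pi> (\<lambda>j. if j = \<pi> (2 * k + 1) then 1 else 0) i = - (if i = \<pi> (2 * k) then 1 else 0)"
          by (simp add: std_complex_def inj sw[unfolded Suc_eq_plus1[symmetric]])
      qed
      show "?A q (coord_vec ?M (perm_chart n \<pi>) q (2 * k)) = coord_vec ?M (perm_chart n \<pi>) q (2 * k + 1)"
        unfolding C A 1 ..
      show "?A q (coord_vec ?M (perm_chart n \<pi>) q (2 * k + 1)) = (\<lambda>f. - coord_vec ?M (perm_chart n \<pi>) q (2 * k) f)"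
        unfolding C A 2 flat_vec_minus ..
    qed (use p in \<open>auto simp: compatible_perm_chart[OF \<pi>']\<close>)
  qed
  \<comment> \<open>\<open>std_complex \<pi>\<close> is a signed permutation of the coordinates
    along an involution, and each sign enters the product twice.\<close>
  have iso: "(\<Sum>i<n. std_complex \<pi> a i * std_complex \<pi> b i) = (\<Sum>i<n. a i * b i)" for a b
  proof -
    let ?\<tau> = "\<lambda>i. \<pi> (parity_swap (\<pi> i))"
    have "?\<tau> i < n" if "i < n" for i
      using that \<pi> by (simp add: involution_below_less_iff[OF \<pi>'] n_def parity_swap_less involution_below_less_iff)
    then show ?thesis
      by (intro sum.reindex_bij_witness[of _ ?\<tau> ?\<tau>]) (use \<pi> in \<open>auto simp: std_complex_def\<close>)
  qed
  have closed: "closed_2form ?M (kahler_form (flat_metric n) ?A)"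
    unfolding closed_2form_def
  proof (intro ballI allI impI)
    fix c i j k x
    assume c: "c \<in> atlas ?M" and ijk: "i < mdim ?M" "j < mdim ?M" "k < mdim ?M" and "x \<in> snd c ` fst c"
    then have x: "x \<in> ?E" by simp
    have *: "pd i (form_component ?M (kahler_form (flat_metric n) ?A) c j k) x = 0"
      if "i < n" "j < n" "k < n" for i j k
    proof -
      let ?d = "\<lambda>i j. if j = i then 1 else 0 :: real"
      have "pd i (form_component ?M (kahler_form (flat_metric n) ?A) c j k) x =
          pd i (\<lambda>x. \<Sum>l<n. std_complex \<pi> (?d j) l * ?d k l) x"
        by (rule pd_cong(2)[OF openin_topspace_Euclidean_space x that(1)])
           (use c that in \<open>simp add: form_component_def kahler_form_def perm_chart_inv coord_vec_perm_chart A\<close>)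
      also have "\<dots> = 0" by (rule pd_eqI) simp
      finally show ?thesis .
    qed
    show "pd i (form_component ?M (kahler_form (flat_metric n) ?A) c j k) x +
          pd j (form_component ?M (kahler_form (flat_metric n) ?A) c k i) x +
          pd k (form_component ?M (kahler_form (flat_metric n) ?A) c i j) x = 0"
      using ijk by (simp add: *)
  qed
  have "flat_metric n p (?A p v) (?A p w) = flat_metric n p v w"
    if "p \<in> points ?M" "v \<in> tangent_space ?M p" "w \<in> tangent_space ?M p" for p v w
    using that by (auto simp: tangent_space_flat_space A iso)
  with cs closed have "kahler ?M (flat_metric n) ?A" unfolding kahler_def by blast
  then show ?thesis by (simp add: n_def)
qed

subsection \<open>Completeness\<close>

text \<open>Serves to show that the speed of a piecewise C^1 curve is integrable. Otherwise
  \<open>integral\<close> would take its default value 0 and lengths could not be bounded below.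
  Each break point inside the interval splits it in two.\<close>

lemma integrable_on_piecewise:
  fixes f :: "real \<Rightarrow> real"
  assumes "finite S"
    and "\<And>a b. c \<le> a \<Longrightarrow> a < b \<Longrightarrow> b \<le> d \<Longrightarrow> {a<..<b} \<inter> S = {} \<Longrightarrow> f integrable_on {a..b}"
  shows "f integrable_on {c..d}"
  using assms
proof (induction S arbitrary: c d rule: finite_induct)
  case empty
  consider "c < d" | "c = d" | "c > d" by linarith
  then show ?case by cases (use empty integrable_on_refl[of f c] in auto)
next
  case (insert s S)
  show ?case
  proof (cases "c < s \<and> s < d")
    case True
    have "f integrable_on {c..s}" "f integrable_on {s..d}"
      by (rule insert.IH; rule insert.prems; use True in auto)+
    with True show ?thesis
      using Henstock_Kurzweil_Integration.integrable_combine[of c s d f] by simp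
  next
    case False
    show ?thesis
      by (rule insert.IH, rule insert.prems) (use False in auto)
  qed
qed

definition euclid_dist :: "nat \<Rightarrow> (nat \<Rightarrow> real) \<Rightarrow> (nat \<Rightarrow> real) \<Rightarrow> real" where
  "euclid_dist n p q = L2_set (\<lambda>i. p i - q i) {..<n}"

lemma flat_speed:
  "sqrt (flat_metric n q (velocity (flat_space n) \<gamma> t) (velocity (flat_space n) \<gamma> t)) =
     L2_set (\<lambda>i. deriv (\<lambda>s. \<gamma> s i) t) {..<n}"
  by (simp add: flat_metric_def velocity_def smooth_funs_flat_space smooth_on_coordinate L2_set_def power2_eq_square)

lemma curve_length_flat_space:
  "curve_length (flat_space n) (flat_metric n) \<gamma> =
     integral {0..1} (\<lambda>t. L2_set (\<lambda>i. deriv (\<lambda>s. \<gamma> s i) t) {..<n})"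
  by (simp add: curve_length_def flat_speed)

text \<open>The velocity is projected onto the chord \<open>w\<close>. By the fundamental theorem of
  calculus the projection integrates to |w|^2, and by the Cauchy-Schwarz inequality it is at most
  |w| times the speed.\<close>

lemma curve_length_ge_euclid_dist:
  assumes \<gamma>: "piecewise_C1_curve (flat_space n) \<gamma>"
  shows "euclid_dist n (\<gamma> 1) (\<gamma> 0) \<le> curve_length (flat_space n) (flat_metric n) \<gamma>"
proof -
  obtain S where S: "finite S"
    and C1: "\<And>a b f. 0 \<le> a \<Longrightarrow> a < b \<Longrightarrow> b \<le> 1 \<Longrightarrow> {a<..<b} \<inter> S = {} \<Longrightarrow> f \<in> smooth_funs (flat_space n) \<Longrightarrow>
       \<exists>D. continuous_on {a..b} D \<and> (\<forall>t\<in>{a..b}. ((\<lambda>s. f (\<gamma> s)) has_real_derivative D t) (at t within {a..b}))"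
    using \<gamma> unfolding piecewise_C1_curve_def by metis
  \<comment> \<open>Continuity at the break points is what lets the fundamental theorem be applied
    across them.\<close>
  have cont: "continuous_on {0..1} (\<lambda>t. \<gamma> t i)" for i
  proof -
    have "continuous_map (top_of_set {0..1}) (Euclidean_space n) \<gamma>"
      using \<gamma> by (simp add: piecewise_C1_curve_def)
    then have "continuous_map (top_of_set {0..1}) euclidean \<gamma>"
      by (metis Euclidean_space_eq_top_of_set continuous_map_in_subtopology)
    then show ?thesis
      by (simp add: continuous_on_product_then_coordinatewise)
  qed
  define v where "v = (\<lambda>t i. deriv (\<lambda>s. \<gamma> s i) t)"
  define w where "w = (\<lambda>i. \<gamma> 1 i - \<gamma> 0 i)"
  define r where "r = L2_set w {..<n}"
  have piece: "\<exists>D. continuous_on {a..b} D \<and> (\<forall>t\<in>{a<..<b}. ((\<lambda>s. \<gamma> s i) has_real_derivative D t) (at t))"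
    if ab: "0 \<le> a" "a < b" "b \<le> 1" "{a<..<b} \<inter> S = {}" for a b i
  proof -
    obtain D where D: "continuous_on {a..b} D"
      "\<forall>t\<in>{a..b}. ((\<lambda>s. \<gamma> s i) has_real_derivative D t) (at t within {a..b})"
      using C1[OF ab, of "\<lambda>x. x i"] by (auto simp: smooth_funs_flat_space smooth_on_coordinate)
    have "((\<lambda>s. \<gamma> s i) has_real_derivative D t) (at t)" if "t \<in> {a<..<b}" for t
      using bspec[OF D(2), of t] that by (simp add: at_within_Icc_at)
    with D(1) show ?thesis by blast
  qed
  have speed: "(\<lambda>t. L2_set (v t) {..<n}) integrable_on {0..1}"
  proof (rule integrable_on_piecewise[OF S])
    fix a b :: real assume ab: "0 \<le> a" "a < b" "b \<le> 1" "{a<..<b} \<inter> S = {}"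
    obtain D where D: "\<And>i. continuous_on {a..b} (D i)"
      "\<And>i t. t \<in> {a<..<b} \<Longrightarrow> ((\<lambda>s. \<gamma> s i) has_real_derivative D i t) (at t)"
      using piece[OF ab] by metis
    have "continuous_on {a..b} (\<lambda>t. L2_set (\<lambda>i. D i t) {..<n})"
      unfolding L2_set_def by (intro continuous_intros D(1))
    then have "(\<lambda>t. L2_set (\<lambda>i. D i t) {..<n}) integrable_on cbox a b"
      by (simp add: integrable_continuous_interval)
    \<comment> \<open>At the ends of a piece the two-sided \<open>deriv\<close> may have no meaning,
      so it is compared with the one-sided derivative \<open>D\<close> on the open interval
      only.\<close>
    then have "(\<lambda>t. L2_set (v t) {..<n}) integrable_on cbox a b"
      by (rule integrable_spike_interior[rotated]) (auto simp: v_def DERIV_imp_deriv[OF D(2)])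
    then show "(\<lambda>t. L2_set (v t) {..<n}) integrable_on {a..b}" by simp
  qed
  have "((\<lambda>t. \<Sum>i<n. w i * v t i) has_integral
      (\<Sum>i<n. w i * \<gamma> 1 i) - (\<Sum>i<n. w i * \<gamma> 0 i)) {0..1}"
  proof (rule fundamental_theorem_of_calculus_interior_strong[OF S])
    fix t assume t: "t \<in> {0<..<1} - S"
    have "open ({0<..<1} - S)" using S by (simp add: finite_imp_closed open_Diff)
    \<comment> \<open>A window around \<open>t\<close> that avoids all break points, so that
      \<open>piece\<close> yields a two-sided derivative at its centre.\<close>
    then obtain e where e: "e > 0" "cball t e \<subseteq> {0<..<1} - S"
      using t open_contains_cball by metis
    have e': "{t - e..t + e} \<subseteq> {0<..<1} - S" using e(2) by (simp add: cball_eq_atLeastAtMost)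
    have "t - e \<in> {0<..<1} - S" "t + e \<in> {0<..<1} - S"
      by (rule subsetD[OF e'], use e(1) in simp)+
    then have "0 \<le> t - e" "t - e < t + e" "t + e \<le> 1" "{t - e<..<t + e} \<inter> S = {}"
      using e(1) subsetD[OF e'] by auto
    from piece[OF this] e(1) have "\<exists>D. ((\<lambda>s. \<gamma> s i) has_real_derivative D) (at t)" for i
      by (metis greaterThanLessThan_iff less_add_same_cancel1 diff_less_eq)
    then have "((\<lambda>s. \<gamma> s i) has_real_derivative v t i) (at t)" for i
      unfolding v_def using DERIV_imp_deriv by metis
    then show "((\<lambda>t. \<Sum>i<n. w i * \<gamma> t i) has_vector_derivative (\<Sum>i<n. w i * v t i)) (at t)"
      unfolding has_real_derivative_iff_has_vector_derivative[symmetric]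
      by (intro DERIV_sum DERIV_cmult)
  next
    show "continuous_on {0..1} (\<lambda>t. \<Sum>i<n. w i * \<gamma> t i)"
      by (intro continuous_intros cont)
  qed simp
  moreover have "(\<Sum>i<n. w i * \<gamma> 1 i) - (\<Sum>i<n. w i * \<gamma> 0 i) = r * r"
  proof -
    have "r * r = (\<Sum>i<n. w i * w i)"
      unfolding r_def L2_set_def real_sqrt_mult_self by (simp add: sum_nonneg power2_eq_square)
    then show ?thesis
      by (simp add: sum_subtractf[symmetric] right_diff_distrib[symmetric]) (simp add: w_def)
  qed
  moreover have "((\<lambda>t. r * L2_set (v t) {..<n}) has_integral r * integral {0..1} (\<lambda>t. L2_set (v t) {..<n})) {0..1}"
    using has_integral_mult_right[OF integrable_integral[OF speed]] by blast
  moreover have "(\<Sum>i<n. w i * v t i) \<le> r * L2_set (v t) {..<n}" for t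
  proof -
    have "(\<Sum>i<n. w i * v t i) \<le> (\<Sum>i<n. \<bar>w i\<bar> * \<bar>v t i\<bar>)"
      by (intro sum_mono) (metis abs_ge_self abs_mult)
    also have "\<dots> \<le> r * L2_set (v t) {..<n}" unfolding r_def by (rule L2_set_mult_ineq)
    finally show ?thesis .
  qed
  ultimately have "r * r \<le> r * integral {0..1} (\<lambda>t. L2_set (v t) {..<n})"
    using has_integral_le[where f = "\<lambda>t. \<Sum>i<n. w i * v t i" and g = "\<lambda>t. r * L2_set (v t) {..<n}"] by metis
  moreover have "r \<ge> 0" "integral {0..1} (\<lambda>t. L2_set (v t) {..<n}) \<ge> 0"
    by (auto simp: r_def intro!: Henstock_Kurzweil_Integration.integral_nonneg speed)
  \<comment> \<open>The factor \<open>r\<close> cancels unless it is 0, and then non-negativity of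
    the length is enough.\<close>
  ultimately have "r \<le> integral {0..1} (\<lambda>t. L2_set (v t) {..<n})"
    by (cases "r = 0") auto
  then show ?thesis
    by (simp add: curve_length_flat_space euclid_dist_def r_def w_def v_def)
qed

text \<open>The straight segment attains the lower bound for lengths, so the infimum in the
  Riemannian distance is a minimum.\<close>

lemma segment_length:
  assumes p: "p \<in> topspace (Euclidean_space n)" and q: "q \<in> topspace (Euclidean_space n)"
  defines "\<gamma> \<equiv> \<lambda>t i. (1 - t) * p i + t * q i"
  shows "piecewise_C1_curve (flat_space n) \<gamma>"
    and "curve_length (flat_space n) (flat_metric n) \<gamma> = euclid_dist n q p"
proof -
  have E: "\<gamma> t \<in> topspace (Euclidean_space n)" for t
    using p q by (auto simp: \<gamma>_def topspace_Euclidean_space)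
  have cont: "continuous_on A \<gamma>" for A
    by (rule continuous_on_coordinatewise_then_product) (unfold \<gamma>_def, intro continuous_intros)
  have d: "((\<lambda>s. \<gamma> s i) has_real_derivative q i - p i) (at t)" for i t
    unfolding \<gamma>_def by (auto intro!: derivative_eq_intros)
  have C1: "\<exists>D. continuous_on {a..b} D \<and> (\<forall>t\<in>{a..b}. ((\<lambda>s. f (\<gamma> s)) has_real_derivative D t) (at t within {a..b}))"
    if f: "f \<in> smooth_funs (flat_space n)" for f and a b :: real
  proof (intro exI[of _ "\<lambda>t. \<Sum>j<n. pd j f (\<gamma> t) * (q j - p j)"] conjI ballI)
    have f': "smooth_on n (topspace (Euclidean_space n)) f" using f by (simp add: smooth_funs_flat_space)
    have c: "continuous_on (topspace (Euclidean_space n)) (pd j f)" if "j < n" for j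
      by (rule smooth_on_imp_continuous_on[OF openin_topspace_Euclidean_space smooth_on_pd[OF _ f' that]]) simp
    show "continuous_on {a..b} (\<lambda>t. \<Sum>j<n. pd j f (\<gamma> t) * (q j - p j))"
      by (intro continuous_on_sum continuous_on_mult_right continuous_on_compose2[OF c cont]) (use E in auto)
    fix t
    show "((\<lambda>s. f (\<gamma> s)) has_real_derivative (\<Sum>j<n. pd j f (\<gamma> t) * (q j - p j))) (at t within {a..b})"
    proof (rule has_field_derivative_at_within, rule chain_rule_curve[OF openin_topspace_Euclidean_space])
      show "(\<lambda>t. f (y(i := t))) differentiable (at (y i))"
        if "i < n" "y \<in> topspace (Euclidean_space n)" for i y
        by (rule DERIV_differentiable[OF smooth_on_DERIV[OF openin_topspace_Euclidean_space f' that]])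
    qed (use E c d in auto)
  qed
  have "continuous_map (top_of_set {0..1}) (Euclidean_space n) \<gamma>"
    by (subst Euclidean_space_eq_top_of_set) (use cont E in \<open>auto simp: continuous_map_in_subtopology\<close>)
  with C1 show "piecewise_C1_curve (flat_space n) \<gamma>"
    unfolding piecewise_C1_curve_def by (auto intro!: exI[of _ "{}"])
  show "curve_length (flat_space n) (flat_metric n) \<gamma> = euclid_dist n q p"
    by (simp add: curve_length_flat_space euclid_dist_def DERIV_imp_deriv[OF d])
qed

lemma euclid_dist_commute: "euclid_dist n p q = euclid_dist n q p"
  by (simp add: euclid_dist_def L2_set_def power2_commute)

lemma riemannian_dist_flat_space:
  assumes p: "p \<in> topspace (Euclidean_space n)" and q: "q \<in> topspace (Euclidean_space n)"
  shows "riemannian_dist (flat_space n) (flat_metric n) p q = euclid_dist n p q"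
proof -
  let ?\<gamma> = "\<lambda>t i. (1 - t) * p i + t * q i"
  have "Inf {curve_length (flat_space n) (flat_metric n) \<gamma> | \<gamma>.
      piecewise_C1_curve (flat_space n) \<gamma> \<and> \<gamma> 0 = p \<and> \<gamma> 1 = q} = euclid_dist n p q"
  proof (rule cInf_eq_minimum)
    show "euclid_dist n p q \<in> {curve_length (flat_space n) (flat_metric n) \<gamma> | \<gamma>.
      piecewise_C1_curve (flat_space n) \<gamma> \<and> \<gamma> 0 = p \<and> \<gamma> 1 = q}"
      using segment_length[OF p q] by (auto simp: euclid_dist_commute intro!: exI[of _ ?\<gamma>])
  qed (use curve_length_ge_euclid_dist in \<open>auto simp: euclid_dist_commute[of n p q]\<close>)
  then show ?thesis using p q by (simp add: riemannian_dist_def)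
qed

lemma coordinate_le_euclid_dist: "i < n \<Longrightarrow> \<bar>p i - q i\<bar> \<le> euclid_dist n p q"
  using member_le_L2_set[of "{..<n}" i "\<lambda>i. \<bar>p i - q i\<bar>"]
  by (simp add: euclid_dist_def L2_set_def)

lemma complete_riemannian_flat_space: "complete_riemannian (flat_space n) (flat_metric n)"
proof -
  let ?E = "topspace (Euclidean_space n)" and ?d = "riemannian_dist (flat_space n) (flat_metric n)"
  have off: "?d p q = 0" if "\<not> (p \<in> ?E \<and> q \<in> ?E)" for p q
    using that by (auto simp: riemannian_dist_def)
  interpret Metric_space ?E ?d
  proof
    fix x y z
    show "0 \<le> ?d x y"
      by (cases "x \<in> ?E \<and> y \<in> ?E") (auto simp: off riemannian_dist_flat_space euclid_dist_def)
    show "?d x y = ?d y x"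
      by (cases "x \<in> ?E \<and> y \<in> ?E") (auto simp: off riemannian_dist_flat_space euclid_dist_commute)
    assume xy: "x \<in> ?E" "y \<in> ?E"
    show "?d x y = 0 \<longleftrightarrow> x = y"
    proof
      assume "?d x y = 0"
      then have "x i = y i" if "i < n" for i
        using coordinate_le_euclid_dist[OF that, of x y] xy by (simp add: riemannian_dist_flat_space)
      moreover have "x i = y i" if "\<not> i < n" for i
        using xy that by (simp add: topspace_Euclidean_space)
      ultimately show "x = y" by (intro ext) blast
    qed (use xy in \<open>simp add: riemannian_dist_flat_space euclid_dist_def L2_set_def\<close>)
    assume z: "z \<in> ?E"
    have "L2_set (\<lambda>i. (x i - y i) + (y i - z i)) {..<n}
        \<le> L2_set (\<lambda>i. x i - y i) {..<n} + L2_set (\<lambda>i. y i - z i) {..<n}"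
      by (rule L2_set_triangle_ineq)
    then show "?d x z \<le> ?d x y + ?d y z"
      using xy z by (simp add: riemannian_dist_flat_space euclid_dist_def)
  qed
  have "mcomplete"
    unfolding mcomplete_def
  proof (intro allI impI)
    fix \<sigma> assume \<sigma>: "MCauchy \<sigma>"
    then have E: "\<sigma> k \<in> ?E" for k by (auto simp: MCauchy_def)
    have C: "Cauchy (\<lambda>k. \<sigma> k i)" if "i < n" for i
    proof (rule metric_CauchyI)
      fix e :: real assume "e > 0"
      then obtain N where N: "\<forall>k k'. N \<le> k \<longrightarrow> N \<le> k' \<longrightarrow> ?d (\<sigma> k) (\<sigma> k') < e"
        using \<sigma> unfolding MCauchy_def by blast
      have "dist (\<sigma> k i) (\<sigma> k' i) < e" if "k \<ge> N" "k' \<ge> N" for k k'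
        using coordinate_le_euclid_dist[OF \<open>i < n\<close>, of "\<sigma> k" "\<sigma> k'"] N that E
        by (fastforce simp: riemannian_dist_flat_space dist_real_def)
      then show "\<exists>N. \<forall>k\<ge>N. \<forall>k'\<ge>N. dist (\<sigma> k i) (\<sigma> k' i) < e" by blast
    qed
    \<comment> \<open>The coordinatewise limit, set to 0 from index \<open>n\<close> on so that it
      lies in the space.\<close>
    define x where "x = (\<lambda>i. if i < n then lim (\<lambda>k. \<sigma> k i) else 0)"
    have x: "x \<in> ?E" by (simp add: x_def topspace_Euclidean_space)
    have lim: "(\<lambda>k. \<sigma> k i) \<longlonglongrightarrow> x i" if "i < n" for i
      using C[OF that] that by (simp add: x_def Cauchy_convergent convergent_LIMSEQ_iff[symmetric])
    have "(\<lambda>k. euclid_dist n (\<sigma> k) x) \<longlonglongrightarrow> sqrt (\<Sum>i<n. (x i - x i)\<^sup>2)"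
      unfolding euclid_dist_def L2_set_def by (intro tendsto_intros lim) simp
    then have "(\<lambda>k. euclid_dist n (\<sigma> k) x) \<longlonglongrightarrow> 0" by simp
    then have "\<exists>N. \<forall>k\<ge>N. euclid_dist n (\<sigma> k) x < e" if "e > 0" for e
      using that order_tendstoD(2)[of _ 0 sequentially e] by (auto simp: eventually_sequentially)
    then show "\<exists>x. limitin mtopology \<sigma> x sequentially"
      using E x by (auto simp: limit_metric_sequentially riemannian_dist_flat_space intro!: exI[of _ x])
  qed
  then show ?thesis
    using Metric_space_axioms by (simp add: complete_riemannian_def)
qed

section \<open>Charts onto all of Euclidean space\<close>

text \<open>A chart whose image is all of Euclidean space, together with an explicit inverse
  \<open>\<psi>\<close>. The formula for \<open>\<psi>\<close> takes the place of
  \<open>chart_inv\<close>, which is defined by choice and hence unsuited to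
  differentiation.\<close>

definition global_param :: "nat \<Rightarrow> 'a chart \<Rightarrow> ((nat \<Rightarrow> real) \<Rightarrow> 'a) \<Rightarrow> bool" where
  "global_param n c \<psi> \<longleftrightarrow>
     (\<forall>x\<in>fst c. snd c x \<in> topspace (Euclidean_space n) \<and> \<psi> (snd c x) = x) \<and>
     (\<forall>y\<in>topspace (Euclidean_space n). \<psi> y \<in> fst c \<and> snd c (\<psi> y) = y)"

lemma global_param_image_Int:
  assumes "global_param n c \<psi>"
  shows "snd c ` (fst c \<inter> P) = {y \<in> topspace (Euclidean_space n). \<psi> y \<in> P}" (is "?L = ?R")
proof (intro equalityI subsetI)
  fix y assume "y \<in> ?R"
  then have "\<psi> y \<in> fst c \<inter> P" "y = snd c (\<psi> y)" using assms by (simp_all add: global_param_def)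
  then show "y \<in> ?L" by (rule rev_image_eqI)
qed (use assms in \<open>auto simp: global_param_def\<close>)

lemma global_param_image: "global_param n c \<psi> \<Longrightarrow> snd c ` fst c = topspace (Euclidean_space n)"
  using global_param_image_Int[of n c \<psi> UNIV] by simp

lemma global_param_inv:
  assumes "global_param n c \<psi>" "y \<in> topspace (Euclidean_space n)"
  shows "chart_inv c y = \<psi> y"
proof -
  have "inj_on (snd c) (fst c)"
    using assms(1) unfolding global_param_def by (metis inj_onI)
  then show ?thesis
    using assms inv_into_f_f[of "snd c" "fst c" "\<psi> y"] by (simp add: global_param_def)
qed

lemma global_param_perm_chart:
  "involution_below n \<pi> \<Longrightarrow> global_param n (perm_chart n \<pi>) (\<lambda>x. x \<circ> \<pi>)"
  using comp_involution_in_topspace comp_involution_twice by (fastforce simp: global_param_def)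

definition low_coords :: "nat \<Rightarrow> (nat \<Rightarrow> real) \<Rightarrow> nat \<Rightarrow> real" where
  "low_coords m z = (\<lambda>i. if i < m then z i else 0)"

definition high_coords :: "nat \<Rightarrow> (nat \<Rightarrow> real) \<Rightarrow> nat \<Rightarrow> real" where
  "high_coords m z = (\<lambda>i. z (i + m))"

lemma low_coords_in: "low_coords m z \<in> topspace (Euclidean_space m)"
  by (simp add: low_coords_def topspace_Euclidean_space)

lemma high_coords_in:
  "z \<in> topspace (Euclidean_space (m + n)) \<Longrightarrow> high_coords m z \<in> topspace (Euclidean_space n)"
  by (simp add: high_coords_def topspace_Euclidean_space)

lemma global_param_prod_chart:
  assumes c: "global_param m c \<psi>" and d: "global_param n d \<phi>"
  shows "global_param (m + n) (prod_chart m c d) (\<lambda>z. (\<psi> (low_coords m z), \<phi> (high_coords m z)))"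
  unfolding global_param_def
proof (intro conjI ballI)
  fix x assume "x \<in> fst (prod_chart m c d)"
  then obtain a b where x: "x = (a, b)" "a \<in> fst c" "b \<in> fst d" by (auto simp: prod_chart_def)
  have E: "snd c a \<in> topspace (Euclidean_space m)" "snd d b \<in> topspace (Euclidean_space n)"
    using c d x by (auto simp: global_param_def)
  let ?z = "snd (prod_chart m c d) x"
  have z: "?z = (\<lambda>i. if i < m then snd c a i else snd d b (i - m))"
    by (simp add: prod_chart_def x)
  show "?z \<in> topspace (Euclidean_space (m + n))"
    using E(2) by (auto simp: z topspace_Euclidean_space)
  have "low_coords m ?z = snd c a" "high_coords m ?z = snd d b"
    using E(1) by (auto simp: z low_coords_def high_coords_def topspace_Euclidean_space fun_eq_iff)
  then show "(\<psi> (low_coords m ?z), \<phi> (high_coords m ?z)) = x"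
    using c d x by (simp add: global_param_def)
next
  fix z assume z: "z \<in> topspace (Euclidean_space (m + n))"
  have 1: "\<psi> (low_coords m z) \<in> fst c" "snd c (\<psi> (low_coords m z)) = low_coords m z"
    using c low_coords_in by (auto simp: global_param_def)
  have 2: "\<phi> (high_coords m z) \<in> fst d" "snd d (\<phi> (high_coords m z)) = high_coords m z"
    using d high_coords_in[OF z] by (auto simp: global_param_def)
  show "(\<psi> (low_coords m z), \<phi> (high_coords m z)) \<in> fst (prod_chart m c d)"
    using 1 2 by (simp add: prod_chart_def)
  show "snd (prod_chart m c d) (\<psi> (low_coords m z), \<phi> (high_coords m z)) = z"
    using 1 2 by (auto simp: prod_chart_def low_coords_def high_coords_def fun_eq_iff)
qed

lemma smooth_on_low_coords:
  assumes "smooth_on m (topspace (Euclidean_space m)) f"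
  shows "smooth_on (m + n) (topspace (Euclidean_space (m + n))) (\<lambda>z. f (low_coords m z))"
  by (rule smooth_on_compose[OF _ _ low_coords_in _ assms])
     (simp_all add: low_coords_def smooth_on_coordinate)

lemma smooth_on_high_coords:
  assumes "smooth_on n (topspace (Euclidean_space n)) f"
  shows "smooth_on (m + n) (topspace (Euclidean_space (m + n))) (\<lambda>z. f (high_coords m z))"
  by (rule smooth_on_compose[OF _ _ high_coords_in _ assms])
     (simp_all add: high_coords_def smooth_on_coordinate)

section \<open>Quaternions\<close>

lemma sum_below_3: "(\<Sum>i<3. f i) = f 0 + f (Suc 0) + f 2" for f :: "nat \<Rightarrow> real"
  by (simp add: eval_nat_numeral lessThan_Suc algebra_simps)

lemma sum_below_4: "(\<Sum>i<4. f i) = f 0 + f (Suc 0) + f 2 + f 3" for f :: "nat \<Rightarrow> real"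
  by (simp add: eval_nat_numeral lessThan_Suc algebra_simps)

lemma less_3_cases: "i < (3::nat) \<longleftrightarrow> i = 0 \<or> i = Suc 0 \<or> i = 2"
  by auto

lemma less_4_cases: "i < (4::nat) \<longleftrightarrow> i = 0 \<or> i = Suc 0 \<or> i = 2 \<or> i = 3"
  by auto

definition quat :: "real \<Rightarrow> real \<Rightarrow> real \<Rightarrow> real \<Rightarrow> nat \<Rightarrow> real" where
  "quat a b c d i = (if i = 0 then a else if i = 1 then b else if i = 2 then c else if i = 3 then d else 0)"

lemma quat_simps [simp]:
  "quat a b c d 0 = a" "quat a b c d (Suc 0) = b" "quat a b c d 2 = c" "quat a b c d 3 = d"
  "4 \<le> i \<Longrightarrow> quat a b c d i = 0"
  by (simp_all add: quat_def)

lemma quat_in [simp]: "quat a b c d \<in> topspace (Euclidean_space 4)"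
  by (simp add: topspace_Euclidean_space)

lemma quat_eqI:
  assumes "x \<in> topspace (Euclidean_space 4)" "y \<in> topspace (Euclidean_space 4)"
    "x 0 = y 0" "x (Suc 0) = y (Suc 0)" "x 2 = y 2" "x 3 = y 3"
  shows "x = y"
proof
  fix i
  show "x i = y i"
  proof (cases "i < 4")
    case True then show ?thesis using assms by (auto simp: less_4_cases)
  next
    case False then show ?thesis using assms(1,2) by (simp add: topspace_Euclidean_space)
  qed
qed

definition qmul :: "(nat \<Rightarrow> real) \<Rightarrow> (nat \<Rightarrow> real) \<Rightarrow> nat \<Rightarrow> real" where
  "qmul x y = quat
     (x 0 * y 0 - x (Suc 0) * y (Suc 0) - x 2 * y 2 - x 3 * y 3)
     (x 0 * y (Suc 0) + x (Suc 0) * y 0 + x 2 * y 3 - x 3 * y 2)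
     (x 0 * y 2 - x (Suc 0) * y 3 + x 2 * y 0 + x 3 * y (Suc 0))
     (x 0 * y 3 + x (Suc 0) * y 2 - x 2 * y (Suc 0) + x 3 * y 0)"

definition qcnj :: "(nat \<Rightarrow> real) \<Rightarrow> nat \<Rightarrow> real" where
  "qcnj x = quat (x 0) (- x (Suc 0)) (- x 2) (- x 3)"

definition qone :: "nat \<Rightarrow> real" where
  "qone = quat 1 0 0 0"

definition qnorm2 :: "(nat \<Rightarrow> real) \<Rightarrow> real" where
  "qnorm2 x = x 0 * x 0 + x (Suc 0) * x (Suc 0) + x 2 * x 2 + x 3 * x 3"

lemma qmul_in [simp]: "qmul x y \<in> topspace (Euclidean_space 4)"
  and qcnj_in [simp]: "qcnj x \<in> topspace (Euclidean_space 4)"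
  and qone_in [simp]: "qone \<in> topspace (Euclidean_space 4)"
  by (simp_all add: qmul_def qcnj_def qone_def)

lemma qmul_assoc: "qmul (qmul x y) z = qmul x (qmul y z)"
  by (rule quat_eqI) (simp_all add: qmul_def algebra_simps)

lemma qmul_qone [simp]:
  "x \<in> topspace (Euclidean_space 4) \<Longrightarrow> qmul qone x = x"
  "x \<in> topspace (Euclidean_space 4) \<Longrightarrow> qmul x qone = x"
  by (rule quat_eqI; simp add: qmul_def qone_def)+

lemma qmul_qcnj: "qmul x (qcnj x) = quat (qnorm2 x) 0 0 0" "qmul (qcnj x) x = quat (qnorm2 x) 0 0 0"
  by (rule quat_eqI; simp add: qmul_def qcnj_def qnorm2_def algebra_simps)+

lemma qnorm2_qmul: "qnorm2 (qmul x y) = qnorm2 x * qnorm2 y"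
  by (simp add: qnorm2_def qmul_def algebra_simps)

lemma qnorm2_qcnj [simp]: "qnorm2 (qcnj x) = qnorm2 x"
  and qnorm2_qone [simp]: "qnorm2 qone = 1"
  by (simp_all add: qnorm2_def qcnj_def qone_def)

section \<open>Topology of the 3-sphere\<close>

definition unit_quats :: "(nat \<Rightarrow> real) set" where
  "unit_quats = {x \<in> topspace (Euclidean_space 4). qnorm2 x = 1}"

lemma topspace_nsphere_3: "topspace (nsphere 3) = unit_quats"
proof -
  have "(\<Sum>i\<le>3. (x i)\<^sup>2) = qnorm2 x" for x :: "nat \<Rightarrow> real"
    using sum_below_4[of "\<lambda>i. (x i)\<^sup>2"]
    by (simp add: lessThan_Suc_atMost[symmetric] qnorm2_def power2_eq_square)
  then show ?thesis
    by (auto simp: unit_quats_def nsphere topspace_Euclidean_space)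
qed

lemma nsphere_3: "nsphere 3 = top_of_set unit_quats"
proof -
  have "nsphere 3 = top_of_set (topspace (nsphere 3))"
    by (simp add: nsphere euclidean_product_topology)
  then show ?thesis by (simp add: topspace_nsphere_3)
qed

text \<open>Two closed hemispheres, both contractible, cover the sphere and share the equator, where
  the quaternion i lies.\<close>

lemma connected_space_nsphere_3: "connected_space (nsphere 3)"
proof -
  let ?A = "topspace (nsphere 3) \<inter> {x. x 0 \<ge> 0}" and ?B = "topspace (nsphere 3) \<inter> {x. x 0 \<le> 0}"
  have "connected_space (subtopology (nsphere 3) ?A)" "connected_space (subtopology (nsphere 3) ?B)"
    unfolding subtopology_restrict
    by (simp_all add: contractible_imp_connected_space contractible_space_upper_hemisphere
        contractible_space_lower_hemisphere)
  then have A: "connectedin (nsphere 3) ?A" and B: "connectedin (nsphere 3) ?B"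
    unfolding connectedin_def by simp_all
  have "quat 0 1 0 0 \<in> ?A \<inter> ?B"
    by (simp add: topspace_nsphere_3 unit_quats_def qnorm2_def)
  then have "?A \<inter> ?B \<noteq> {}" by blast
  with A B have "connectedin (nsphere 3) (?A \<union> ?B)" by (rule connectedin_Un)
  moreover have "?A \<union> ?B = topspace (nsphere 3)" by auto
  ultimately show ?thesis by (simp add: connectedin_topspace)
qed

section \<open>The group of unit quaternions\<close>

definition sphere_group :: "(nat \<Rightarrow> real) monoid" where
  "sphere_group = \<lparr>carrier = unit_quats, mult = qmul, one = qone\<rparr>"

lemma sphere_group_simps [simp]:
  "carrier sphere_group = unit_quats" "x \<otimes>\<^bsub>sphere_group\<^esub> y = qmul x y" "\<one>\<^bsub>sphere_group\<^esub> = qone"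
  by (simp_all add: sphere_group_def)

lemma unit_quats_qmul: "x \<in> unit_quats \<Longrightarrow> y \<in> unit_quats \<Longrightarrow> qmul x y \<in> unit_quats"
  and unit_quats_qcnj: "x \<in> unit_quats \<Longrightarrow> qcnj x \<in> unit_quats"
  and unit_quats_qone: "qone \<in> unit_quats"
  by (simp_all add: unit_quats_def qnorm2_qmul)

lemma group_sphere_group: "group sphere_group"
proof (rule groupI)
  fix x assume "x \<in> carrier sphere_group"
  then show "\<exists>y\<in>carrier sphere_group. y \<otimes>\<^bsub>sphere_group\<^esub> x = \<one>\<^bsub>sphere_group\<^esub>"
    by (intro bexI[of _ "qcnj x"]) (simp_all add: unit_quats_qcnj qmul_qcnj, simp add: unit_quats_def qone_def)
qed (simp_all add: unit_quats_qmul unit_quats_qone qmul_assoc, simp add: unit_quats_def)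

lemma inv_sphere_group: "x \<in> unit_quats \<Longrightarrow> inv\<^bsub>sphere_group\<^esub> x = qcnj x"
  by (rule group.inv_equality[OF group_sphere_group])
     (simp_all add: unit_quats_qcnj qmul_qcnj, simp add: unit_quats_def qone_def)

lemma not_comm_sphere_group: "\<not> comm_group sphere_group"
proof
  assume "comm_group sphere_group"
  then interpret comm_group sphere_group .
  have "quat 0 1 0 0 \<in> unit_quats" "quat 0 0 1 0 \<in> unit_quats"
    by (simp_all add: unit_quats_def qnorm2_def)
  then have "qmul (quat 0 1 0 0) (quat 0 0 1 0) = qmul (quat 0 0 1 0) (quat 0 1 0 0)"
    using m_comm by simp
  then have "qmul (quat 0 1 0 0) (quat 0 0 1 0) 3 = qmul (quat 0 0 1 0) (quat 0 1 0 0) 3" by simp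
  then show False by (simp add: qmul_def)
qed

text \<open>For \<open>s\<close> equal to 1 or -1 this is stereographic projection from the pole
  with real part \<open>- s\<close>. With \<open>s\<close> equal to 1 the neutral element 1 sits at
  the origin.\<close>

definition stereo :: "real \<Rightarrow> (nat \<Rightarrow> real) chart" where
  "stereo s = ({x \<in> unit_quats. 1 + s * x 0 \<noteq> 0}, \<lambda>x i. if i < 3 then x (Suc i) / (1 + s * x 0) else 0)"

definition stereo_inv :: "real \<Rightarrow> (nat \<Rightarrow> real) \<Rightarrow> nat \<Rightarrow> real" where
  "stereo_inv s y =
     (let N = y 0 * y 0 + y (Suc 0) * y (Suc 0) + y 2 * y 2
      in quat (s * ((1 - N) / (1 + N))) (2 * y 0 / (1 + N)) (2 * y (Suc 0) / (1 + N)) (2 * y 2 / (1 + N)))"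

definition sphere_manifold :: "(nat \<Rightarrow> real) manifold" where
  "sphere_manifold = \<lparr>mtop = nsphere 3, mdim = 3, atlas = {stereo 1, stereo (- 1)}\<rparr>"

lemma sphere_manifold_simps [simp]:
  "mtop sphere_manifold = nsphere 3" "mdim sphere_manifold = 3"
  "atlas sphere_manifold = {stereo 1, stereo (- 1)}"
  by (simp_all add: sphere_manifold_def)

lemma fst_stereo: "x \<in> fst (stereo s) \<longleftrightarrow> x \<in> unit_quats \<and> 1 + s * x 0 \<noteq> 0"
  by (simp add: stereo_def)

lemma snd_stereo: "snd (stereo s) x i = (if i < 3 then x (Suc i) / (1 + s * x 0) else 0)"
  by (simp add: stereo_def)

lemma Suc_2_eq_3: "Suc 2 = 3" "Suc (Suc 0) = 2"
  by simp_all

lemma global_param_stereo: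
  assumes s: "s * s = 1"
  shows "global_param 3 (stereo s) (stereo_inv s)"
  unfolding global_param_def
proof (intro conjI ballI)
  fix x assume "x \<in> fst (stereo s)"
  then have x: "x \<in> unit_quats" and nz: "1 + s * x 0 \<noteq> 0" by (auto simp: fst_stereo)
  show "snd (stereo s) x \<in> topspace (Euclidean_space 3)"
    by (simp add: snd_stereo topspace_Euclidean_space)
  \<comment> \<open>The denominator of the projection. On the sphere the imaginary part of
    \<open>x\<close> has squared length 1 - (r - 1)^2 = r (2 - r), so the projected point has
    squared norm \<open>N\<close> equal to (2 - r) / r for either sign \<open>s\<close>.\<close>
  define r where "r = 1 + s * x 0"
  have r: "r \<noteq> 0" using nz by (simp add: r_def)
  define N where "N = (x (Suc 0) * x (Suc 0) + x 2 * x 2 + x 3 * x 3) / (r * r)"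
  have x0: "x 0 = s * (r - 1)" using s by (simp add: r_def algebra_simps)
  have "s * (r - 1) * (s * (r - 1)) = (s * s) * ((r - 1) * (r - 1))" by (simp only: mult_ac)
  then have "x 0 * x 0 = (r - 1) * (r - 1)" unfolding x0 by (simp only: s mult_1)
  then have "x (Suc 0) * x (Suc 0) + x 2 * x 2 + x 3 * x 3 = r * (2 - r)"
    using x by (simp add: unit_quats_def qnorm2_def algebra_simps)
  then have N: "N = (2 - r) / r" using r by (simp add: N_def)
  then have N1: "1 + N = 2 / r" "1 - N = 2 * (r - 1) / r" using r by (simp_all add: field_simps)
  have "stereo_inv s (snd (stereo s) x) =
      quat (s * ((1 - N) / (1 + N))) (2 * (x (Suc 0) / r) / (1 + N)) (2 * (x 2 / r) / (1 + N)) (2 * (x 3 / r) / (1 + N))"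
  proof -
    have "x (Suc 0) / r * (x (Suc 0) / r) + x 2 / r * (x 2 / r) + x 3 / r * (x 3 / r) = N"
      by (simp add: N_def add_divide_distrib)
    then show ?thesis
      by (simp add: stereo_inv_def snd_stereo Let_def r_def[symmetric] Suc_2_eq_3)
  qed
  also have "\<dots> = x"
    by (rule quat_eqI) (use x r in \<open>simp_all add: N1 x0 unit_quats_def\<close>)
  finally show "stereo_inv s (snd (stereo s) x) = x" .
next
  fix y assume y: "y \<in> topspace (Euclidean_space 3)"
  define N where "N = y 0 * y 0 + y (Suc 0) * y (Suc 0) + y 2 * y 2"
  have "N \<ge> 0" by (simp add: N_def)
  then have N1: "1 + N > 0" by simp
  have eq: "stereo_inv s y = quat (s * ((1 - N) / (1 + N))) (2 * y 0 / (1 + N)) (2 * y (Suc 0) / (1 + N)) (2 * y 2 / (1 + N))"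
    by (simp add: stereo_inv_def Let_def N_def)
  \<comment> \<open>The projection's denominator at the reconstructed point. Being positive, it also
    shows that this point is not the omitted pole.\<close>
  have r: "1 + s * stereo_inv s y 0 = 2 / (1 + N)"
  proof -
    have "s * (s * ((1 - N) / (1 + N))) = (1 - N) / (1 + N)" by (simp only: mult.assoc[symmetric] s mult_1)
    then show ?thesis using N1 by (simp add: eq field_simps)
  qed
  have "qnorm2 (stereo_inv s y) = 1"
  proof -
    define q where "q = 1 + N"
    have "s * ((1 - N) / q) * (s * ((1 - N) / q)) = (s * s) * (((1 - N) / q) * ((1 - N) / q))"
      by (simp only: mult_ac)
    also have "\<dots> = (1 - N) * (1 - N) / (q * q)" by (simp add: s)
    finally have 1: "s * ((1 - N) / q) * (s * ((1 - N) / q)) = (1 - N) * (1 - N) / (q * q)" .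
    have 2: "2 * y 0 / q * (2 * y 0 / q) + 2 * y (Suc 0) / q * (2 * y (Suc 0) / q) + 2 * y 2 / q * (2 * y 2 / q)
        = 4 * N / (q * q)"
      by (simp add: N_def add_divide_distrib algebra_simps)
    have "qnorm2 (stereo_inv s y) = (1 - N) * (1 - N) / (q * q) + 4 * N / (q * q)"
      unfolding eq qnorm2_def quat_simps q_def[symmetric] 1 2[symmetric] by (simp only: add.assoc)
    then have "qnorm2 (stereo_inv s y) = ((1 - N) * (1 - N) + 4 * N) / ((1 + N) * (1 + N))"
      by (simp add: add_divide_distrib q_def)
    also have "(1 - N) * (1 - N) + 4 * N = (1 + N) * (1 + N)" by (simp add: algebra_simps)
    finally show ?thesis using N1 by simp
  qed
  then show "stereo_inv s y \<in> fst (stereo s)"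
    using N1 by (simp add: fst_stereo unit_quats_def r) (simp add: eq)
  show "snd (stereo s) (stereo_inv s y) = y"
  proof
    fix i
    show "snd (stereo s) (stereo_inv s y) i = y i"
    proof (cases "i < 3")
      case True
      then show ?thesis unfolding snd_stereo r
        using N1 by (auto simp: less_3_cases eq Suc_2_eq_3)
    next
      case False
      then show ?thesis using y by (simp add: snd_stereo topspace_Euclidean_space)
    qed
  qed
qed

lemma atlas_sphere_manifoldE:
  assumes "c \<in> atlas sphere_manifold"
  obtains s where "s * s = 1" "c = stereo s"
  using assms that[of 1] that[of "-1"] by auto

lemma smooth_on_stereo_inv: "smooth_on 3 (topspace (Euclidean_space 3)) (\<lambda>y. stereo_inv s y i)"
proof -
  let ?N = "\<lambda>y::nat \<Rightarrow> real. y 0 * y 0 + y (Suc 0) * y (Suc 0) + y 2 * y 2"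
  have nz: "1 + ?N y \<noteq> 0" for y
    by (metis add_nonneg_nonneg add_pos_nonneg less_numeral_extra(1,3) zero_le_square)
  note intros = smooth_on_mult smooth_on_divide smooth_on_add smooth_on_diff smooth_on_const smooth_on_coordinate
  show ?thesis
  proof (cases "i < 4")
    case True
    then show ?thesis
      by (auto simp: less_4_cases stereo_inv_def Let_def nz intro!: intros)
  qed (simp add: stereo_inv_def Let_def smooth_on_const)
qed

lemma smooth_on_stereo_compose:
  assumes U: "openin (Euclidean_space n) U"
    and F: "\<And>x. x \<in> U \<Longrightarrow> F x \<in> fst (stereo s)"
    and sm: "\<And>i. i < 4 \<Longrightarrow> smooth_on n U (\<lambda>x. F x i)"
  shows "smooth_on n U (\<lambda>x. snd (stereo s) (F x) j)"
proof (cases "j < 3")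
  case True
  then have "smooth_on n U (\<lambda>x. F x (Suc j) / (1 + s * F x 0))"
    by (intro smooth_on_divide[OF U] smooth_on_add[OF U] smooth_on_mult[OF U] smooth_on_const[OF U] sm)
       (use F in \<open>auto simp: fst_stereo\<close>)
  then show ?thesis using True by (simp add: snd_stereo)
qed (simp add: snd_stereo smooth_on_const[OF U])

lemma openin_preimage_stereo:
  assumes F: "\<And>x. x \<in> topspace (Euclidean_space n) \<Longrightarrow> F x \<in> unit_quats"
    and sm: "\<And>i. i < 4 \<Longrightarrow> smooth_on n (topspace (Euclidean_space n)) (\<lambda>x. F x i)"
  shows "openin (Euclidean_space n) {x \<in> topspace (Euclidean_space n). F x \<in> fst (stereo s)}"
proof -
  have "continuous_on (topspace (Euclidean_space n)) (\<lambda>x. 1 + s * F x 0)"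
    by (intro continuous_intros smooth_on_imp_continuous_on[OF _ sm]) auto
  then have "openin (top_of_set (topspace (Euclidean_space n)))
      (topspace (Euclidean_space n) \<inter> (\<lambda>x. 1 + s * F x 0) -` (- {0}))"
    by (rule continuous_openin_preimage_gen) auto
  moreover have "topspace (Euclidean_space n) \<inter> (\<lambda>x. 1 + s * F x 0) -` (- {0}) =
      {x \<in> topspace (Euclidean_space n). F x \<in> fst (stereo s)}"
    using F by (auto simp: fst_stereo)
  ultimately show ?thesis by (metis Euclidean_space_eq_top_of_set)
qed

text \<open>Smoothness into the sphere may be tested on the four ambient coordinates: a target chart
  is a quotient of these with non-vanishing denominator on its domain, and the preimage of that
  domain is open.\<close>

lemma smooth_map_sphere_manifoldI:
  assumes "continuous_map (mtop X) (nsphere 3) F"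
    and "\<And>c. c \<in> atlas X \<Longrightarrow> \<exists>\<psi>. global_param (mdim X) c \<psi> \<and>
       (\<forall>y\<in>topspace (Euclidean_space (mdim X)). F (\<psi> y) \<in> unit_quats) \<and>
       (\<forall>i<4. smooth_on (mdim X) (topspace (Euclidean_space (mdim X))) (\<lambda>y. F (\<psi> y) i))"
  shows "smooth_map X sphere_manifold F"
  unfolding smooth_map_def
proof (intro conjI ballI allI impI)
  show "continuous_map (mtop X) (mtop sphere_manifold) F" using assms(1) by simp
  fix c d j assume c: "c \<in> atlas X" and d: "d \<in> atlas sphere_manifold"
  let ?n = "mdim X"
  let ?E = "topspace (Euclidean_space ?n)"
  obtain \<psi> where \<psi>: "global_param ?n c \<psi>" and S: "\<And>y. y \<in> ?E \<Longrightarrow> F (\<psi> y) \<in> unit_quats"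
    and sm: "\<And>i. i < 4 \<Longrightarrow> smooth_on ?n ?E (\<lambda>y. F (\<psi> y) i)"
    using assms(2)[OF c] by blast
  obtain s where ds: "d = stereo s" using d by (rule atlas_sphere_manifoldE)
  let ?U = "{y \<in> ?E. F (\<psi> y) \<in> fst (stereo s)}"
  have U: "openin (Euclidean_space ?n) ?U" by (rule openin_preimage_stereo[OF S sm])
  have "smooth_on ?n ?U (\<lambda>y. snd (stereo s) (F (\<psi> y)) j)"
    by (rule smooth_on_stereo_compose[OF U]) (use smooth_on_subset[OF _ U _ sm] in auto)
  then have "smooth_on ?n ?U (\<lambda>y. snd (stereo s) (F (chart_inv c y)) j)"
    by (rule smooth_on_cong[OF U, rotated]) (simp add: global_param_inv[OF \<psi>])
  then show "smooth_on ?n (snd c ` (fst c \<inter> F -` fst d)) (\<lambda>y. snd d (F (chart_inv c y)) j)"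
    by (simp add: global_param_image_Int[OF \<psi>] ds)
qed

lemma smooth_map_flat_spaceI:
  assumes "continuous_map (mtop X) (Euclidean_space m) F"
    and "\<And>c. c \<in> atlas X \<Longrightarrow> \<exists>\<psi>. global_param (mdim X) c \<psi> \<and>
       (\<forall>y\<in>topspace (Euclidean_space (mdim X)). F (\<psi> y) \<in> topspace (Euclidean_space m)) \<and>
       (\<forall>i<m. smooth_on (mdim X) (topspace (Euclidean_space (mdim X))) (\<lambda>y. F (\<psi> y) i))"
  shows "smooth_map X (flat_space m) F"
  unfolding smooth_map_def
proof (intro conjI ballI allI impI)
  show "continuous_map (mtop X) (mtop (flat_space m)) F" using assms(1) by simp
  fix c d j assume c: "c \<in> atlas X" and d: "d \<in> atlas (flat_space m)" and j: "j < mdim (flat_space m)"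
  let ?n = "mdim X"
  let ?E = "topspace (Euclidean_space ?n)"
  obtain \<psi> where \<psi>: "global_param ?n c \<psi>" and S: "\<And>y. y \<in> ?E \<Longrightarrow> F (\<psi> y) \<in> topspace (Euclidean_space m)"
    and sm: "\<And>i. i < m \<Longrightarrow> smooth_on ?n ?E (\<lambda>y. F (\<psi> y) i)"
    using assms(2)[OF c] by blast
  have U: "{y \<in> ?E. F (\<psi> y) \<in> fst d} = ?E" using d S by auto
  have "smooth_on ?n ?E (\<lambda>y. snd d (F (chart_inv c y)) j)"
    by (rule smooth_on_cong[OF _ _ sm[of j]]) (use d j in \<open>simp_all add: global_param_inv[OF \<psi>]\<close>)
  then show "smooth_on ?n (snd c ` (fst c \<inter> F -` fst d)) (\<lambda>y. snd d (F (chart_inv c y)) j)"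
    using U by (simp add: global_param_image_Int[OF \<psi>])
qed

lemma continuous_on_qmul:
  assumes "continuous_on A f" "continuous_on A g"
  shows "continuous_on A (\<lambda>x. qmul (f x) (g x))"
proof (rule continuous_on_coordinatewise_then_product)
  note [continuous_intros] = assms[THEN continuous_on_product_then_coordinatewise]
  fix i
  show "continuous_on A (\<lambda>x. qmul (f x) (g x) i)"
    by (cases "i < 4") (auto simp: less_4_cases qmul_def intro!: continuous_intros)
qed

lemma continuous_on_qcnj:
  assumes "continuous_on A f"
  shows "continuous_on A (\<lambda>x. qcnj (f x))"
proof (rule continuous_on_coordinatewise_then_product)
  note [continuous_intros] = assms[THEN continuous_on_product_then_coordinatewise]
  fix i
  show "continuous_on A (\<lambda>x. qcnj (f x) i)"
    by (cases "i < 4") (auto simp: less_4_cases qcnj_def intro!: continuous_intros)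
qed

lemma smooth_on_qmul:
  assumes U: "openin (Euclidean_space n) U"
    and "\<And>i. i < 4 \<Longrightarrow> smooth_on n U (\<lambda>x. f x i)" "\<And>i. i < 4 \<Longrightarrow> smooth_on n U (\<lambda>x. g x i)"
  shows "smooth_on n U (\<lambda>x. qmul (f x) (g x) i)"
proof (cases "i < 4")
  case True
  note intros = smooth_on_mult[OF U] smooth_on_add[OF U] smooth_on_diff[OF U] assms(2,3)
  show ?thesis using True by (auto simp: less_4_cases qmul_def intro!: intros)
qed (simp add: qmul_def smooth_on_const[OF U])

lemma smooth_on_qcnj:
  assumes U: "openin (Euclidean_space n) U" and "\<And>i. i < 4 \<Longrightarrow> smooth_on n U (\<lambda>x. f x i)"
  shows "smooth_on n U (\<lambda>x. qcnj (f x) i)"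
proof (cases "i < 4")
  case True
  show ?thesis using True by (auto simp: less_4_cases qcnj_def intro!: smooth_on_minus[OF U] assms(2))
qed (simp add: qcnj_def smooth_on_const[OF U])

lemma stereo_inv_unit_quats:
  "s * s = 1 \<Longrightarrow> y \<in> topspace (Euclidean_space 3) \<Longrightarrow> stereo_inv s y \<in> unit_quats"
  using global_param_stereo[of s] by (simp add: global_param_def fst_stereo)

lemma is_chart_stereo:
  assumes s: "s * s = 1"
  shows "is_chart (nsphere 3) 3 (stereo s)"
proof -
  let ?E = "topspace (Euclidean_space 3)"
  note P = global_param_stereo[OF s]
  have c0: "continuous_on A (\<lambda>x::nat \<Rightarrow> real. x i)" for A i
    by (rule continuous_on_subset[OF continuous_on_product_coordinates]) simp
  have dom: "fst (stereo s) = unit_quats \<inter> (\<lambda>x. 1 + s * x 0) -` (- {0})"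
    by (auto simp: fst_stereo)
  have "openin (top_of_set unit_quats) (unit_quats \<inter> (\<lambda>x. 1 + s * x 0) -` (- {0}))"
    by (rule continuous_openin_preimage_gen) (auto intro!: continuous_intros c0)
  then have 1: "openin (nsphere 3) (fst (stereo s))" by (simp add: dom nsphere_3)
  have sub: "fst (stereo s) \<subseteq> unit_quats" by (auto simp: fst_stereo)
  have c1: "continuous_on (fst (stereo s)) (snd (stereo s))"
  proof (rule continuous_on_coordinatewise_then_product)
    fix i
    show "continuous_on (fst (stereo s)) (\<lambda>x. snd (stereo s) x i)"
      unfolding snd_stereo by (cases "i < 3") (auto intro!: continuous_intros c0 simp: fst_stereo)
  qed
  have c2: "continuous_on ?E (stereo_inv s)"
    by (rule continuous_on_coordinatewise_then_product)
       (rule smooth_on_imp_continuous_on[OF openin_topspace_Euclidean_space smooth_on_stereo_inv])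
  have "homeomorphic_maps (top_of_set (fst (stereo s))) (top_of_set ?E) (snd (stereo s)) (stereo_inv s)"
    using P c1 c2 by (auto simp: homeomorphic_maps_def global_param_def)
  then have "homeomorphic_map (top_of_set (fst (stereo s))) (top_of_set ?E) (snd (stereo s))"
    using homeomorphic_maps_map by blast
  moreover have "subtopology (nsphere 3) (fst (stereo s)) = top_of_set (fst (stereo s))"
    using sub by (simp add: nsphere_3 subtopology_subtopology Int_absorb1)
  moreover have "subtopology (Euclidean_space 3) ?E = top_of_set ?E"
    by (metis Euclidean_space_eq_top_of_set subtopology_topspace)
  ultimately show ?thesis
    using 1 by (simp add: is_chart_def global_param_image[OF P])
qed

lemma smooth_manifold_sphere_manifold: "smooth_manifold sphere_manifold"
  unfolding smooth_manifold_def
proof (intro conjI ballI)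
  show "Hausdorff_space (mtop sphere_manifold)" "second_countable_space (mtop sphere_manifold)"
    by (simp_all add: nsphere_3 Hausdorff_space_subtopology second_countable_top_of_set)
  show "(\<Union>c\<in>atlas sphere_manifold. fst c) = points sphere_manifold"
    by (auto simp: topspace_nsphere_3 fst_stereo)
  fix c assume c: "c \<in> atlas sphere_manifold"
  then obtain s where s: "s * s = 1" "c = stereo s" by (rule atlas_sphere_manifoldE)
  show "is_chart (mtop sphere_manifold) (mdim sphere_manifold) c"
    using s is_chart_stereo by simp
  \<comment> \<open>For the identity map, the chart condition in \<open>smooth_map\<close> is
    exactly the smoothness of the transition functions.\<close>
  have "smooth_map sphere_manifold sphere_manifold (\<lambda>x. x)"
  proof (rule smooth_map_sphere_manifoldI)
    fix c assume "c \<in> atlas sphere_manifold"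
    then obtain s where s: "s * s = 1" "c = stereo s" by (rule atlas_sphere_manifoldE)
    show "\<exists>\<psi>. global_param (mdim sphere_manifold) c \<psi> \<and>
       (\<forall>y\<in>topspace (Euclidean_space (mdim sphere_manifold)). \<psi> y \<in> unit_quats) \<and>
       (\<forall>i<4. smooth_on (mdim sphere_manifold) (topspace (Euclidean_space (mdim sphere_manifold))) (\<lambda>y. \<psi> y i))"
      by (rule exI[of _ "stereo_inv s"])
         (simp add: s global_param_stereo stereo_inv_unit_quats smooth_on_stereo_inv)
  qed simp
  then show "smooth_transition (mdim sphere_manifold) c d" if "d \<in> atlas sphere_manifold" for d
    using c that unfolding smooth_map_def smooth_transition_def vimage_ident by blast
qed

text \<open>In ambient coordinates the product is bilinear and the inverse is conjugation, hence
  linear, so only the smoothness of the inverse projections enters.\<close>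

lemma lie_group_sphere: "lie_group sphere_group sphere_manifold"
proof -
  have top: "mtop (prod_manifold sphere_manifold sphere_manifold) = top_of_set (unit_quats \<times> unit_quats)"
    by (simp add: prod_manifold_def nsphere_3)
  have mult: "smooth_map (prod_manifold sphere_manifold sphere_manifold) sphere_manifold (\<lambda>(x, y). qmul x y)"
  proof (rule smooth_map_sphere_manifoldI)
    have "continuous_on (unit_quats \<times> unit_quats) (\<lambda>z. qmul (fst z) (snd z))"
      by (intro continuous_on_qmul continuous_intros)
    then show "continuous_map (mtop (prod_manifold sphere_manifold sphere_manifold)) (nsphere 3) (\<lambda>(x, y). qmul x y)"
      unfolding top nsphere_3 by (auto simp: case_prod_unfold unit_quats_qmul)
    fix c assume "c \<in> atlas (prod_manifold sphere_manifold sphere_manifold)"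
    then obtain d e where c: "c = prod_chart 3 d e" "d \<in> atlas sphere_manifold" "e \<in> atlas sphere_manifold"
      by (auto simp: prod_manifold_def)
    obtain s t where st: "s * s = 1" "d = stereo s" "t * t = 1" "e = stereo t"
      using c by (metis atlas_sphere_manifoldE)
    let ?\<psi> = "\<lambda>z. (stereo_inv s (low_coords 3 z), stereo_inv t (high_coords 3 z))"
    have d: "mdim (prod_manifold sphere_manifold sphere_manifold) = 3 + 3" by (simp add: prod_manifold_def)
    show "\<exists>\<psi>. global_param (mdim (prod_manifold sphere_manifold sphere_manifold)) c \<psi> \<and>
       (\<forall>y\<in>topspace (Euclidean_space (mdim (prod_manifold sphere_manifold sphere_manifold))).
          (case \<psi> y of (x, y) \<Rightarrow> qmul x y) \<in> unit_quats) \<and>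
       (\<forall>i<4. smooth_on (mdim (prod_manifold sphere_manifold sphere_manifold))
          (topspace (Euclidean_space (mdim (prod_manifold sphere_manifold sphere_manifold))))
          (\<lambda>y. (case \<psi> y of (x, y) \<Rightarrow> qmul x y) i))"
      unfolding d
    proof (intro exI[of _ ?\<psi>] conjI ballI allI impI)
      show "global_param (3 + 3) c ?\<psi>"
        unfolding c st by (intro global_param_prod_chart global_param_stereo st)
      show "(case ?\<psi> y of (x, y) \<Rightarrow> qmul x y) \<in> unit_quats" if "y \<in> topspace (Euclidean_space (3 + 3))" for y
        using low_coords_in high_coords_in[OF that] by (simp add: unit_quats_qmul stereo_inv_unit_quats st)
      show "smooth_on (3 + 3) (topspace (Euclidean_space (3 + 3))) (\<lambda>y. (case ?\<psi> y of (x, y) \<Rightarrow> qmul x y) i)" for i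
        unfolding prod.case
        by (intro smooth_on_qmul smooth_on_low_coords smooth_on_high_coords smooth_on_stereo_inv
              openin_topspace_Euclidean_space)
    qed
  qed
  have inv: "smooth_map sphere_manifold sphere_manifold (\<lambda>x. inv\<^bsub>sphere_group\<^esub> x)"
  proof (rule smooth_map_sphere_manifoldI)
    have "continuous_on unit_quats (\<lambda>x. inv\<^bsub>sphere_group\<^esub> x)"
      by (subst continuous_on_cong[OF refl inv_sphere_group]) (auto intro!: continuous_on_qcnj[OF continuous_on_id])
    then show "continuous_map (mtop sphere_manifold) (nsphere 3) (\<lambda>x. inv\<^bsub>sphere_group\<^esub> x)"
      by (auto simp: nsphere_3 inv_sphere_group unit_quats_qcnj)
    fix c assume "c \<in> atlas sphere_manifold"
    then obtain s where s: "s * s = 1" "c = stereo s" by (rule atlas_sphere_manifoldE)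
    have sm: "smooth_on 3 (topspace (Euclidean_space 3)) (\<lambda>y. (inv\<^bsub>sphere_group\<^esub> (stereo_inv s y)) i)" for i
      by (rule smooth_on_cong[OF _ _ smooth_on_qcnj[OF _ smooth_on_stereo_inv, where i = i]])
         (simp_all add: inv_sphere_group stereo_inv_unit_quats[OF s(1)])
    show "\<exists>\<psi>. global_param (mdim sphere_manifold) c \<psi> \<and>
       (\<forall>y\<in>topspace (Euclidean_space (mdim sphere_manifold)). inv\<^bsub>sphere_group\<^esub> (\<psi> y) \<in> unit_quats) \<and>
       (\<forall>i<4. smooth_on (mdim sphere_manifold) (topspace (Euclidean_space (mdim sphere_manifold)))
          (\<lambda>y. (inv\<^bsub>sphere_group\<^esub> (\<psi> y)) i))"
      by (rule exI[of _ "stereo_inv s"])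
         (simp add: s global_param_stereo stereo_inv_unit_quats inv_sphere_group unit_quats_qcnj sm)
  qed
  show ?thesis
    using group_sphere_group smooth_manifold_sphere_manifold mult inv
    by (simp add: lie_group_def topspace_nsphere_3)
qed

subsection \<open>The Lie algebra\<close>

lemma pd_linear_combination:
  assumes "openin (Euclidean_space n) U" "\<And>k. k \<in> A \<Longrightarrow> smooth_on n U (f k)" "i < n" "x \<in> U"
  shows "pd i (\<lambda>x. \<Sum>k\<in>A. c k * f k x) x = (\<Sum>k\<in>A. c k * pd i (f k) x)"
  by (rule pd_eqI, rule DERIV_sum, rule DERIV_cmult, rule smooth_on_DERIV[OF assms(1) assms(2) assms(3,4)])

lemma smooth_funs_sphere_manifold:
  "f \<in> smooth_funs sphere_manifold \<longleftrightarrow>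
     (\<forall>s. s * s = 1 \<longrightarrow> smooth_on 3 (topspace (Euclidean_space 3)) (\<lambda>y. f (stereo_inv s y)))"
proof -
  have *: "smooth_on 3 (snd (stereo s) ` fst (stereo s)) (\<lambda>y. f (chart_inv (stereo s) y)) \<longleftrightarrow>
      smooth_on 3 (topspace (Euclidean_space 3)) (\<lambda>y. f (stereo_inv s y))" if "s * s = 1" for s
  proof -
    note P = global_param_stereo[OF that]
    have eq: "f (chart_inv (stereo s) y) = f (stereo_inv s y)" if "y \<in> topspace (Euclidean_space 3)" for y
      by (simp add: global_param_inv[OF P that])
    show ?thesis
      unfolding global_param_image[OF P]
      by (rule iffI; rule smooth_on_cong[OF openin_topspace_Euclidean_space]; (assumption | simp add: eq))
  qed
  have "s * s = 1 \<longleftrightarrow> s = 1 \<or> s = - 1" for s :: real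
    using square_eq_1_iff by blast
  then show ?thesis
    using *[of 1] *[of "- 1"] by (auto simp: smooth_funs_def)
qed

text \<open>The chart \<open>stereo 1\<close> alone describes the tangent space at the neutral
  element, since \<open>stereo (- 1)\<close> omits that point.\<close>

definition lie_vec :: "(nat \<Rightarrow> real) \<Rightarrow> (nat \<Rightarrow> real) tvec" where
  "lie_vec a = (\<lambda>f. if f \<in> smooth_funs sphere_manifold
     then \<Sum>i<3. a i * pd i (\<lambda>y. f (stereo_inv 1 y)) (\<lambda>_. 0) else 0)"

lemma zero_in_Euclidean_space [simp]: "(\<lambda>_. 0) \<in> topspace (Euclidean_space n)"
  by (simp add: topspace_Euclidean_space)

lemma stereo_qone: "snd (stereo 1) qone = (\<lambda>_. 0)"
  by (auto simp: snd_stereo qone_def fun_eq_iff less_3_cases Suc_2_eq_3)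

lemma lie_algebra_sphere: "lie_algebra sphere_group sphere_manifold = range lie_vec"
proof -
  note P = global_param_stereo[of 1, simplified]
  have 1: "coord_vec sphere_manifold (stereo 1) qone i f =
      (if f \<in> smooth_funs sphere_manifold then pd i (\<lambda>y. f (stereo_inv 1 y)) (\<lambda>_. 0) else 0)" if "i < 3" for i f
    using pd_cong(2)[OF openin_topspace_Euclidean_space[of 3] _ that, of "\<lambda>_. 0"
        "\<lambda>y. f (chart_inv (stereo 1) y)" "\<lambda>y. f (stereo_inv 1 y)"]
    by (simp add: coord_vec_def stereo_qone global_param_inv[OF P])
  have 2: "qone \<in> fst c \<longleftrightarrow> c = stereo 1" if "c \<in> atlas sphere_manifold" for c
  proof -
    have "qone \<in> fst (stereo 1)" "qone \<notin> fst (stereo (- 1))"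
      by (simp_all add: fst_stereo unit_quats_qone) (simp_all add: qone_def)
    then show ?thesis using that by auto
  qed
  have 3: "(\<lambda>f. \<Sum>i<3. a i * coord_vec sphere_manifold (stereo 1) qone i f) = lie_vec a" for a
    by (auto simp: fun_eq_iff 1 lie_vec_def)
  have "stereo 1 \<in> atlas sphere_manifold" by simp
  then have "lie_algebra sphere_group sphere_manifold =
      {v. \<exists>a. v = (\<lambda>f. \<Sum>i<3. a i * coord_vec sphere_manifold (stereo 1) qone i f)}"
    unfolding lie_algebra_def tangent_space_def sphere_group_simps sphere_manifold_simps(2)
    using 2 by blast
  then show ?thesis unfolding 3 by auto
qed

lemma lie_vec_linear:
  "(\<lambda>f. x * lie_vec a f + y * lie_vec b f) = lie_vec (\<lambda>i. x * a i + y * b i)"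
  by (auto simp: lie_vec_def fun_eq_iff sum.distrib sum_distrib_left algebra_simps)

lemma coordinate_in_smooth_funs_sphere: "(\<lambda>x. x j) \<in> smooth_funs sphere_manifold"
  by (simp add: smooth_funs_sphere_manifold smooth_on_stereo_inv)

lemma lie_vec_linear_combination:
  fixes n :: nat
  assumes "\<And>k. k < n \<Longrightarrow> f k \<in> smooth_funs sphere_manifold"
  shows "lie_vec a (\<lambda>x. \<Sum>k<n. c k * f k x) = (\<Sum>k<n. c k * lie_vec a (f k))"
proof -
  have sm: "smooth_on 3 (topspace (Euclidean_space 3)) (\<lambda>y. f k (stereo_inv s y))" if "k < n" "s * s = 1" for k s
    using assms[OF that(1)] that(2) by (simp add: smooth_funs_sphere_manifold)
  have 1: "(\<lambda>x. \<Sum>k<n. c k * f k x) \<in> smooth_funs sphere_manifold"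
    unfolding smooth_funs_sphere_manifold
    by (auto intro!: smooth_on_sum smooth_on_mult smooth_on_const sm)
  have "pd i (\<lambda>y. \<Sum>k<n. c k * f k (stereo_inv 1 y)) (\<lambda>_. 0) =
      (\<Sum>k<n. c k * pd i (\<lambda>y. f k (stereo_inv 1 y)) (\<lambda>_. 0))" if "i < 3" for i
    by (rule pd_linear_combination[OF openin_topspace_Euclidean_space]) (use sm that in auto)
  then have "lie_vec a (\<lambda>x. \<Sum>k<n. c k * f k x) =
      (\<Sum>i<3. \<Sum>k<n. c k * (a i * pd i (\<lambda>y. f k (stereo_inv 1 y)) (\<lambda>_. 0)))"
    using 1 by (simp add: lie_vec_def sum_distrib_left mult_ac)
  also have "\<dots> = (\<Sum>k<n. c k * lie_vec a (f k))"
    by (subst sum.swap) (simp add: lie_vec_def assms sum_distrib_left)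
  finally show ?thesis .
qed

text \<open>The imaginary quaternion that \<open>lie_vec a\<close> becomes as a vector in the
  ambient space. The factor 2 is the differential of \<open>stereo_inv 1\<close> at the
  origin.\<close>

definition lie_quat :: "(nat \<Rightarrow> real) \<Rightarrow> nat \<Rightarrow> real" where
  "lie_quat a = quat 0 (2 * a 0) (2 * a (Suc 0)) (2 * a 2)"

lemma pd_stereo_inv:
  assumes "i < 3" "j < 4"
  shows "pd i (\<lambda>y. stereo_inv 1 y j) (\<lambda>_. 0) = (if j = Suc i then 2 else 0)"
proof (rule pd_eqI)
  have 1: "((\<lambda>t::real. (1 - t * t) / (1 + t * t)) has_real_derivative 0) (at 0)"
    by (rule derivative_eq_intros refl | simp)+
  have 2: "((\<lambda>t::real. 2 * t / (1 + t * t)) has_real_derivative 2) (at 0)"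
    by (rule derivative_eq_intros refl | simp)+
  show "((\<lambda>t. stereo_inv 1 ((\<lambda>_. 0)(i := t)) j) has_real_derivative (if j = Suc i then 2 else 0)) (at ((\<lambda>_. 0) i))"
  proof -
    \<comment> \<open>Along a coordinate axis only the real part and coordinate \<open>Suc i\<close>
      survive; the real part is even in \<open>t\<close>, so it has derivative 0 at the
      origin.\<close>
    have eq: "stereo_inv 1 ((\<lambda>_. 0)(i := t)) j =
        (if j = 0 then (1 - t * t) / (1 + t * t) else if j = Suc i then 2 * t / (1 + t * t) else 0)" for t
      using assms unfolding less_3_cases less_4_cases stereo_inv_def Let_def
      by (elim disjE) (simp_all add: Suc_2_eq_3)
    show ?thesis unfolding eq using 1 2 by (cases "j = 0"; cases "j = Suc i") simp_all
  qed
qed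

lemma lie_vec_coordinate: "lie_vec a (\<lambda>x. x j) = lie_quat a j"
proof (cases "j < 4")
  case True
  have "lie_vec a (\<lambda>x. x j) = (\<Sum>i<3. a i * (if j = Suc i then 2 else 0))"
    by (simp add: lie_vec_def coordinate_in_smooth_funs_sphere pd_stereo_inv True)
  then show ?thesis using True by (auto simp: less_4_cases sum_below_3 lie_quat_def Suc_2_eq_3)
next
  case False
  have "pd i (\<lambda>y. stereo_inv 1 y j) (\<lambda>_. 0) = 0" for i
    by (rule pd_eqI) (use False in \<open>simp add: stereo_inv_def Let_def\<close>)
  then show ?thesis using False by (simp add: lie_vec_def lie_quat_def)
qed

text \<open>Linearity in matrix form: each coordinate of \<open>L x\<close> is a finite combination
  of coordinate functions, on which tangent vectors are already evaluated. In particular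
  \<open>L x\<close> depends on the first four coordinates of \<open>x\<close> only.\<close>

definition quat_linear :: "((nat \<Rightarrow> real) \<Rightarrow> nat \<Rightarrow> real) \<Rightarrow> bool" where
  "quat_linear L \<longleftrightarrow> (\<forall>x j. L x j = (\<Sum>k<4. L (\<lambda>i. if i = k then 1 else 0) j * x k))"

lemma quat_linear_qmul: "quat_linear (\<lambda>x. qmul x p)" "quat_linear (qmul h)"
proof -
  have "qmul x p j = (\<Sum>k<4. qmul (\<lambda>i. if i = k then 1 else 0) p j * x k)"
    "qmul h x j = (\<Sum>k<4. qmul h (\<lambda>i. if i = k then 1 else 0) j * x k)" for x j
    by (cases "j < 4"; auto simp: less_4_cases sum_below_4 qmul_def)+
  then show "quat_linear (\<lambda>x. qmul x p)" "quat_linear (qmul h)"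
    unfolding quat_linear_def by blast+
qed

lemma quat_linear_conj: "quat_linear (\<lambda>x. qmul (qmul h x) k)"
proof -
  have "qmul (qmul h x) k j = (\<Sum>l<4. qmul (qmul h (\<lambda>i. if i = l then 1 else 0)) k j * x l)" for x j
    by (cases "j < 4"; auto simp: less_4_cases sum_below_4 qmul_def algebra_simps)
  then show ?thesis unfolding quat_linear_def by blast
qed

text \<open>A linear map is its own differential. With right multiplication by a point this computes
  the fundamental field, with conjugation the adjoint action.\<close>

lemma lie_vec_quat_linear:
  assumes "quat_linear L"
  shows "lie_vec a (\<lambda>x. L x j) = L (lie_quat a) j"
proof -
  have L: "L x j = (\<Sum>k<4. L (\<lambda>i. if i = k then 1 else 0) j * x k)" for x
    using assms unfolding quat_linear_def by blast
  show ?thesis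
    unfolding L[of "lie_quat a"]
    by (subst L) (simp only: lie_vec_linear_combination coordinate_in_smooth_funs_sphere lie_vec_coordinate)
qed

lemma flat_vec_quat_linear:
  assumes "quat_linear L" "p \<in> topspace (Euclidean_space 4)"
  shows "flat_vec 4 p a (\<lambda>x. L x j) = L a j"
proof -
  have L: "L x j = (\<Sum>k<4. L (\<lambda>i. if i = k then 1 else 0) j * x k)" for x
    using assms(1) unfolding quat_linear_def by blast
  let ?c = "\<lambda>k. L (\<lambda>i. if i = k then 1 else 0) j"
  have 1: "smooth_on 4 (topspace (Euclidean_space 4)) (\<lambda>x. \<Sum>k<4. ?c k * x k)"
    by (auto intro!: smooth_on_sum smooth_on_mult smooth_on_const smooth_on_coordinate)
  have 2: "pd i (\<lambda>x. \<Sum>k<4. ?c k * x k) p = ?c i" if "i < 4" for i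
  proof -
    have "pd i (\<lambda>x. x k) p = (if k = i then 1 else 0)" for k
      by (rule pd_eqI) (auto intro!: derivative_eq_intros)
    then have "pd i (\<lambda>x. \<Sum>k<4. ?c k * x k) p = (\<Sum>k<4. ?c k * (if k = i then 1 else 0))"
      using pd_linear_combination[OF openin_topspace_Euclidean_space, of "{..<4}" 4 "\<lambda>k x. x k" i p ?c]
        that assms(2) by (simp add: smooth_on_coordinate)
    also have "\<dots> = (\<Sum>k<4. if k = i then ?c k else 0)" by (rule sum.cong) auto
    also have "\<dots> = ?c i" using that by simp
    finally show ?thesis .
  qed
  have "flat_vec 4 p a (\<lambda>x. \<Sum>k<4. ?c k * x k) = (\<Sum>i<4. a i * ?c i)"
    unfolding flat_vec_def using 1 2 by simp
  also have "\<dots> = L a j" unfolding L[of a] by (simp add: mult.commute)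
  finally show ?thesis by (subst L)
qed

text \<open>Serves to replace \<open>quat_action\<close>, which agrees with \<open>qmul\<close> on
  the four-dimensional space only, under a tangent vector.\<close>

lemma flat_vec_fun_cong:
  assumes p: "p \<in> topspace (Euclidean_space n)"
    and eq: "\<And>x. x \<in> topspace (Euclidean_space n) \<Longrightarrow> f x = g x"
  shows "flat_vec n p a f = flat_vec n p a g"
proof -
  have "smooth_on n (topspace (Euclidean_space n)) f \<longleftrightarrow> smooth_on n (topspace (Euclidean_space n)) g"
    using smooth_on_cong[OF openin_topspace_Euclidean_space, of n f g]
      smooth_on_cong[OF openin_topspace_Euclidean_space, of n g f] eq by metis
  moreover have "pd i f p = pd i g p" if "i < n" for i
    by (rule pd_cong(2)[OF openin_topspace_Euclidean_space p that eq])
  ultimately show ?thesis by (simp add: flat_vec_def)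
qed

text \<open>Conjugation fixes the real part, hence maps the domain of each stereographic chart to itself.\<close>

lemma Ad_in_lie_algebra:
  assumes h: "h \<in> unit_quats" and X: "X \<in> lie_algebra sphere_group sphere_manifold"
  shows "Ad sphere_group sphere_manifold h X \<in> lie_algebra sphere_group sphere_manifold"
proof -
  let ?E = "topspace (Euclidean_space 3)"
  define C where "C = (\<lambda>x. qmul (qmul h x) (qcnj h))"
  obtain a where a: "X = lie_vec a" using X by (auto simp: lie_algebra_sphere)
  have Ad: "Ad sphere_group sphere_manifold h X =
      (\<lambda>f. if f \<in> smooth_funs sphere_manifold then lie_vec a (\<lambda>x. f (C x)) else 0)"
    unfolding C_def using h by (simp add: Ad_def pushforward_def inv_sphere_group a)
  have "C x 0 = qnorm2 h * x 0" for x
    by (simp add: C_def qmul_def qcnj_def qnorm2_def algebra_simps)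
  then have C0: "C x 0 = x 0" for x using h by (simp add: unit_quats_def)
  have C: "C x \<in> fst (stereo s)" if "x \<in> fst (stereo s)" for x s
    using that h by (simp add: fst_stereo C0) (simp add: C_def unit_quats_qmul unit_quats_qcnj)
  \<comment> \<open>Conjugation in the coordinates of chart \<open>s\<close>. Both signs are treated
    because \<open>lie_vec a\<close> returns 0 on \<open>f\<close> composed with \<open>C\<close>
    unless that function is smooth in both charts.\<close>
  define \<kappa> where "\<kappa> = (\<lambda>s y. snd (stereo s) (C (stereo_inv s y)))"
  have P: "stereo_inv s y \<in> fst (stereo s)" if "s * s = 1" "y \<in> ?E" for s y
    using global_param_stereo[OF that(1)] that(2) by (simp add: global_param_def)
  have \<kappa>: "\<kappa> s y \<in> ?E" "C (stereo_inv s y) = stereo_inv s (\<kappa> s y)" if "s * s = 1" "y \<in> ?E" for s y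
    using global_param_stereo[OF that(1)] C[OF P[OF that]] by (simp_all add: global_param_def \<kappa>_def)
  have sm\<kappa>: "smooth_on 3 ?E (\<lambda>y. \<kappa> s y j)" if "s * s = 1" for s j
    unfolding \<kappa>_def
    by (rule smooth_on_stereo_compose[OF openin_topspace_Euclidean_space])
       (auto simp: C_def intro!: C[unfolded C_def] P that smooth_on_qmul smooth_on_stereo_inv smooth_on_const)
  have smC: "smooth_on 3 ?E (\<lambda>y. f (C (stereo_inv s y)))"
    if f: "f \<in> smooth_funs sphere_manifold" and s: "s * s = 1" for f s
  proof -
    have "smooth_on 3 ?E (\<lambda>y. f (stereo_inv s (\<kappa> s y)))"
      by (rule smooth_on_compose[OF _ openin_topspace_Euclidean_space \<kappa>(1)[OF s] sm\<kappa>[OF s], where f = "\<lambda>y. f (stereo_inv s y)"])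
         (use f s in \<open>simp_all add: smooth_funs_sphere_manifold\<close>)
    then show ?thesis
      by (rule smooth_on_cong[OF openin_topspace_Euclidean_space, rotated]) (simp add: \<kappa>(2)[OF s])
  qed
  \<comment> \<open>The image of \<open>a\<close> under the Jacobian of \<open>\<kappa> 1\<close> at
    the origin; conjugation fixes the neutral element, so the base point does not move.\<close>
  define b where "b = (\<lambda>j. \<Sum>i<3. a i * pd i (\<lambda>y. \<kappa> 1 y j) (\<lambda>_. 0))"
  have "lie_vec a (\<lambda>x. f (C x)) = lie_vec b f" if f: "f \<in> smooth_funs sphere_manifold" for f
  proof -
    have fC: "(\<lambda>x. f (C x)) \<in> smooth_funs sphere_manifold"
      using smC[OF f] by (simp add: smooth_funs_sphere_manifold)
    have f1: "smooth_on 3 ?E (\<lambda>y. f (stereo_inv 1 y))"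
      using f by (simp add: smooth_funs_sphere_manifold)
    have "stereo_inv 1 (\<lambda>_. 0) = qone" by (simp add: stereo_inv_def qone_def)
    moreover have "C qone = qone"
      using h by (simp add: C_def qmul_qcnj unit_quats_def) (simp add: qone_def)
    ultimately have \<kappa>0: "\<kappa> 1 (\<lambda>_. 0) = (\<lambda>_. 0)" by (simp add: \<kappa>_def stereo_qone)
    have "pd i (\<lambda>y. f (C (stereo_inv 1 y))) (\<lambda>_. 0) =
        (\<Sum>j<3. pd j (\<lambda>y. f (stereo_inv 1 y)) (\<lambda>_. 0) * pd i (\<lambda>y. \<kappa> 1 y j) (\<lambda>_. 0))" if i: "i < 3" for i
    proof -
      have "pd i (\<lambda>y. f (C (stereo_inv 1 y))) (\<lambda>_. 0) = pd i (\<lambda>y. f (stereo_inv 1 (\<kappa> 1 y))) (\<lambda>_. 0)"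
        by (rule pd_cong(2)[OF openin_topspace_Euclidean_space _ i]) (simp_all add: \<kappa>(2))
      also have "\<dots> = (\<Sum>j<3. pd j (\<lambda>y. f (stereo_inv 1 y)) (\<kappa> 1 (\<lambda>_. 0)) * pd i (\<lambda>y. \<kappa> 1 y j) (\<lambda>_. 0))"
        by (rule smooth_on_pd_compose[OF openin_topspace_Euclidean_space openin_topspace_Euclidean_space
              \<kappa>(1) sm\<kappa> f1 i]) simp_all
      finally show ?thesis unfolding \<kappa>0 .
    qed
    then have "lie_vec a (\<lambda>x. f (C x)) =
        (\<Sum>i<3. \<Sum>j<3. a i * (pd j (\<lambda>y. f (stereo_inv 1 y)) (\<lambda>_. 0) * pd i (\<lambda>y. \<kappa> 1 y j) (\<lambda>_. 0)))"
      using fC by (simp add: lie_vec_def sum_distrib_left)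
    also have "\<dots> = lie_vec b f"
      by (subst sum.swap) (simp add: lie_vec_def f b_def sum_distrib_left sum_distrib_right mult_ac)
    finally show ?thesis .
  qed
  then have "Ad sphere_group sphere_manifold h X = lie_vec b"
    unfolding Ad by (auto simp: fun_eq_iff) (simp add: lie_vec_def)
  then show ?thesis by (simp add: lie_algebra_sphere)
qed

lemma Ad_coordinate:
  assumes "h \<in> unit_quats"
  shows "Ad sphere_group sphere_manifold h (lie_vec a) (\<lambda>x. x j) = qmul (qmul h (lie_quat a)) (qcnj h) j"
  using assms lie_vec_quat_linear[OF quat_linear_conj, of a h "qcnj h" j]
  by (simp add: Ad_def pushforward_def coordinate_in_smooth_funs_sphere inv_sphere_group)

section \<open>The action on the quaternions\<close>

text \<open>The members of \<open>BijGroup\<close> are extensional, hence the restriction of left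
  multiplication to the space.\<close>

definition quat_action :: "(nat \<Rightarrow> real) \<Rightarrow> (nat \<Rightarrow> real) \<Rightarrow> nat \<Rightarrow> real" where
  "quat_action h = restrict (qmul h) (topspace (Euclidean_space 4))"

lemma quat_action_eq [simp]: "p \<in> topspace (Euclidean_space 4) \<Longrightarrow> quat_action h p = qmul h p"
  by (simp add: quat_action_def)

lemma group_action_quat: "group_action sphere_group (topspace (Euclidean_space 4)) quat_action"
proof -
  let ?E = "topspace (Euclidean_space 4)"
  have cancel: "qmul (qcnj h) (qmul h x) = x" "qmul h (qmul (qcnj h) x) = x"
    if "h \<in> unit_quats" "x \<in> ?E" for h x
  proof -
    have "qmul (qcnj h) h = qone" "qmul h (qcnj h) = qone"
      using that(1) by (simp_all add: qmul_qcnj unit_quats_def) (simp_all add: qone_def)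
    then show "qmul (qcnj h) (qmul h x) = x" "qmul h (qmul (qcnj h) x) = x"
      using that(2) by (simp_all add: qmul_assoc[symmetric])
  qed
  have Bij: "quat_action h \<in> Bij ?E" if h: "h \<in> unit_quats" for h
  proof -
    have "bij_betw (quat_action h) ?E ?E"
      by (rule bij_betw_byWitness[where f' = "qmul (qcnj h)"]) (auto simp: cancel[OF h])
    then show ?thesis by (simp add: Bij_def quat_action_def)
  qed
  have "quat_action (qmul h k) = compose ?E (quat_action h) (quat_action k)" for h k
    by (auto simp: compose_def quat_action_def fun_eq_iff qmul_assoc)
  then have "quat_action \<in> hom sphere_group (BijGroup ?E)"
    by (auto simp: hom_def BijGroup_def Bij)
  then show ?thesis
    by (simp add: group_action_def group_hom_def group_hom_axioms_def group_sphere_group group_BijGroup)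
qed

lemma faithful_action_quat: "faithful_action sphere_group (topspace (Euclidean_space 4)) quat_action"
proof -
  have "inj_on quat_action unit_quats"
  proof (rule inj_onI)
    fix h k assume "h \<in> unit_quats" "k \<in> unit_quats" and eq: "quat_action h = quat_action k"
    then have "h \<in> topspace (Euclidean_space 4)" "k \<in> topspace (Euclidean_space 4)"
      by (simp_all add: unit_quats_def)
    moreover have "quat_action h qone = quat_action k qone" by (simp only: eq)
    ultimately show "h = k" by simp
  qed
  then show ?thesis
    by (simp add: faithful_action_def faithful_action_axioms_def group_action_quat)
qed

lemma smooth_action_quat: "smooth_action sphere_group sphere_manifold (flat_space 4) quat_action"
proof -
  let ?P = "prod_manifold sphere_manifold (flat_space 4)"
  have top: "mtop ?P = top_of_set (unit_quats \<times> topspace (Euclidean_space 4))"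
    by (simp add: prod_manifold_def nsphere_3)
       (metis Euclidean_space_eq_top_of_set prod_topology_subtopology_eu)
  have d: "mdim ?P = 3 + 4" by (simp add: prod_manifold_def)
  have "smooth_map ?P (flat_space 4) (\<lambda>(h, p). quat_action h p)"
  proof (rule smooth_map_flat_spaceI)
    have "continuous_on (unit_quats \<times> topspace (Euclidean_space 4)) (\<lambda>z. qmul (fst z) (snd z))"
      by (intro continuous_on_qmul continuous_on_fst continuous_on_snd continuous_on_id)
    then have "continuous_on (unit_quats \<times> topspace (Euclidean_space 4)) (\<lambda>(h, p). quat_action h p)"
      by (rule continuous_on_eq) auto
    then show "continuous_map (mtop ?P) (Euclidean_space 4) (\<lambda>(h, p). quat_action h p)"
      unfolding top by (subst Euclidean_space_eq_top_of_set) (auto simp: continuous_map_in_subtopology)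
    fix c assume "c \<in> atlas ?P"
    then have "\<exists>d. c = prod_chart 3 d (perm_chart 4 id) \<and> d \<in> atlas sphere_manifold"
      by (simp add: prod_manifold_def del: split_paired_Ex)
    then obtain d where c: "c = prod_chart 3 d (perm_chart 4 id)" "d \<in> atlas sphere_manifold"
      by blast
    obtain s where s: "s * s = 1" "d = stereo s"
      using c(2) by (rule atlas_sphere_manifoldE)
    let ?\<psi> = "\<lambda>z. (stereo_inv s (low_coords 3 z), high_coords 3 z \<circ> id)"
    show "\<exists>\<psi>. global_param (mdim ?P) c \<psi> \<and>
       (\<forall>y\<in>topspace (Euclidean_space (mdim ?P)).
          (case \<psi> y of (h, p) \<Rightarrow> quat_action h p) \<in> topspace (Euclidean_space 4)) \<and>
       (\<forall>i<4. smooth_on (mdim ?P) (topspace (Euclidean_space (mdim ?P)))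
          (\<lambda>y. (case \<psi> y of (h, p) \<Rightarrow> quat_action h p) i))"
      unfolding d
    proof (intro exI[of _ ?\<psi>] conjI ballI allI impI)
      show "global_param (3 + 4) c ?\<psi>"
        unfolding c s by (intro global_param_prod_chart global_param_stereo s global_param_perm_chart) simp
      have eq: "(case ?\<psi> y of (h, p) \<Rightarrow> quat_action h p) = qmul (stereo_inv s (low_coords 3 y)) (high_coords 3 y)"
        if "y \<in> topspace (Euclidean_space (3 + 4))" for y
        using high_coords_in[OF that] by simp
      show "(case ?\<psi> y of (h, p) \<Rightarrow> quat_action h p) \<in> topspace (Euclidean_space 4)"
        if "y \<in> topspace (Euclidean_space (3 + 4))" for y
        unfolding eq[OF that] by simp
      fix i
      have "smooth_on (3 + 4) (topspace (Euclidean_space (3 + 4)))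
          (\<lambda>y. qmul (stereo_inv s (low_coords 3 y)) (high_coords 3 y) i)"
        by (intro smooth_on_qmul smooth_on_low_coords smooth_on_stereo_inv openin_topspace_Euclidean_space)
           (simp add: high_coords_def smooth_on_coordinate)
      then show "smooth_on (3 + 4) (topspace (Euclidean_space (3 + 4)))
          (\<lambda>y. (case ?\<psi> y of (h, p) \<Rightarrow> quat_action h p) i)"
        by (rule smooth_on_cong[OF openin_topspace_Euclidean_space, rotated]) (simp only: eq)
    qed
  qed
  then show ?thesis
    by (simp add: smooth_action_def group_action_quat)
qed

subsection \<open>The complex structures and their Kaehler forms\<close>

text \<open>\<open>std_complex \<pi>\<close> is right multiplication by \<open>j\<close>, \<open>i\<close>, \<open>k\<close> when \<open>\<pi>\<close> exchanges
  the coordinates 1 and 2, 2 and 3, 1 and 3 respectively.\<close>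

definition exchange :: "nat \<Rightarrow> nat \<Rightarrow> nat \<Rightarrow> nat" where
  "exchange a b = id(a := b, b := a)"

definition exchanges :: "(nat \<Rightarrow> nat) set" where
  "exchanges = {exchange 1 2, exchange 2 3, exchange 1 3}"

lemma involution_exchanges: "\<pi> \<in> exchanges \<Longrightarrow> involution_below 4 \<pi>"
  by (auto simp: exchanges_def involution_below_def exchange_def)

lemma std_complex_exchange:
  "std_complex (exchange 1 2) a 0 = - a 2" "std_complex (exchange 1 2) a (Suc 0) = - a 3"
  "std_complex (exchange 1 2) a 2 = a 0" "std_complex (exchange 1 2) a 3 = a (Suc 0)"
  "std_complex (exchange 2 3) a 0 = - a (Suc 0)" "std_complex (exchange 2 3) a (Suc 0) = a 0"
  "std_complex (exchange 2 3) a 2 = a 3" "std_complex (exchange 2 3) a 3 = - a 2"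
  "std_complex (exchange 1 3) a 0 = - a 3" "std_complex (exchange 1 3) a (Suc 0) = a 2"
  "std_complex (exchange 1 3) a 2 = - a (Suc 0)" "std_complex (exchange 1 3) a 3 = a 0"
  by (simp_all add: std_complex_def parity_swap_def exchange_def)

definition quat_complex :: "(nat \<Rightarrow> nat) \<Rightarrow> (nat \<Rightarrow> real) endo" where
  "quat_complex \<pi> = flat_endo 4 (std_complex \<pi>)"

lemma quat_complex_flat_vec:
  "\<pi> \<in> exchanges \<Longrightarrow> quat_complex \<pi> q (flat_vec 4 p a) = flat_vec 4 q (std_complex \<pi> a)"
  unfolding quat_complex_def
  using flat_endo_std_complex[of 2 \<pi> q p a] involution_exchanges[of \<pi>] by simp

text \<open>Right multiplications compose in reverse order. Taking right multiplication by j for I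
  and by i for J gives I (J v) = v i j = v k = K v.\<close>

lemma hyperkahler_quat:
  "hyperkahler (flat_space 4) (flat_metric 4)
     (quat_complex (exchange 1 2)) (quat_complex (exchange 2 3)) (quat_complex (exchange 1 3))"
proof -
  have mem: "exchange 1 2 \<in> exchanges" "exchange 2 3 \<in> exchanges" "exchange 1 3 \<in> exchanges"
    by (simp_all add: exchanges_def)
  have K: "kahler (flat_space 4) (flat_metric 4) (quat_complex \<pi>)" if "\<pi> \<in> exchanges" for \<pi>
    using kahler_flat_space[of 2 \<pi>] involution_exchanges[OF that] by (simp add: quat_complex_def)
  have "quat_complex (exchange 1 2) p (quat_complex (exchange 2 3) p v) = quat_complex (exchange 1 3) p v \<and>
      quat_complex (exchange 2 3) p (quat_complex (exchange 1 2) p v) = (\<lambda>f. - quat_complex (exchange 1 3) p v f)"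
    if p: "p \<in> topspace (Euclidean_space 4)" and "v \<in> tangent_space (flat_space 4) p" for p v
  proof -
    have "v \<in> range (flat_vec 4 p)" using that(2) by (simp add: tangent_space_flat_space[OF p])
    then obtain a where v: "v = flat_vec 4 p a" by blast
    show ?thesis
      unfolding v quat_complex_flat_vec[OF mem(1)] quat_complex_flat_vec[OF mem(2)]
        quat_complex_flat_vec[OF mem(3)] flat_vec_minus
      by (intro conjI flat_vec_cong) (unfold less_4_cases, auto simp: std_complex_exchange[simplified])
  qed
  then show ?thesis
    unfolding hyperkahler_def
    using smooth_manifold_flat_space riemannian_metric_flat_space K[OF mem(1)] K[OF mem(2)] K[OF mem(3)]
    by simp
qed

section \<open>The Kaehler forms in coordinates\<close>

definition kform :: "(nat \<Rightarrow> nat) \<Rightarrow> (nat \<Rightarrow> real) \<Rightarrow> (nat \<Rightarrow> real) \<Rightarrow> real" where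
  "kform \<pi> a b = (\<Sum>i<4. std_complex \<pi> a i * b i)"

lemma kahler_form_quat:
  "kahler_form (flat_metric 4) (quat_complex \<pi>) p v w = kform \<pi> (\<lambda>i. v (\<lambda>x. x i)) (\<lambda>i. w (\<lambda>x. x i))"
  by (simp add: kahler_form_def flat_metric_def quat_complex_def flat_endo_def kform_def)

lemma kform_exchange:
  "kform (exchange 1 2) a b = - a 2 * b 0 - a 3 * b (Suc 0) + a 0 * b 2 + a (Suc 0) * b 3"
  "kform (exchange 2 3) a b = - a (Suc 0) * b 0 + a 0 * b (Suc 0) + a 3 * b 2 - a 2 * b 3"
  "kform (exchange 1 3) a b = - a 3 * b 0 + a 2 * b (Suc 0) - a (Suc 0) * b 2 + a 0 * b 3"
  by (simp_all add: kform_def sum_below_4 std_complex_exchange[simplified])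

lemma kform_cong:
  assumes "\<pi> \<in> exchanges" "\<And>i. i < 4 \<Longrightarrow> a i = a' i" "\<And>i. i < 4 \<Longrightarrow> b i = b' i"
  shows "kform \<pi> a b = kform \<pi> a' b'"
  unfolding kform_def
proof (rule sum.cong)
  fix i assume "i \<in> {..<4::nat}"
  then have i: "i < 4" by simp
  have "std_complex \<pi> a i = std_complex \<pi> a' i"
    by (rule std_complex_cong[of 2]) (use i assms(2) involution_exchanges[OF assms(1)] in simp_all)
  then show "std_complex \<pi> a i * b i = std_complex \<pi> a' i * b' i" using assms(3)[OF i] by simp
qed simp

text \<open>Left multiplication by \<open>h\<close> commutes with the complex structures and scales
  the inner product by |h|^2.\<close>

lemma kform_qmul_qmul: "\<pi> \<in> exchanges \<Longrightarrow> kform \<pi> (qmul h a) (qmul h b) = qnorm2 h * kform \<pi> a b"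
  unfolding exchanges_def
  by (elim insertE emptyE; hypsubst; simp only: kform_exchange; simp add: qmul_def qnorm2_def algebra_simps)

text \<open>Left multiplications by \<open>h\<close> and by its conjugate are adjoint for the inner
  product, and they commute with the complex structure that \<open>kform\<close> applies to its
  first argument.\<close>

lemma kform_qmul_adjoint: "\<pi> \<in> exchanges \<Longrightarrow> kform \<pi> a (qmul h b) = kform \<pi> (qmul (qcnj h) a) b"
  unfolding exchanges_def
  by (elim insertE emptyE; hypsubst; simp only: kform_exchange; simp add: qmul_def qcnj_def algebra_simps)

lemma preserves_form_quat:
  assumes "\<pi> \<in> exchanges"
  shows "preserves_form sphere_group (flat_space 4) quat_action (kahler_form (flat_metric 4) (quat_complex \<pi>))"
  unfolding preserves_form_def
proof (intro ballI)
  fix h p v w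
  assume h: "h \<in> carrier sphere_group" and "p \<in> points (flat_space 4)"
    and v: "v \<in> tangent_space (flat_space 4) p" and w: "w \<in> tangent_space (flat_space 4) p"
  then have p: "p \<in> topspace (Euclidean_space 4)" by simp
  obtain a b where ab: "v = flat_vec 4 p a" "w = flat_vec 4 p b"
    using v w by (auto simp: tangent_space_flat_space[OF p])
  have push: "pushforward (flat_space 4) (quat_action h) (flat_vec 4 p a) (\<lambda>x. x i) = qmul h a i" for a i
  proof -
    have "flat_vec 4 p a (\<lambda>x. quat_action h x i) = flat_vec 4 p a (\<lambda>x. qmul h x i)"
      by (rule flat_vec_fun_cong[OF p]) simp
    then show ?thesis
      by (simp add: pushforward_def smooth_funs_flat_space smooth_on_coordinate
          flat_vec_quat_linear[OF quat_linear_qmul(2) p])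
  qed
  have "kform \<pi> (qmul h a) (qmul h b) = kform \<pi> a b"
    using h by (simp add: kform_qmul_qmul[OF assms] unit_quats_def)
  also have "\<dots> = kform \<pi> (\<lambda>i. v (\<lambda>x. x i)) (\<lambda>i. w (\<lambda>x. x i))"
    by (rule kform_cong[OF assms]) (simp_all add: ab)
  finally show "kahler_form (flat_metric 4) (quat_complex \<pi>) (quat_action h p)
      (pushforward (flat_space 4) (quat_action h) v) (pushforward (flat_space 4) (quat_action h) w) =
      kahler_form (flat_metric 4) (quat_complex \<pi>) p v w"
    unfolding kahler_form_quat unfolding ab push by simp
qed

subsection \<open>The moment map\<close>

text \<open>The inner abstraction turns a Lie algebra element into its quaternion. Halving
  compensates the 2 from differentiating a quadratic form, and the restriction makes the functional
  extensional as \<open>lie_algebra_dual\<close> demands.\<close>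

definition quat_moment :: "(nat \<Rightarrow> nat) \<Rightarrow> (nat \<Rightarrow> real) \<Rightarrow> (nat \<Rightarrow> real) tvec \<Rightarrow> real" where
  "quat_moment \<pi> p = restrict (\<lambda>X. kform \<pi> (qmul (\<lambda>j. X (\<lambda>x. x j)) p) p / 2)
     (lie_algebra sphere_group sphere_manifold)"

lemma quat_moment_lie_vec [simp]:
  "quat_moment \<pi> p (lie_vec a) = kform \<pi> (qmul (lie_quat a) p) p / 2"
  by (simp add: quat_moment_def lie_algebra_sphere lie_vec_coordinate)

lemma kform_qmul_linear:
  "\<pi> \<in> exchanges \<Longrightarrow>
     kform \<pi> (qmul (lie_quat (\<lambda>i. x * a i + y * b i)) p) q =
       x * kform \<pi> (qmul (lie_quat a) p) q + y * kform \<pi> (qmul (lie_quat b) p) q"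
  unfolding exchanges_def
  by (elim insertE emptyE; hypsubst; simp only: kform_exchange; simp add: qmul_def lie_quat_def algebra_simps)

text \<open>Left multiplication by an imaginary quaternion is skew, hence its composite with a commuting
  skew complex structure is symmetric; this turns the derivative of the quadratic moment map into
  the Kaehler form.\<close>

lemma pd_kform_qmul:
  assumes "\<pi> \<in> exchanges" "i < 4"
  shows "pd i (\<lambda>q. kform \<pi> (qmul (lie_quat a) q) q / 2) p =
    kform \<pi> (qmul (lie_quat a) p) (\<lambda>j. if j = i then 1 else 0)"
  using assms unfolding exchanges_def less_4_cases
  by (elim insertE emptyE disjE, simp_all only: kform_exchange)
     (rule pd_eqI, simp add: qmul_def lie_quat_def, (rule derivative_eq_intros refl)+, simp, simp add: field_simps)+

lemma smooth_on_kform_qmul: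
  "\<pi> \<in> exchanges \<Longrightarrow> smooth_on 4 (topspace (Euclidean_space 4)) (\<lambda>q. kform \<pi> (qmul c q) q / 2)"
  unfolding exchanges_def
  by (elim insertE emptyE; hypsubst; simp only: kform_exchange;
      intro smooth_on_divide smooth_on_add smooth_on_diff smooth_on_minus smooth_on_mult smooth_on_qmul
        smooth_on_const smooth_on_coordinate openin_topspace_Euclidean_space; simp)

lemma kform_expand:
  "kform \<pi> c b = (\<Sum>i<4. b i * kform \<pi> c (\<lambda>j. if j = i then 1 else 0))"
proof -
  have "kform \<pi> c (\<lambda>j. if j = i then 1 else 0) = std_complex \<pi> c i" if "i < 4" for i
  proof -
    have "kform \<pi> c (\<lambda>j. if j = i then 1 else 0) = (\<Sum>j<4. if j = i then std_complex \<pi> c j else 0)"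
      unfolding kform_def by (rule sum.cong) auto
    then show ?thesis using that by simp
  qed
  then show ?thesis by (simp add: kform_def mult.commute)
qed

lemma equivariant_moment_map_quat:
  assumes \<pi>: "\<pi> \<in> exchanges"
  shows "equivariant_moment_map sphere_group sphere_manifold (flat_space 4) quat_action
     (kahler_form (flat_metric 4) (quat_complex \<pi>)) (quat_moment \<pi>)"
  unfolding equivariant_moment_map_def
proof (intro conjI ballI)
  let ?T = "lie_algebra sphere_group sphere_manifold"
  fix p assume "p \<in> points (flat_space 4)"
  then have p: "p \<in> topspace (Euclidean_space 4)" by simp
  have "linear_functional_on ?T (quat_moment \<pi> p)"
    by (auto simp: linear_functional_on_def lie_algebra_sphere lie_vec_linear kform_qmul_linear[OF \<pi>] add_divide_distrib)
  then show "quat_moment \<pi> p \<in> lie_algebra_dual sphere_group sphere_manifold"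
    by (simp add: lie_algebra_dual_def quat_moment_def)
next
  fix X assume "X \<in> lie_algebra sphere_group sphere_manifold"
  then obtain a where X: "X = lie_vec a" by (auto simp: lie_algebra_sphere)
  show "(\<lambda>p. quat_moment \<pi> p X) \<in> smooth_funs (flat_space 4)"
    unfolding X quat_moment_lie_vec smooth_funs_flat_space by (rule smooth_on_kform_qmul[OF \<pi>])
next
  fix X p v
  assume "X \<in> lie_algebra sphere_group sphere_manifold" and "p \<in> points (flat_space 4)"
    and v: "v \<in> tangent_space (flat_space 4) p"
  then obtain a where X: "X = lie_vec a" and p: "p \<in> topspace (Euclidean_space 4)"
    by (auto simp: lie_algebra_sphere)
  obtain b where b: "v = flat_vec 4 p b" using v by (auto simp: tangent_space_flat_space[OF p])
  have fund: "fundamental_field (flat_space 4) quat_action X p (\<lambda>x. x j) = qmul (lie_quat a) p j" for j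
    using p by (simp add: fundamental_field_def pushforward_def smooth_funs_flat_space smooth_on_coordinate X
        lie_vec_quat_linear[OF quat_linear_qmul(1)])
  have "v (\<lambda>q. quat_moment \<pi> q X) = (\<Sum>i<4. b i * kform \<pi> (qmul (lie_quat a) p) (\<lambda>j. if j = i then 1 else 0))"
    unfolding b X quat_moment_lie_vec flat_vec_def
    using smooth_on_kform_qmul[OF \<pi>] by (simp add: pd_kform_qmul[OF \<pi>])
  also have "\<dots> = kform \<pi> (qmul (lie_quat a) p) b" by (rule kform_expand[symmetric])
  also have "\<dots> = kform \<pi> (qmul (lie_quat a) p) (\<lambda>i. v (\<lambda>x. x i))"
    by (rule kform_cong[OF \<pi>]) (simp_all add: b)
  finally show "v (\<lambda>q. quat_moment \<pi> q X) =
      kahler_form (flat_metric 4) (quat_complex \<pi>) p (fundamental_field (flat_space 4) quat_action X p) v"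
    by (simp add: kahler_form_quat fund)
next
  fix h p X
  assume "h \<in> carrier sphere_group" "p \<in> points (flat_space 4)"
    and XT: "X \<in> lie_algebra sphere_group sphere_manifold"
  then have h: "h \<in> unit_quats" and p: "p \<in> topspace (Euclidean_space 4)" by simp_all
  obtain a where X: "X = lie_vec a" using XT by (auto simp: lie_algebra_sphere)
  have inv: "inv\<^bsub>sphere_group\<^esub> h = qcnj h" by (rule inv_sphere_group[OF h])
  have cc: "qcnj (qcnj h) = h"
    by (rule quat_eqI) (use h in \<open>simp_all add: qcnj_def unit_quats_def\<close>)
  \<comment> \<open>The transformed vector must be known to lie in the Lie algebra, since
    \<open>quat_moment\<close> is undefined elsewhere. Equivariance is then the adjointness of
    \<open>h\<close> and its conjugate: X h p paired with h p equals h^* X h p paired with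
    p.\<close>
  have "quat_moment \<pi> p (Ad sphere_group sphere_manifold (qcnj h) X) =
      kform \<pi> (qmul (qmul (qmul (qcnj h) (lie_quat a)) h) p) p / 2"
    using Ad_in_lie_algebra[OF unit_quats_qcnj[OF h] XT]
    by (simp add: quat_moment_def X Ad_coordinate[OF unit_quats_qcnj[OF h]] cc)
  also have "\<dots> = quat_moment \<pi> (quat_action h p) X"
    by (simp add: X p kform_qmul_adjoint[OF \<pi>] qmul_assoc)
  finally show "quat_moment \<pi> (quat_action h p) X =
      quat_moment \<pi> p (Ad sphere_group sphere_manifold (inv\<^bsub>sphere_group\<^esub> h) X)"
    by (simp add: inv)
qed

definition quat_moment3 ::
  "(nat \<Rightarrow> real) \<Rightarrow> ((nat \<Rightarrow> real) tvec \<Rightarrow> real) \<times> ((nat \<Rightarrow> real) tvec \<Rightarrow> real) \<times> ((nat \<Rightarrow> real) tvec \<Rightarrow> real)"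
  where "quat_moment3 p =
    (quat_moment (exchange 1 2) p, quat_moment (exchange 2 3) p, quat_moment (exchange 1 3) p)"

lemma hyperkahler_moment_map_quat:
  "hyperkahler_moment_map sphere_group sphere_manifold (flat_space 4) (flat_metric 4)
     (quat_complex (exchange 1 2)) (quat_complex (exchange 2 3)) (quat_complex (exchange 1 3))
     quat_action quat_moment3"
  by (simp add: hyperkahler_moment_map_def quat_moment3_def equivariant_moment_map_quat exchanges_def)

lemma tri_hamiltonian_quat:
  "tri_hamiltonian sphere_group sphere_manifold (flat_space 4) (flat_metric 4)
     (quat_complex (exchange 1 2)) (quat_complex (exchange 2 3)) (quat_complex (exchange 1 3)) quat_action"
  unfolding tri_hamiltonian_def
  using smooth_action_quat preserves_form_quat hyperkahler_moment_map_quat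
  by (auto simp: exchanges_def)

lemma quat_moment3_in_imH_dual:
  "p \<in> topspace (Euclidean_space 4) \<Longrightarrow> quat_moment3 p \<in> imH_dual sphere_group sphere_manifold"
  using equivariant_moment_map_quat
  by (simp add: equivariant_moment_map_def imH_dual_def quat_moment3_def exchanges_def)

section \<open>A missed value and a disconnected fibre\<close>

lemma quat_moment_not_surjective:
  "quat_moment3 ` topspace (Euclidean_space 4) \<noteq> imH_dual sphere_group sphere_manifold"
proof
  assume surj: "quat_moment3 ` topspace (Euclidean_space 4) = imH_dual sphere_group sphere_manifold"
  let ?T = "lie_algebra sphere_group sphere_manifold"
  \<comment> \<open>The missed value is \<open>(\<beta>, \<zeta>, \<zeta>)\<close>, with
    \<open>\<beta>\<close> twice the first chart coordinate and \<open>\<zeta>\<close> zero.\<close>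
  define \<beta> where "\<beta> = restrict (\<lambda>X. X (\<lambda>x. x (Suc 0))) ?T"
  define \<zeta> where "\<zeta> = restrict (\<lambda>X::(nat \<Rightarrow> real) tvec. 0 :: real) ?T"
  have "linear_functional_on ?T \<beta>" "linear_functional_on ?T \<zeta>"
    by (auto simp: linear_functional_on_def lie_algebra_sphere lie_vec_linear lie_vec_coordinate \<beta>_def \<zeta>_def
        lie_quat_def)
  then have "(\<beta>, \<zeta>, \<zeta>) \<in> imH_dual sphere_group sphere_manifold"
    by (simp add: imH_dual_def lie_algebra_dual_def \<beta>_def \<zeta>_def)
  then obtain p where p: "quat_moment3 p = (\<beta>, \<zeta>, \<zeta>)"
    using surj by (metis imageE)
  let ?e = "\<lambda>k i. if i = k then 1 else 0 :: real"
  have "kform (exchange 2 3) (qmul (lie_quat (?e k)) p) p = 0" for k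
    using p quat_moment_lie_vec[of "exchange 2 3" p "?e k"]
    by (simp add: quat_moment3_def \<zeta>_def lie_algebra_sphere)
  from this[of 0] this[of "Suc 0"] this[of 2]
  \<comment> \<open>Up to non-zero factors, the three coordinates of p i p^*.\<close>
  have E: "p 0 * p 0 + p (Suc 0) * p (Suc 0) - p 2 * p 2 - p 3 * p 3 = 0"
    "p (Suc 0) * p 2 + p 0 * p 3 = 0" "p (Suc 0) * p 3 - p 0 * p 2 = 0"
    unfolding kform_exchange by (simp_all add: qmul_def lie_quat_def algebra_simps)
  \<comment> \<open>|p i p^*|^2 = |p|^4 written out; each 4 is the square of the factor 2 that the
    last two equations of \<open>E\<close> have lost. So a vanishing second component forces p = 0,
    and with it a vanishing first component.\<close>
  have "qnorm2 p * qnorm2 p =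
      (p 0 * p 0 + p (Suc 0) * p (Suc 0) - p 2 * p 2 - p 3 * p 3) * (p 0 * p 0 + p (Suc 0) * p (Suc 0) - p 2 * p 2 - p 3 * p 3)
      + 4 * ((p (Suc 0) * p 2 + p 0 * p 3) * (p (Suc 0) * p 2 + p 0 * p 3))
      + 4 * ((p (Suc 0) * p 3 - p 0 * p 2) * (p (Suc 0) * p 3 - p 0 * p 2))"
    by (simp add: qnorm2_def algebra_simps)
  then have "qnorm2 p = 0" unfolding E by simp
  then have "p 0 = 0 \<and> p (Suc 0) = 0 \<and> p 2 = 0 \<and> p 3 = 0"
    unfolding qnorm2_def by (smt (verit) not_real_square_gt_zero zero_le_square)
  then have "kform (exchange 1 2) (qmul (lie_quat (?e 0)) p) p = 0"
    unfolding kform_exchange by simp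
  moreover have "\<beta> (lie_vec (?e 0)) = 2"
    by (simp add: \<beta>_def lie_algebra_sphere lie_vec_coordinate lie_quat_def)
  ultimately show False
    using p quat_moment_lie_vec[of "exchange 1 2" p "?e 0"] by (simp add: quat_moment3_def)
qed

text \<open>The fibre through 1 contains -1 but misses the hyperplane of imaginary quaternions.\<close>

lemma quat_moment_fibre_disconnected:
  "\<not> connectedin (Euclidean_space 4) {p \<in> topspace (Euclidean_space 4). quat_moment3 p = quat_moment3 qone}"
    (is "\<not> connectedin _ ?F")
proof
  assume "connectedin (Euclidean_space 4) ?F"
  moreover have "continuous_map (Euclidean_space 4) euclideanreal (\<lambda>x. x 0)"
    by (simp add: continuous_map_Euclidean_space_iff continuous_on_subset[OF continuous_on_product_coordinates])
  ultimately have "connectedin euclideanreal ((\<lambda>x. x 0) ` ?F)"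
    by (rule connectedin_continuous_map_image[rotated])
  then have conn: "connected ((\<lambda>x. x 0) ` ?F)" by simp
  \<comment> \<open>The moment map is quadratic in the point, hence takes the same value at 1 and
    -1.\<close>
  have "kform \<pi> (qmul c (quat (- 1) 0 0 0)) (quat (- 1) 0 0 0) = kform \<pi> (qmul c qone) qone"
    if "\<pi> \<in> exchanges" for \<pi> c
    using that unfolding exchanges_def
    by (elim insertE emptyE; hypsubst; simp only: kform_exchange; simp add: qmul_def qone_def)
  then have "quat_moment3 (quat (- 1) 0 0 0) = quat_moment3 qone"
    by (simp add: quat_moment3_def quat_moment_def exchanges_def)
  then have "quat (- 1) 0 0 0 \<in> ?F" by simp
  then have "- 1 \<in> (\<lambda>x. x 0) ` ?F" by (rule rev_image_eqI) simp
  moreover have "qone \<in> ?F" by simp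
  then have "1 \<in> (\<lambda>x. x 0) ` ?F" by (rule rev_image_eqI) (simp add: qone_def)
  ultimately have "0 \<in> (\<lambda>x. x 0) ` ?F"
    using connectedD_interval[OF conn, of "- 1" 1 0] by simp
  then obtain p where p0: "p 0 = 0" and p: "quat_moment3 p = quat_moment3 qone" by auto
  let ?e = "\<lambda>k i. if i = k then 1 else 0 :: real"
  have eq: "quat_moment \<pi> p (lie_vec a) = quat_moment \<pi> qone (lie_vec a)" if "\<pi> \<in> exchanges" for \<pi> a
  proof -
    have "quat_moment \<pi> p = quat_moment \<pi> qone"
      using p that by (auto simp: quat_moment3_def exchanges_def)
    then show ?thesis by (rule fun_cong)
  qed
  have "kform \<pi> (qmul (lie_quat a) p) p = kform \<pi> (qmul (lie_quat a) qone) qone" if "\<pi> \<in> exchanges" for \<pi> a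
    using eq[OF that, of a] by simp
  \<comment> \<open>Each complex structure is paired with its own axis, which yields the diagonal
    entries of a -> p a p^* and hence its trace. At p = 1 the trace is 3; for imaginary p the map is
    |p|^2 times a half-turn, of trace -|p|^2. Accordingly the sum of the three resulting equations
    is contradictory.\<close>
  then have "kform (exchange 2 3) (qmul (lie_quat (?e 0)) p) p = kform (exchange 2 3) (qmul (lie_quat (?e 0)) qone) qone"
    "kform (exchange 1 2) (qmul (lie_quat (?e (Suc 0))) p) p = kform (exchange 1 2) (qmul (lie_quat (?e (Suc 0))) qone) qone"
    "kform (exchange 1 3) (qmul (lie_quat (?e 2)) p) p = kform (exchange 1 3) (qmul (lie_quat (?e 2)) qone) qone"
    by (simp_all add: exchanges_def)
  then have "p (Suc 0) * p (Suc 0) - p 2 * p 2 - p 3 * p 3 = 1"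
    "p 2 * p 2 - p (Suc 0) * p (Suc 0) - p 3 * p 3 = 1"
    "p 3 * p 3 - p (Suc 0) * p (Suc 0) - p 2 * p 2 = 1"
    unfolding kform_exchange by (simp_all add: qmul_def lie_quat_def qone_def p0 algebra_simps)
  moreover have "0 \<le> p (Suc 0) * p (Suc 0)" "0 \<le> p 2 * p 2" "0 \<le> p 3 * p 3" by simp_all
  ultimately show False by linarith
qed

theorem mainTheorem4:
  shows "\<exists>(G :: label monoid) (MG :: label manifold) (M :: label manifold) g I J K act \<mu>.
    lie_group G MG \<and> connected_space (mtop MG) \<and> \<not> comm_group G \<and>
    hyperkahler M g I J K \<and> connected_space (mtop M) \<and> complete_riemannian M g \<and>
    tri_hamiltonian G MG M g I J K act \<and> faithful_action G (points M) act \<and>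
    hyperkahler_moment_map G MG M g I J K act \<mu> \<and>
    \<mu> ` points M \<noteq> imH_dual G MG \<and>
    (\<exists>\<alpha>\<in>imH_dual G MG. {p \<in> points M. \<mu> p = \<alpha>} \<noteq> {} \<and>
       \<not> connectedin (mtop M) {p \<in> points M. \<mu> p = \<alpha>})"
proof (intro exI conjI)
  show "lie_group sphere_group sphere_manifold" by (rule lie_group_sphere)
  show "connected_space (mtop sphere_manifold)" by (simp add: connected_space_nsphere_3)
  show "\<not> comm_group sphere_group" by (rule not_comm_sphere_group)
  show "hyperkahler (flat_space 4) (flat_metric 4)
     (quat_complex (exchange 1 2)) (quat_complex (exchange 2 3)) (quat_complex (exchange 1 3))"
    by (rule hyperkahler_quat)
  show "connected_space (mtop (flat_space 4))" by (simp add: connected_Euclidean_space)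
  show "complete_riemannian (flat_space 4) (flat_metric 4)" by (rule complete_riemannian_flat_space)
  show "tri_hamiltonian sphere_group sphere_manifold (flat_space 4) (flat_metric 4)
     (quat_complex (exchange 1 2)) (quat_complex (exchange 2 3)) (quat_complex (exchange 1 3)) quat_action"
    by (rule tri_hamiltonian_quat)
  show "faithful_action sphere_group (points (flat_space 4)) quat_action"
    by (simp add: faithful_action_quat)
  show "hyperkahler_moment_map sphere_group sphere_manifold (flat_space 4) (flat_metric 4)
     (quat_complex (exchange 1 2)) (quat_complex (exchange 2 3)) (quat_complex (exchange 1 3))
     quat_action quat_moment3"
    by (rule hyperkahler_moment_map_quat)
  show "quat_moment3 ` points (flat_space 4) \<noteq> imH_dual sphere_group sphere_manifold"
    using quat_moment_not_surjective by simp
  show "\<exists>\<alpha>\<in>imH_dual sphere_group sphere_manifold. {p \<in> points (flat_space 4). quat_moment3 p = \<alpha>} \<noteq> {} \<and>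
       \<not> connectedin (mtop (flat_space 4)) {p \<in> points (flat_space 4). quat_moment3 p = \<alpha>}"
  proof (rule bexI[of _ "quat_moment3 qone"])
    show "quat_moment3 qone \<in> imH_dual sphere_group sphere_manifold"
      by (simp add: quat_moment3_in_imH_dual)
    have "qone \<in> {p \<in> points (flat_space 4). quat_moment3 p = quat_moment3 qone}" by simp
    then show "{p \<in> points (flat_space 4). quat_moment3 p = quat_moment3 qone} \<noteq> {} \<and>
       \<not> connectedin (mtop (flat_space 4)) {p \<in> points (flat_space 4). quat_moment3 p = quat_moment3 qone}"
      using quat_moment_fibre_disconnected unfolding flat_space_simps(1) by (intro conjI; blast)
  qed
qed

end
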